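(* Let $R$ be a reduced irreducible root system of rank $n$ with Weyl group $W$, $H$ the associated adjoint torus, $H^{\circ}\subset H$ the complement of the toric mirrors, $\kappa=(k_\alpha)_{\alpha\in R}$ a $W$-invariant multiplicity parameter, $a^{\kappa}:\mathfrak h\times\mathfrak h\to\mathbb C$ a $W$-invariant symmetric bilinear form, and $b^{\kappa}:\mathfrak h\times\mathfrak h\to\mathfrak h$ a $W$-equivariant symmetric bilinear map. The system of $n(n+1)/2$ linearly independent differential equations for $f\in\mathcal O_{H^{\circ}}$ $$\Big(\partial_u\partial_v+\tfrac12\sum_{\alpha>0}k_\alpha\,\alpha(u)\alpha(v)\,\frac{e^{\alpha}(h)+1}{e^{\alpha}(h)-1}\,\partial_{\alpha^\vee}+\partial_{b^{\kappa}(u,v)}+a^{\kappa}(u,v)\Big)f(h)=0\qquad\text{for all }u,v\in\mathfrak h$$ is an integrable system on $H^{\circ}$ if and only if $-A^{\kappa}$ represents the curvature of $\nabla^{\kappa}$, that is, $\nabla^{\kappa}\nabla^{\kappa}(\zeta)=-\zeta\wedge A^{\kappa}$ for all $\zeta\in\Omega_{H^{\circ}}$.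
   Context: Setting: $\mathfrak a$ is a Euclidean vector space of dimension $n$, $R\subset\mathfrak a^*$ a reduced irreducible crystallographic root system spanning $\mathfrak a^*$, $W$ its Weyl group; sums over $\alpha>0$ are over positive roots. $Q=\mathbb ZR$, $P^\vee=\mathrm{Hom}(Q,\mathbb Z)\subset\mathfrak a$, $H=\mathrm{Hom}(Q,\mathbb C^\times)$, $\mathfrak h=\mathbb C\otimes\mathfrak a$ its Lie algebra, $H=\mathfrak h/2\pi\sqrt{-1}P^\vee$. $e^\alpha$ is the character of $H$ defined by $\alpha$, $H_\alpha=\{h\in H: e^\alpha(h)=1\}$, $H^\circ=H-\bigcup_{\alpha\in R}H_\alpha$. For $v\in\mathfrak h$, $\partial_v$ is the translation invariant vector field on $H$; for $\phi\in\mathfrak h^*$, $d\phi$ is the translation invariant differential; $\alpha^\vee\in\mathfrak h$ is the coroot ($\alpha(\alpha^\vee)=2$). $\kappa=(k_\alpha)_{\alpha\in R}\in\mathbb C^R$ is $W$-invariant. $\nabla^0$ is the flat translation invariant connection on the cotangent bundle of $H$, $A^\kappa$ is the translation invariant symmetric tensor field (section of $\Omega_H\otimes\Omega_H$) defined by $a^\kappa$, and for a $1$-form $\zeta$, $(B^\kappa)^*(\zeta)$ is the section of $\Omega\otimes\Omega$ with $(B^\kappa)^*(\zeta)(\partial_u,\partial_v)=\zeta(\partial_{b^\kappa(u,v)})$. The connection $\nabla^\kappa=\nabla^0+\Omega^\kappa$ on $\Omega_{H^\circ}$ is given by $$\Omega^\kappa(\zeta)=\tfrac12\sum_{\alpha>0}k_\alpha\frac{e^\alpha+1}{e^\alpha-1}\,\zeta(\partial_{\alpha^\vee})\,d\alpha\otimes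 d\alpha+(B^\kappa)^*(\zeta).$$ A connection $\nabla$ is extended by $\nabla(\omega\otimes\zeta)=d\omega\otimes\zeta-\omega\wedge\nabla\zeta$ for $1$-forms $\omega$, so the curvature is $\nabla\nabla:\Omega\to\Omega^2\otimes\Omega$. For $A=\sum A_{ij}dz^i\otimes dz^j$, $\zeta\wedge A:=\sum A_{ij}(\zeta\wedge dz^i)\otimes dz^j$. "Integrable" means that the local solution space near every point of $H^\circ$ has the maximal possible dimension $n+1$. *)

theory Defs
  imports "HOL-Analysis.Analysis"
begin

text \<open>
  The Euclidean space \<open>\<aa>\<close> is \<open>real ^ 'n\<close>, and its dual is identified with it by the inner product:
  a vector \<open>\<alpha>\<close> stands for the functional \<open>x \<mapsto> \<alpha> \<bullet> x\<close>. The complexification \<open>\<hh>\<close> is \<open>complex ^ 'n\<close>.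
\<close>

section \<open>Root systems and Weyl groups\<close>

definition reflection :: "real ^ 'n \<Rightarrow> real ^ 'n \<Rightarrow> real ^ 'n" where
  "reflection \<alpha> x = x - (2 * (\<alpha> \<bullet> x) / (\<alpha> \<bullet> \<alpha>)) *\<^sub>R \<alpha>"

definition root_system :: "(real ^ 'n) set \<Rightarrow> bool" where
  "root_system R \<longleftrightarrow>
     finite R \<and> 0 \<notin> R \<and> span R = UNIV \<and>
     (\<forall>\<alpha>\<in>R. reflection \<alpha> ` R \<subseteq> R) \<and>
     (\<forall>\<alpha>\<in>R. \<forall>\<beta>\<in>R. 2 * (\<alpha> \<bullet> \<beta>) / (\<alpha> \<bullet> \<alpha>) \<in> \<int>)"

definition reduced_roots :: "(real ^ 'n) set \<Rightarrow> bool" where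
  "reduced_roots R \<longleftrightarrow> (\<forall>\<alpha>\<in>R. \<forall>c. c *\<^sub>R \<alpha> \<in> R \<longrightarrow> c = 1 \<or> c = -1)"

definition irreducible_roots :: "(real ^ 'n) set \<Rightarrow> bool" where
  "irreducible_roots R \<longleftrightarrow>
     \<not> (\<exists>R1 R2. R1 \<noteq> {} \<and> R2 \<noteq> {} \<and> R1 \<union> R2 = R \<and> (\<forall>\<alpha>\<in>R1. \<forall>\<beta>\<in>R2. \<alpha> \<bullet> \<beta> = 0))"

definition positive_system :: "(real ^ 'n) set \<Rightarrow> (real ^ 'n) set \<Rightarrow> bool" where
  "positive_system R Rp \<longleftrightarrow> (\<exists>\<xi>. (\<forall>\<alpha>\<in>R. \<alpha> \<bullet> \<xi> \<noteq> 0) \<and> Rp = {\<alpha> \<in> R. \<alpha> \<bullet> \<xi> > 0})"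

text \<open>Reflections are involutions, so closing under composition already gives a group.\<close>

inductive_set weyl_group :: "(real ^ 'n) set \<Rightarrow> (real ^ 'n \<Rightarrow> real ^ 'n) set" for R where
  weyl_id: "id \<in> weyl_group R"
| weyl_reflection: "w \<in> weyl_group R \<Longrightarrow> \<alpha> \<in> R \<Longrightarrow> reflection \<alpha> \<circ> w \<in> weyl_group R"

section \<open>The complexification\<close>

definition cvec :: "real ^ 'n \<Rightarrow> complex ^ 'n" where
  "cvec x = (\<chi> i. complex_of_real (x $ i))"

definition complexify :: "(real ^ 'n \<Rightarrow> real ^ 'n) \<Rightarrow> complex ^ 'n \<Rightarrow> complex ^ 'n" where
  "complexify w u = cvec (w (\<chi> i. Re (u $ i))) + \<i> *s cvec (w (\<chi> i. Im (u $ i)))"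

text \<open>The value \<open>\<alpha>(u)\<close> of the complex-linear extension of \<open>\<alpha>\<close> at \<open>u\<close>.\<close>

definition root_eval :: "real ^ 'n \<Rightarrow> complex ^ 'n \<Rightarrow> complex" where
  "root_eval \<alpha> u = (\<Sum>i\<in>UNIV. complex_of_real (\<alpha> $ i) * u $ i)"

definition coroot :: "real ^ 'n \<Rightarrow> complex ^ 'n" where
  "coroot \<alpha> = cvec ((2 / (\<alpha> \<bullet> \<alpha>)) *\<^sub>R \<alpha>)"

definition sym_bilinear ::
  "(complex \<Rightarrow> 'b \<Rightarrow> 'b :: ab_group_add) \<Rightarrow> (complex ^ 'n \<Rightarrow> complex ^ 'n \<Rightarrow> 'b) \<Rightarrow> bool" where
  "sym_bilinear scl B \<longleftrightarrow>
     (\<forall>u. Vector_Spaces.linear (*s) scl (B u)) \<and> (\<forall>u v. B u v = B v u)"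

section \<open>The adjoint torus\<close>

definition root_lattice :: "(real ^ 'n) set \<Rightarrow> (real ^ 'n) set" where
  "root_lattice R = {\<Sum>\<alpha>\<in>R. real_of_int (m \<alpha>) *\<^sub>R \<alpha> | m. True}"

text \<open>
  \<open>H = Hom(Q, \<complex>\<^sup>\<times>)\<close>, each homomorphism being extended by the dummy value \<open>1\<close> outside \<open>Q\<close>.
  The character \<open>e\<^sup>\<alpha>\<close> is \<open>h \<mapsto> h \<alpha>\<close>. The topology is that of pointwise convergence, that is,
  the subspace topology from \<open>real ^ 'n \<Rightarrow> complex\<close>.
\<close>

type_synonym 'n torus_pt = "real ^ 'n \<Rightarrow> complex"

definition torus :: "(real ^ 'n) set \<Rightarrow> 'n torus_pt set" where
  "torus R =
     {h. (\<forall>x\<in>root_lattice R. \<forall>y\<in>root_lattice R. h (x + y) = h x * h y) \<and>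
         (\<forall>x\<in>root_lattice R. h x \<noteq> 0) \<and> (\<forall>x. x \<notin> root_lattice R \<longrightarrow> h x = 1)}"

definition torus_reg :: "(real ^ 'n) set \<Rightarrow> 'n torus_pt set" where
  "torus_reg R = {h \<in> torus R. \<forall>\<alpha>\<in>R. h \<alpha> \<noteq> 1}"

text \<open>Open subsets of \<open>H\<^sup>\<circ>\<close>, which is itself open in \<open>H\<close>.\<close>

definition open_reg :: "(real ^ 'n) set \<Rightarrow> 'n torus_pt set \<Rightarrow> bool" where
  "open_reg R U \<longleftrightarrow> openin (top_of_set (torus R)) U \<and> U \<subseteq> torus_reg R"

definition torus_exp :: "(real ^ 'n) set \<Rightarrow> complex ^ 'n \<Rightarrow> 'n torus_pt" where
  "torus_exp R u = (\<lambda>x. if x \<in> root_lattice R then exp (root_eval x u) else 1)"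

definition translate :: "(real ^ 'n) set \<Rightarrow> complex ^ 'n \<Rightarrow> 'n torus_pt \<Rightarrow> 'n torus_pt" where
  "translate R u h = (\<lambda>x. h x * torus_exp R u x)"

text \<open>The complex structure of \<open>H\<close>: near \<open>h\<close> the map \<open>u \<mapsto> h \<cdot> exp u\<close> is a holomorphic chart.\<close>

definition holomorphic_fun ::
  "(real ^ 'n) set \<Rightarrow> 'n torus_pt set \<Rightarrow> ('n torus_pt \<Rightarrow> complex) \<Rightarrow> bool" where
  "holomorphic_fun R U f \<longleftrightarrow>
     (\<forall>h\<in>U. \<exists>D. Vector_Spaces.linear (*s) (*) D \<and>
                 ((\<lambda>u. f (translate R u h)) has_derivative D) (at 0))"

text \<open>The translation invariant vector field \<open>\<partial>\<^sub>v\<close>.\<close>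

definition pd :: "(real ^ 'n) set \<Rightarrow> complex ^ 'n \<Rightarrow> ('n torus_pt \<Rightarrow> complex) \<Rightarrow> 'n torus_pt \<Rightarrow> complex"
  where "pd R v f h = deriv (\<lambda>t. f (translate R (t *s v) h)) 0"

section \<open>Tensor fields and connections\<close>

text \<open>
  Translations trivialise the tangent bundle, with fibre \<open>\<hh>\<close>; a tensor field is given by its values on
  the fields \<open>\<partial>\<^sub>u\<close>. Thus \<open>\<zeta> h u = \<zeta>(\<partial>\<^sub>u)(h)\<close> for a 1-form and \<open>T h u v = T(\<partial>\<^sub>u, \<partial>\<^sub>v)(h)\<close> for a section of
  \<open>\<Omega> \<otimes> \<Omega>\<close>. For a section of \<open>\<Omega>\<^sup>2 \<otimes> \<Omega>\<close> the first two arguments belong to the 2-form. The normalisation is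
  \<open>(\<omega> \<and> \<eta>)(u, v) = \<omega>(u) \<eta>(v) - \<omega>(v) \<eta>(u)\<close>.
\<close>

type_synonym 'n field1 = "'n torus_pt \<Rightarrow> complex ^ 'n \<Rightarrow> complex"
type_synonym 'n field2 = "'n torus_pt \<Rightarrow> complex ^ 'n \<Rightarrow> complex ^ 'n \<Rightarrow> complex"
type_synonym 'n field3 = "'n torus_pt \<Rightarrow> complex ^ 'n \<Rightarrow> complex ^ 'n \<Rightarrow> complex ^ 'n \<Rightarrow> complex"

definition one_form :: "(real ^ 'n) set \<Rightarrow> 'n torus_pt set \<Rightarrow> 'n field1 \<Rightarrow> bool" where
  "one_form R U \<zeta> \<longleftrightarrow>
     (\<forall>h\<in>U. Vector_Spaces.linear (*s) (*) (\<zeta> h)) \<and> (\<forall>v. holomorphic_fun R U (\<lambda>h. \<zeta> h v))"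

definition ext_d :: "(real ^ 'n) set \<Rightarrow> 'n field1 \<Rightarrow> 'n field2" where
  "ext_d R \<omega> h u v = pd R u (\<lambda>g. \<omega> g v) h - pd R v (\<lambda>g. \<omega> g u) h"

definition wedge :: "'n field1 \<Rightarrow> 'n field2 \<Rightarrow> 'n field3" where
  "wedge \<omega> T h u v w = \<omega> h u * T h v w - \<omega> h v * T h u w"

definition dz :: "'n :: finite \<Rightarrow> 'n field1" where
  "dz j h v = v $ j"

text \<open>
  The extension \<open>\<nabla>(\<omega> \<otimes> \<eta>) = d\<omega> \<otimes> \<eta> - \<omega> \<and> \<nabla>\<eta>\<close>, applied to \<open>T = \<Sum>\<^sub>j \<omega>\<^sub>j \<otimes> dz\<^sub>j\<close> with
  \<open>\<omega>\<^sub>j = T(\<cdot>, e\<^sub>j)\<close>.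
\<close>

definition ext_conn :: "(real ^ 'n) set \<Rightarrow> ('n field1 \<Rightarrow> 'n field2) \<Rightarrow> 'n field2 \<Rightarrow> 'n field3" where
  "ext_conn R conn T h u v w =
     (\<Sum>j\<in>UNIV. let \<omega> = (\<lambda>g x. T g x (axis j 1)) in
        ext_d R \<omega> h u v * dz j h w - wedge \<omega> (conn (dz j)) h u v w)"

definition curvature :: "(real ^ 'n) set \<Rightarrow> ('n field1 \<Rightarrow> 'n field2) \<Rightarrow> 'n field1 \<Rightarrow> 'n field3" where
  "curvature R conn \<zeta> = ext_conn R conn (conn \<zeta>)"

text \<open>The fields \<open>\<partial>\<^sub>v\<close> are flat for \<open>\<nabla>\<^sup>0\<close>.\<close>

definition nabla0 :: "(real ^ 'n) set \<Rightarrow> 'n field1 \<Rightarrow> 'n field2" where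
  "nabla0 R \<zeta> h u v = pd R u (\<lambda>g. \<zeta> g v) h"

definition Omega_form ::
  "(real ^ 'n) set \<Rightarrow> (real ^ 'n \<Rightarrow> complex) \<Rightarrow> (complex ^ 'n \<Rightarrow> complex ^ 'n \<Rightarrow> complex ^ 'n)
     \<Rightarrow> 'n field1 \<Rightarrow> 'n field2" where
  "Omega_form Rp k b \<zeta> h u v =
     1/2 * (\<Sum>\<alpha>\<in>Rp. k \<alpha> * ((h \<alpha> + 1) / (h \<alpha> - 1)) * \<zeta> h (coroot \<alpha>) * (root_eval \<alpha> u * root_eval \<alpha> v))
     + \<zeta> h (b u v)"

definition nabla ::
  "(real ^ 'n) set \<Rightarrow> (real ^ 'n) set \<Rightarrow> (real ^ 'n \<Rightarrow> complex)
     \<Rightarrow> (complex ^ 'n \<Rightarrow> complex ^ 'n \<Rightarrow> complex ^ 'n) \<Rightarrow> 'n field1 \<Rightarrow> 'n field2" where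
  "nabla R Rp k b \<zeta> h u v = nabla0 R \<zeta> h u v + Omega_form Rp k b \<zeta> h u v"

definition A_field :: "(complex ^ 'n \<Rightarrow> complex ^ 'n \<Rightarrow> complex) \<Rightarrow> 'n field2" where
  "A_field a h u v = a u v"

section \<open>The system of differential equations\<close>

definition solution ::
  "(real ^ 'n) set \<Rightarrow> (real ^ 'n) set \<Rightarrow> (real ^ 'n \<Rightarrow> complex)
     \<Rightarrow> (complex ^ 'n \<Rightarrow> complex ^ 'n \<Rightarrow> complex) \<Rightarrow> (complex ^ 'n \<Rightarrow> complex ^ 'n \<Rightarrow> complex ^ 'n)
     \<Rightarrow> 'n torus_pt set \<Rightarrow> ('n torus_pt \<Rightarrow> complex) \<Rightarrow> bool" where
  "solution R Rp k a b U f \<longleftrightarrow>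
     holomorphic_fun R U f \<and>
     (\<forall>h\<in>U. \<forall>u v.
        pd R u (pd R v f) h
        + 1/2 * (\<Sum>\<alpha>\<in>Rp. k \<alpha> * root_eval \<alpha> u * root_eval \<alpha> v * ((h \<alpha> + 1) / (h \<alpha> - 1))
                     * pd R (coroot \<alpha>) f h)
        + pd R (b u v) f h + a u v * f h = 0)"

definition local_solutions ::
  "(real ^ 'n) set \<Rightarrow> (real ^ 'n) set \<Rightarrow> (real ^ 'n \<Rightarrow> complex)
     \<Rightarrow> (complex ^ 'n \<Rightarrow> complex ^ 'n \<Rightarrow> complex) \<Rightarrow> (complex ^ 'n \<Rightarrow> complex ^ 'n \<Rightarrow> complex ^ 'n)
     \<Rightarrow> 'n torus_pt \<Rightarrow> ('n torus_pt \<Rightarrow> complex) set" where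
  "local_solutions R Rp k a b p = {f. \<exists>U. open_reg R U \<and> p \<in> U \<and> solution R Rp k a b U f}"

definition germ_eq ::
  "(real ^ 'n) set \<Rightarrow> 'n torus_pt \<Rightarrow> ('n torus_pt \<Rightarrow> complex) \<Rightarrow> ('n torus_pt \<Rightarrow> complex) \<Rightarrow> bool" where
  "germ_eq R p f g \<longleftrightarrow> (\<exists>U. open_reg R U \<and> p \<in> U \<and> (\<forall>h\<in>U. f h = g h))"

text \<open>The germs at \<open>p\<close> of the functions in \<open>S\<close> form a space with a basis of \<open>d\<close> elements.\<close>

definition has_germ_dim ::
  "(real ^ 'n) set \<Rightarrow> 'n torus_pt \<Rightarrow> ('n torus_pt \<Rightarrow> complex) set \<Rightarrow> nat \<Rightarrow> bool" where
  "has_germ_dim R p S d \<longleftrightarrow>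
     (\<exists>F :: nat \<Rightarrow> 'n torus_pt \<Rightarrow> complex.
        (\<forall>i<d. F i \<in> S) \<and>
        (\<forall>c. germ_eq R p (\<lambda>h. \<Sum>i<d. c i * F i h) (\<lambda>h. 0) \<longrightarrow> (\<forall>i<d. c i = 0)) \<and>
        (\<forall>f\<in>S. \<exists>c. germ_eq R p f (\<lambda>h. \<Sum>i<d. c i * F i h)))"

definition integrable_system ::
  "(real ^ 'n) set \<Rightarrow> (real ^ 'n) set \<Rightarrow> (real ^ 'n \<Rightarrow> complex)
     \<Rightarrow> (complex ^ 'n \<Rightarrow> complex ^ 'n \<Rightarrow> complex) \<Rightarrow> (complex ^ 'n \<Rightarrow> complex ^ 'n \<Rightarrow> complex ^ 'n)
     \<Rightarrow> bool" where
  "integrable_system R Rp k a b \<longleftrightarrow>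
     (\<forall>p\<in>torus_reg R. has_germ_dim R p (local_solutions R Rp k a b p) (CARD('n) + 1))"

end

theory Submission
  imports Defs "HOL-Complex_Analysis.Cauchy_Integral_Formula"
begin

text \<open>
  Write \<open>\<Gamma>(u, v)\<close> for the vector field with \<open>\<nabla>\<^sup>\<kappa>\<zeta>(\<partial>\<^sub>u, \<partial>\<^sub>v) = \<partial>\<^sub>u(\<zeta>(\<partial>\<^sub>v)) + \<zeta>(\<Gamma>(u, v))\<close>. The curvature of
  \<open>\<nabla>\<^sup>\<kappa>\<close> is \<open>\<zeta> \<mapsto> \<zeta> \<circ> K\<close> with
  \<open>K(u, v)w = (\<partial>\<^sub>u\<Gamma>)(v, w) - (\<partial>\<^sub>v\<Gamma>)(u, w) - \<Gamma>(u, \<Gamma>(v, w)) + \<Gamma>(v, \<Gamma>(u, w))\<close>, so the curvature equation says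
  \<open>K(u, v)w = a(u, w)v - a(v, w)u\<close>. The differential equations express the derivatives of the jet
  \<open>(f, \<partial>\<^sub>1f, \<dots>, \<partial>\<^sub>nf)\<close> linearly in the jet. A solution is determined by its jet at a point, so if the
  solutions have dimension \<open>n + 1\<close> then every jet occurs, and the symmetry of the third derivatives
  gives the curvature equation. Conversely, the curvature equation and the symmetry of
  \<open>a(u, \<Gamma>(v, w))\<close> in \<open>u\<close> and \<open>v\<close>, which follows from the invariance of \<open>a\<close> and \<open>b\<close>, make the linear
  system for the jets flat, and the holomorphic Frobenius theorem provides a solution for every jet.
\<close>

section \<open>Holomorphic functions of several variables\<close>

text \<open>Holomorphy is given as bare complex differentiability at each point, so second
  derivatives, their symmetry and limits of solutions must be derived. Cauchy's formula on complex
  lines does this: it writes a directional derivative as an integral of the function itself, which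
  can be differentiated under the integral sign and compared in both orders. The Frobenius theorem
  rests on Picard iteration along rays. A ray integral controls the radial derivative only. The
  homotopy formula of the Poincare lemma expresses the remaining error by a curl, flatness makes the
  curl linear in the error, and a bound that can be halved repeatedly forces the error to vanish.
  The torus has the topology of pointwise convergence on an infinite lattice, so openness of the
  exponential chart is not automatic: small logarithms on the finitely many roots are glued by a
  frame dual to all roots at once, without a choice of simple roots. In
  \<open>a(u, \<Gamma>(v, w))\<close> the root part is symmetric since \<open>a\<close> of
  \<open>u\<close> and a coroot is a multiple of \<open>\<alpha>(u)\<close>; the part from
  \<open>b\<close> is symmetric since an invariant trilinear form, antisymmetric in two arguments,
  vanishes on coroots.\<close>

definition holo_on :: "(complex ^ 'n) set \<Rightarrow> (complex ^ 'n \<Rightarrow> complex) \<Rightarrow> bool" where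
  "holo_on S f \<longleftrightarrow> open S \<and>
     (\<forall>x\<in>S. \<exists>D. Vector_Spaces.linear (*s) (*) D \<and> (f has_derivative D) (at x))"

text \<open>This is \<open>pd\<close> read in a chart: \<open>pd_chart\<close> passes between the
  two for arbitrary functions.\<close>

definition ddir :: "complex ^ 'n \<Rightarrow> (complex ^ 'n \<Rightarrow> complex) \<Rightarrow> complex ^ 'n \<Rightarrow> complex" where
  "ddir v f x = deriv (\<lambda>t. f (x + t *s v)) 0"

section \<open>Directional derivatives along complex lines\<close>

lemma linear_smult_left: "linear (\<lambda>t::complex. t *s v)"
  by (rule linearI) (auto simp: vec_eq_iff algebra_simps)

lemma has_derivative_smult_left:
  "((\<lambda>t::complex. x + t *s v) has_derivative (\<lambda>t. t *s v)) (at t0 within T)"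
proof -
  have "bounded_linear (\<lambda>t::complex. t *s v)"
    using linear_smult_left linear_conv_bounded_linear by blast
  from has_derivative_add[OF has_derivative_const bounded_linear_imp_has_derivative[OF this]]
  show ?thesis by simp
qed

lemma continuous_on_smult [continuous_intros]:
  assumes "continuous_on T a" "continuous_on T b"
  shows "continuous_on T (\<lambda>x. (a x :: complex) *s (b x :: complex ^ 'n))"
  unfolding vector_scalar_mult_def
  by (intro continuous_intros assms)

lemma norm_smult: "norm (t *s (v :: complex ^ 'n)) = norm t * norm v"
  by (simp add: norm_vec_def L2_set_def norm_mult power_mult_distrib real_sqrt_mult
      flip: sum_distrib_left)

lemma linear_complexD:
  assumes "Vector_Spaces.linear (*s) (*) (D :: complex ^ 'n \<Rightarrow> complex)"
  shows "D (u + v) = D u + D v" "D (c *s v) = c * D v"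
  using assms by (simp_all add: vec.linear_add vec.linear_scale Vector_Spaces.linear_iff)

lemma has_derivative_line:
  fixes f :: "complex ^ 'n \<Rightarrow> complex"
  assumes "(f has_derivative D) (at x)" "Vector_Spaces.linear (*s) (*) D"
  shows "((\<lambda>t. f (x + t *s v)) has_field_derivative D v) (at 0)"
proof -
  have "((\<lambda>t. f (x + t *s v)) has_derivative (\<lambda>t. D (t *s v))) (at 0)"
    by (rule has_derivative_compose[OF has_derivative_smult_left]) (use assms in simp)
  moreover have "(\<lambda>t. D (t *s v)) = (*) (D v)"
    using linear_complexD[OF assms(2)] by (auto simp: fun_eq_iff mult.commute)
  ultimately show ?thesis
    by (simp add: has_field_derivative_def)
qed

lemma ddir_eqI:
  assumes "((\<lambda>t. f (x + t *s v)) has_field_derivative d) (at 0)"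
  shows "ddir v f x = d"
  using assms unfolding ddir_def by (rule DERIV_imp_deriv)

lemma holo_on_open: "holo_on S f \<Longrightarrow> open S"
  by (simp add: holo_on_def)

lemma holo_on_derivative:
  assumes "holo_on S f" "x \<in> S"
  shows "Vector_Spaces.linear (*s) (*) (\<lambda>v. ddir v f x)"
    "(f has_derivative (\<lambda>v. ddir v f x)) (at x)"
proof -
  from assms obtain D where D: "Vector_Spaces.linear (*s) (*) D" "(f has_derivative D) (at x)"
    unfolding holo_on_def by auto
  have "D = (\<lambda>v. ddir v f x)"
    using ddir_eqI[OF has_derivative_line[OF D(2,1)]] by auto
  with D show "Vector_Spaces.linear (*s) (*) (\<lambda>v. ddir v f x)"
    "(f has_derivative (\<lambda>v. ddir v f x)) (at x)" by simp_all
qed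

lemma holo_on_line0:
  assumes "holo_on S f" "x \<in> S"
  shows "((\<lambda>t. f (x + t *s v)) has_field_derivative ddir v f x) (at 0)"
  using has_derivative_line[OF holo_on_derivative(2,1)[OF assms]] .

lemma ddir_sum_basis:
  assumes "holo_on S f" "x \<in> S"
  shows "ddir v f x = (\<Sum>j\<in>UNIV. v $ j * ddir (axis j 1) f x)"
proof -
  interpret D: Vector_Spaces.linear "(*s)" "(*)" "\<lambda>v. ddir v f x"
    using holo_on_derivative(1)[OF assms] .
  have "ddir v f x = ddir (\<Sum>j\<in>UNIV. v $ j *s axis j 1) f x"
    by (simp add: basis_expansion)
  also have "\<dots> = (\<Sum>j\<in>UNIV. v $ j * ddir (axis j 1) f x)"
    by (simp only: D.sum D.scale)
  finally show ?thesis .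
qed

lemma ddir_cong:
  assumes "open T" "x \<in> T" "\<And>y. y \<in> T \<Longrightarrow> f y = g y"
  shows "ddir v f x = ddir v g x"
  unfolding ddir_def
proof (rule deriv_cong_ev)
  have "continuous_on UNIV (\<lambda>t::complex. x + t *s v)"
    by (intro continuous_intros)
  from open_vimage[OF assms(1) this] assms(2)
  have "\<forall>\<^sub>F t in nhds 0. x + t *s v \<in> T"
    using eventually_nhds_in_open[of "(\<lambda>t::complex. x + t *s v) -` T" 0]
    by (simp add: vimage_def)
  then show "\<forall>\<^sub>F t in nhds 0. f (x + t *s v) = g (x + t *s v)"
    by eventually_elim (use assms(3) in auto)
qed simp

lemma holo_on_cong:
  assumes "holo_on S f" "\<And>x. x \<in> S \<Longrightarrow> f x = g x"
  shows "holo_on S g"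
  unfolding holo_on_def
proof (intro conjI ballI)
  show S: "open S" using holo_on_open[OF assms(1)] .
  fix x assume x: "x \<in> S"
  have "(g has_derivative (\<lambda>v. ddir v f x)) (at x)"
    by (rule has_derivative_transform_within_open[OF holo_on_derivative(2)[OF assms(1) x] S x])
      (use assms(2) in auto)
  then show "\<exists>D. Vector_Spaces.linear (*s) (*) D \<and> (g has_derivative D) (at x)"
    using holo_on_derivative(1)[OF assms(1) x] by blast
qed

lemma holo_on_subset: "holo_on S f \<Longrightarrow> open T \<Longrightarrow> T \<subseteq> S \<Longrightarrow> holo_on T f"
  unfolding holo_on_def by blast

lemma holo_on_local:
  assumes "open S" "\<And>x. x \<in> S \<Longrightarrow> \<exists>T. x \<in> T \<and> holo_on T f"
  shows "holo_on S f"
  using assms unfolding holo_on_def by blast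

lemma holo_on_continuous: "holo_on S f \<Longrightarrow> continuous_on S f"
  by (meson continuous_at_imp_continuous_on has_derivative_continuous holo_on_derivative(2))

section \<open>Cauchy's formula on complex lines and Osgood's lemma\<close>

lemma line_derivative_at:
  assumes "\<And>x. x \<in> S \<Longrightarrow> (\<lambda>t. f (x + t *s v)) field_differentiable at 0"
    and "x + t0 *s v \<in> S"
  shows "((\<lambda>t. f (x + t *s v)) has_field_derivative ddir v f (x + t0 *s v)) (at t0)"
proof -
  have "((\<lambda>t. f ((x + t0 *s v) + t *s v)) has_field_derivative ddir v f (x + t0 *s v)) (at 0)"
    unfolding ddir_def using assms field_differentiable_derivI by blast
  moreover have "(x + t0 *s v) + t *s v = x + (t + t0) *s v" for t
    by (simp add: vec_eq_iff algebra_simps)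
  ultimately show ?thesis
    using DERIV_shift[of "\<lambda>t. f (x + t *s v)" _ 0 t0] by simp
qed

text \<open>Cauchy's formula for the first derivative at the centre of a circle of radius
  \<open>r\<close> in the complex line through \<open>x\<close> in direction \<open>v\<close>, with
  the circle parametrised by the unit interval. The integrand contains \<open>f\<close> but no
  derivative of \<open>f\<close>, so regularity of \<open>f\<close> passes to
  \<open>ddir v f\<close>.\<close>

lemma ddir_Cauchy_integral:
  assumes diff: "\<And>x. x \<in> S \<Longrightarrow> (\<lambda>t. f (x + t *s v)) field_differentiable at 0"
    and r: "r > 0" and sub: "\<And>t. norm t \<le> r \<Longrightarrow> x + t *s v \<in> S"
  shows "((\<lambda>s. f (x + (of_real r * exp (2 * of_real pi * \<i> * of_real s)) *s v)
             * (exp (- (2 * of_real pi * \<i> * of_real s)) / of_real r))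
           has_integral ddir v f x) (cbox 0 (1::real))"
proof -
  define g where "g = (\<lambda>t. f (x + t *s v))"
  have gd: "(g has_field_derivative ddir v f (x + t *s v)) (at t)" if "norm t \<le> r" for t
    unfolding g_def by (rule line_derivative_at[OF diff sub[OF that]])
  have cont: "continuous_on (cball 0 r) g"
    by (rule DERIV_continuous_on[of _ _ "\<lambda>t. ddir v f (x + t *s v)"])
       (use gd in \<open>auto intro: has_field_derivative_at_within\<close>)
  have hol: "g holomorphic_on ball 0 r"
    unfolding holomorphic_on_def field_differentiable_def
    using gd by (metis less_imp_le mem_ball_0 has_field_derivative_at_within)
  note C = Cauchy_derivative_integral_circlepath[OF cont hol, of 0]
  have "(\<lambda>u. g u / u^2) contour_integrable_on circlepath 0 r" using C(1) r by simp
  then have I: "((\<lambda>u. g u / u^2) has_contour_integral contour_integral (circlepath 0 r) (\<lambda>u. g u / u^2))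
      (circlepath 0 r)"
    by (rule has_contour_integral_integral)
  have d: "ddir v f x = 1 / (2 * of_real pi * \<i>) * contour_integral (circlepath 0 r) (\<lambda>u. g u / u^2)"
    using C(2) r DERIV_unique[OF _ gd[of 0]] by simp
  have "((\<lambda>s. g (circlepath 0 r s) / (circlepath 0 r s)^2 *
           vector_derivative (circlepath 0 r) (at s within {0..1}))
         has_integral contour_integral (circlepath 0 r) (\<lambda>u. g u / u^2)) {0..1}"
    using I unfolding has_contour_integral_def .
  from has_integral_mult_right[OF this, of "1 / (2 * of_real pi * \<i>)"]
  have J: "((\<lambda>s. 1 / (2 * of_real pi * \<i>) * (g (circlepath 0 r s) / (circlepath 0 r s)^2 *
           vector_derivative (circlepath 0 r) (at s within {0..1})))
         has_integral ddir v f x) {0..1}"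
    using d by simp
  show ?thesis unfolding cbox_interval
  proof (rule has_integral_eq[OF _ J])
    fix s :: real assume s: "s \<in> {0..1}"
    have E: "circlepath 0 r s = of_real r * exp (2 * of_real pi * \<i> * of_real s)"
      by (simp add: circlepath)
    have V: "vector_derivative (circlepath 0 r) (at s within {0..1})
        = 2 * of_real pi * \<i> * circlepath 0 r s"
      using s by (simp add: vector_derivative_circlepath01 E)
    show "1 / (2 * of_real pi * \<i>) * (g (circlepath 0 r s) / (circlepath 0 r s)^2 *
           vector_derivative (circlepath 0 r) (at s within {0..1})) =
        f (x + (of_real r * exp (2 * of_real pi * \<i> * of_real s)) *s v)
             * (exp (- (2 * of_real pi * \<i> * of_real s)) / of_real r)"
      using r unfolding V unfolding E g_def exp_minus
      by (simp add: divide_simps power2_eq_square)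
  qed
qed

text \<open>One radius \<open>r\<close> serves all base points near \<open>x0\<close>; this makes
  Cauchy's formula an integral with a parameter.\<close>

lemma circle_in_open:
  assumes "open S" "x0 \<in> S"
  obtains \<rho> r where "\<rho> > 0" "r > 0" "ball x0 \<rho> \<subseteq> S"
    "\<And>x t. x \<in> ball x0 \<rho> \<Longrightarrow> norm t \<le> r \<Longrightarrow> x + t *s (v :: complex ^ 'n) \<in> S"
proof -
  obtain e where e: "e > 0" "ball x0 e \<subseteq> S" using assms open_contains_ball by blast
  \<comment> \<open>The summand 1 covers \<open>v = 0\<close>. A circle point lies at most
    \<open>e/2\<close> from its base point, and the base point less than \<open>e/2\<close> from
    \<open>x0\<close>.\<close>
  define r where "r = e / (2 * (norm v + 1))"
  have r: "r > 0" using e by (simp add: r_def add_nonneg_pos)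
  have rv: "r * norm v \<le> e / 2"
    using e unfolding r_def by (simp add: divide_simps add_nonneg_pos)
  show thesis
  proof (rule that[of "e/2" r])
    fix x t assume x: "x \<in> ball x0 (e/2)" and t: "norm (t::complex) \<le> r"
    have "norm (t *s v) \<le> e / 2"
      using mult_right_mono[OF t norm_ge_zero[of v]] rv by (simp add: norm_smult)
    then have "dist x0 (x + t *s v) < e"
      using x norm_triangle_ineq4[of "x0 - x" "t *s v"] by (simp add: dist_norm algebra_simps)
    then show "x + t *s v \<in> S" using e by auto
  qed (use e r in auto)
qed

lemma exp_circle_norm [simp]: "norm (exp (2 * complex_of_real pi * \<i> * complex_of_real s)) = 1"
  by (simp add: norm_exp_eq_Re)

lemma exp_circle_norm' [simp]: "norm (exp (- (2 * complex_of_real pi * \<i> * complex_of_real s))) = 1"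
  by (simp add: norm_exp_eq_Re)

lemma continuous_on_circle_shift:
  fixes f :: "complex ^ 'n \<Rightarrow> complex"
  assumes "continuous_on S f"
    and "\<And>x t. x \<in> B \<Longrightarrow> norm t \<le> r \<Longrightarrow> x + t *s v \<in> S" "r > 0"
  shows "continuous_on (B \<times> T) (\<lambda>(x, s). f (x + (of_real r * exp (2 * of_real pi * \<i> * of_real s)) *s v)
             * (exp (- (2 * of_real pi * \<i> * of_real s)) / of_real r))"
  unfolding case_prod_beta
  by (intro continuous_intros continuous_on_compose2[OF assms(1)])
     (use assms(2,3) in \<open>auto simp: norm_mult\<close>)

text \<open>With a common radius, Cauchy's formula writes \<open>ddir v f\<close> near
  \<open>x0\<close> as an integral depending continuously on the base point. The hypothesis concerns
  the single direction \<open>v\<close>, so that Osgood's lemma can use it for one coordinate at a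
  time.\<close>

lemma ddir_continuous:
  fixes f :: "complex ^ 'n \<Rightarrow> complex"
  assumes S: "open S" and cont: "continuous_on S f"
    and diff: "\<And>x. x \<in> S \<Longrightarrow> (\<lambda>t. f (x + t *s v)) field_differentiable at 0"
  shows "continuous_on S (ddir v f)"
proof (rule continuous_at_imp_continuous_on, rule ballI)
  fix x0 assume x0: "x0 \<in> S"
  obtain \<rho> r where pr: "\<rho> > 0" "r > 0" "ball x0 \<rho> \<subseteq> S"
    and sub: "\<And>x t. x \<in> ball x0 \<rho> \<Longrightarrow> norm t \<le> r \<Longrightarrow> x + t *s v \<in> S"
    using circle_in_open[OF S x0, of v] by metis
  have "continuous_on (ball x0 \<rho>) (\<lambda>x. integral (cbox 0 (1::real))
      (\<lambda>s. f (x + (of_real r * exp (2 * of_real pi * \<i> * of_real s)) *s v)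
             * (exp (- (2 * of_real pi * \<i> * of_real s)) / of_real r)))"
    by (rule integral_continuous_on_param) (rule continuous_on_circle_shift[OF cont sub pr(2)])
  then have "continuous_on (ball x0 \<rho>) (ddir v f)"
    by (rule continuous_on_eq)
       (use ddir_Cauchy_integral[OF diff pr(2) sub, THEN integral_unique] in auto)
  then show "isCont (ddir v f) x0"
    using pr(1) by (simp add: continuous_on_eq_continuous_at)
qed

text \<open>Osgood's lemma: telescope along the coordinates; by the Cauchy integral the
  partial derivatives are continuous.\<close>

lemma holo_on_Osgood:
  fixes f :: "complex ^ 'n \<Rightarrow> complex"
  assumes S: "open S" and cont: "continuous_on S f"
    and diff: "\<And>x j. x \<in> S \<Longrightarrow> (\<lambda>t. f (x + t *s axis j 1)) field_differentiable at 0"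
  shows "holo_on S f"
  unfolding holo_on_def
proof (intro conjI ballI S)
  fix x assume x: "x \<in> S"
  define D where "D y = (\<Sum>j\<in>UNIV. y $ j * ddir (axis j 1) f x)" for y :: "complex ^ 'n"
  define pr where "pr J y = (\<Sum>j\<in>J. y $ j *s axis j 1)" for J and y :: "complex ^ 'n"
  have prn: "norm (pr J y) \<le> norm y" for J y
  proof -
    have *: "pr J y $ i = (if i \<in> J then y $ i else 0)" for i
      by (simp add: pr_def axis_def if_distrib[of "\<lambda>u. _ * u"] cong: if_cong)
    show ?thesis by (rule norm_le_componentwise_cart) (auto simp: *)
  qed
  have lin: "Vector_Spaces.linear (*s) (*) D"
    unfolding Vector_Spaces.linear_iff
    by (auto simp: D_def algebra_simps sum.distrib sum_distrib_left)
       (unfold_locales, auto simp: algebra_simps)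
  \<comment> \<open>\<open>J\<close> collects the coordinates already moved. A new coordinate
    contributes an error \<open>e/2\<close> through the mean value inequality, the earlier ones
    \<open>e/2\<close> by induction.\<close>
  have tele: "\<exists>d>0. \<forall>y. norm y < d \<longrightarrow>
      norm (f (x + pr J y) - f x - (\<Sum>j\<in>J. y $ j * ddir (axis j 1) f x)) \<le> e * norm y"
    if "finite J" "e > 0" for J e
    using that
  proof (induction J arbitrary: e rule: finite_induct)
    case empty
    then show ?case by (intro exI[of _ 1]) (auto simp: pr_def)
  next
    case (insert i J)
    from insert.IH[of "e/2"] insert.prems obtain d1 where d1: "d1 > 0"
      "\<And>y. norm y < d1 \<Longrightarrow>
        norm (f (x + pr J y) - f x - (\<Sum>j\<in>J. y $ j * ddir (axis j 1) f x)) \<le> e/2 * norm y"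
      by auto
    have "continuous_on S (ddir (axis i 1) f)"
      by (rule ddir_continuous[OF S cont diff])
    then have "isCont (ddir (axis i 1) f) x" using S x by (simp add: continuous_on_eq_continuous_at)
    then obtain d2 where d2: "d2 > 0"
      "\<And>z. norm (z - x) < d2 \<Longrightarrow> norm (ddir (axis i 1) f z - ddir (axis i 1) f x) < e/2"
      unfolding continuous_at_eps_delta dist_norm using insert.prems by (meson half_gt_zero)
    obtain d3 where d3: "d3 > 0" "ball x d3 \<subseteq> S" using S x open_contains_ball by blast
    \<comment> \<open>Points on the segment of the new coordinate are at distance at most
      \<open>2 * norm y\<close> from \<open>x\<close>, hence the halves of \<open>d2\<close> and
      \<open>d3\<close>.\<close>
    define d where "d = min d1 (min (d2/2) (d3/2))"
    show ?case
    proof (intro exI[of _ d] conjI allI impI)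
      show "d > 0" using d1 d2 d3 by (simp add: d_def)
      fix y :: "complex ^ 'n" assume y: "norm y < d"
      \<comment> \<open>With the linear part subtracted, the derivative of \<open>g\<close> is the
        variation of the partial derivative, which is below \<open>e/2\<close> on the
        segment.\<close>
      define g where "g t = f ((x + pr J y) + t *s axis i 1) - t * ddir (axis i 1) f x" for t
      have near: "norm ((x + pr J y) + t *s axis i 1 - x) < min d2 d3"
        if "t \<in> closed_segment 0 (y $ i)" for t
      proof -
        have "norm t \<le> norm (y $ i)" using that segment_bound1[of t 0 "y$i"] by simp
        also have "\<dots> \<le> norm y" by (rule Finite_Cartesian_Product.norm_nth_le)
        finally have "norm (t *s (axis i 1 :: complex ^ 'n)) \<le> norm y"
          by (simp add: norm_smult norm_axis_1)
        with prn[of J y] norm_triangle_ineq[of "pr J y" "t *s axis i 1"] y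
        show ?thesis by (simp add: d_def)
      qed
      have gd: "(g has_field_derivative
           ddir (axis i 1) f ((x + pr J y) + t *s axis i 1) - ddir (axis i 1) f x)
            (at t within closed_segment 0 (y $ i))" if "t \<in> closed_segment 0 (y $ i)" for t
      proof -
        have "dist x ((x + pr J y) + t *s axis i 1) < d3"
          using near[OF that] by (subst dist_commute) (simp add: dist_norm)
        with d3(2) have "(x + pr J y) + t *s axis i 1 \<in> S"
          by (meson mem_ball subsetD)
        note 1 = line_derivative_at[OF diff this]
        have 2: "((\<lambda>t. t * ddir (axis i 1) f x) has_field_derivative ddir (axis i 1) f x) (at t)"
          using DERIV_cmult_right[OF DERIV_ident, of "ddir (axis i 1) f x"] by simp
        show ?thesis unfolding g_def
          by (rule has_field_derivative_at_within[OF DERIV_diff[OF 1 2]])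
      qed
      have "norm (g (y $ i) - g 0) \<le> e/2 * norm (y $ i - 0)"
      proof (rule field_differentiable_bound[OF convex_closed_segment gd])
        fix t assume t: "t \<in> closed_segment 0 (y $ i)"
        show "norm (ddir (axis i 1) f (x + pr J y + t *s axis i 1) - ddir (axis i 1) f x) \<le> e/2"
          using d2(2)[of "x + pr J y + t *s axis i 1"] near[OF t] by auto
      qed auto
      also have "\<dots> \<le> e/2 * norm y"
        using insert.prems Finite_Cartesian_Product.norm_nth_le[of y i] by simp
      finally have 1: "norm (g (y $ i) - g 0) \<le> e/2 * norm y" .
      have 2: "norm (f (x + pr J y) - f x - (\<Sum>j\<in>J. y $ j * ddir (axis j 1) f x)) \<le> e/2 * norm y"
        by (rule d1) (use y in \<open>simp add: d_def\<close>)
      have pri: "x + pr (insert i J) y = x + pr J y + y $ i *s axis i 1"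
        using insert.hyps by (simp add: pr_def)
      have "f (x + pr (insert i J) y) - f x - (\<Sum>j\<in>insert i J. y $ j * ddir (axis j 1) f x)
        = (g (y $ i) - g 0) + (f (x + pr J y) - f x - (\<Sum>j\<in>J. y $ j * ddir (axis j 1) f x))"
        unfolding pri g_def using insert.hyps by simp
      moreover have "norm ((g (y $ i) - g 0) +
          (f (x + pr J y) - f x - (\<Sum>j\<in>J. y $ j * ddir (axis j 1) f x))) \<le> e * norm y"
        using norm_triangle_le[OF add_mono[OF 1 2]] by simp
      ultimately show "norm (f (x + pr (insert i J) y) - f x - (\<Sum>j\<in>insert i J. y $ j * ddir (axis j 1) f x))
          \<le> e * norm y"
        by (simp only:)
    qed
  qed
  have "linear D"
    by (rule linearI) (auto simp: D_def algebra_simps sum.distrib scaleR_sum_right)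
  then have bl: "bounded_linear D" using linear_conv_bounded_linear by blast
  have prU: "pr UNIV y = y" for y unfolding pr_def by (rule basis_expansion)
  have "(f has_derivative D) (at x)"
    unfolding has_derivative_at_alt
  proof (intro conjI bl allI impI)
    fix e :: real assume "e > 0"
    from tele[OF finite this, of UNIV] obtain d where d: "d > 0"
      "\<And>y. norm y < d \<Longrightarrow> norm (f (x + y) - f x - D y) \<le> e * norm y"
      unfolding prU D_def by auto
    show "\<exists>d>0. \<forall>y. norm (y - x) < d \<longrightarrow> norm (f y - f x - D (y - x)) \<le> e * norm (y - x)"
      using d(1) d(2)[of "_ - x"] by (intro exI[of _ d]) auto
  qed
  with lin show "\<exists>D. Vector_Spaces.linear (*s) (*) D \<and> (f has_derivative D) (at x)" by blast
qed

lemma ddir_continuous_on: "holo_on S f \<Longrightarrow> continuous_on S (ddir v f)"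
  by (meson ddir_continuous field_differentiable_def holo_on_continuous holo_on_line0 holo_on_open)

text \<open>Asking for all directions instead of the coordinate ones lets the closure properties
  below be read off from functions of one variable.\<close>

lemma holo_onI:
  assumes "open S" "continuous_on S f"
    and "\<And>x v. x \<in> S \<Longrightarrow> (\<lambda>t. f (x + t *s v)) field_differentiable at 0"
  shows "holo_on S f"
  using assms by (intro holo_on_Osgood)

lemma holo_on_line_differentiable:
  "holo_on S f \<Longrightarrow> x \<in> S \<Longrightarrow> (\<lambda>t. f (x + t *s v)) field_differentiable at 0"
  using holo_on_line0 field_differentiable_def by blast

lemma holo_on_line:
  assumes "holo_on S f" "x + t0 *s v \<in> S"
  shows "((\<lambda>t. f (x + t *s v)) has_field_derivative ddir v f (x + t0 *s v)) (at t0)"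
  by (rule line_derivative_at[OF holo_on_line_differentiable[OF assms(1)] assms(2)])

section \<open>Closure properties and rules of differentiation\<close>

lemma holo_on_const: "open S \<Longrightarrow> holo_on S (\<lambda>x. c)"
  by (rule holo_onI) auto

lemma holo_on_nth: "open S \<Longrightarrow> holo_on S (\<lambda>x. x $ i)"
  by (rule holo_onI) (auto intro!: continuous_intros derivative_intros)

lemma holo_on_add:
  "holo_on S f \<Longrightarrow> holo_on S g \<Longrightarrow> holo_on S (\<lambda>x. f x + g x)"
  by (rule holo_onI)
     (auto intro!: continuous_intros field_differentiable_add
       intro: holo_on_continuous holo_on_open holo_on_line_differentiable)

lemma holo_on_mult:
  "holo_on S f \<Longrightarrow> holo_on S g \<Longrightarrow> holo_on S (\<lambda>x. f x * g x)"
  by (rule holo_onI)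
     (auto intro!: continuous_intros field_differentiable_mult
       intro: holo_on_continuous holo_on_open holo_on_line_differentiable)

lemma holo_on_minus: "holo_on S f \<Longrightarrow> holo_on S (\<lambda>x. - f x)"
  by (rule holo_onI)
     (auto intro!: continuous_intros field_differentiable_minus
       intro: holo_on_continuous holo_on_open holo_on_line_differentiable)

lemma holo_on_diff:
  "holo_on S f \<Longrightarrow> holo_on S g \<Longrightarrow> holo_on S (\<lambda>x. f x - g x)"
  using holo_on_add[of S f "\<lambda>x. - g x"] holo_on_minus[of S g] by simp

lemma holo_on_divide:
  "holo_on S f \<Longrightarrow> holo_on S g \<Longrightarrow> (\<And>x. x \<in> S \<Longrightarrow> g x \<noteq> 0) \<Longrightarrow> holo_on S (\<lambda>x. f x / g x)"
  by (rule holo_onI)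
     (auto intro!: continuous_intros field_differentiable_divide
       intro: holo_on_continuous holo_on_open holo_on_line_differentiable)

lemma holo_on_exp: "holo_on S f \<Longrightarrow> holo_on S (\<lambda>x. exp (f x))"
  by (rule holo_onI)
     (auto intro!: continuous_intros field_differentiable_within_exp
        field_differentiable_compose[of _ _ exp, unfolded o_def]
       intro: holo_on_continuous holo_on_open holo_on_line_differentiable)

lemma holo_on_sum:
  assumes "open S" "\<And>i. i \<in> I \<Longrightarrow> holo_on S (f i)"
  shows "holo_on S (\<lambda>x. \<Sum>i\<in>I. f i x)"
  using assms(2)
  by (induction I rule: infinite_finite_induct) (auto intro: holo_on_const[OF assms(1)] holo_on_add)

lemma ddir_const [simp]: "ddir v (\<lambda>x. c) x = 0"
  by (simp add: ddir_def)

lemma ddir_nth [simp]: "ddir v (\<lambda>x. x $ i) x = v $ i"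
  by (rule ddir_eqI) (auto intro!: derivative_eq_intros)

lemma ddir_add:
  "holo_on S f \<Longrightarrow> holo_on S g \<Longrightarrow> x \<in> S \<Longrightarrow> ddir v (\<lambda>x. f x + g x) x = ddir v f x + ddir v g x"
  by (rule ddir_eqI) (intro DERIV_add holo_on_line0)

lemma ddir_minus:
  "holo_on S f \<Longrightarrow> x \<in> S \<Longrightarrow> ddir v (\<lambda>x. - f x) x = - ddir v f x"
  by (rule ddir_eqI) (intro DERIV_minus holo_on_line0)

lemma ddir_mult:
  assumes "holo_on S f" "holo_on S g" "x \<in> S"
  shows "ddir v (\<lambda>x. f x * g x) x = ddir v f x * g x + f x * ddir v g x"
  by (rule ddir_eqI) (use DERIV_mult[OF holo_on_line0[OF assms(1,3)] holo_on_line0[OF assms(2,3)]] in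
      \<open>simp add: algebra_simps\<close>)

lemma ddir_cmult:
  "holo_on S f \<Longrightarrow> x \<in> S \<Longrightarrow> ddir v (\<lambda>x. c * f x) x = c * ddir v f x"
  using ddir_mult[of S "\<lambda>x. c" f x v] holo_on_const[of S c] holo_on_open[of S f] by simp

lemma ddir_sum:
  assumes "\<And>i. i \<in> I \<Longrightarrow> holo_on S (f i)" "x \<in> S"
  shows "ddir v (\<lambda>x. \<Sum>i\<in>I. f i x) x = (\<Sum>i\<in>I. ddir v (f i) x)"
  by (rule ddir_eqI, rule DERIV_sum, rule holo_on_line0[OF assms(1)]) (use assms(2) in auto)

text \<open>Both sides differentiate the same function of one variable, so \<open>f\<close> may be
  arbitrary.\<close>

lemma ddir_affine: "ddir v (\<lambda>x. f (c + r *s x)) x = ddir (r *s v) f (c + r *s x)"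
proof -
  have "c + r *s (x + t *s v) = (c + r *s x) + t *s (r *s v)" for t
    by (simp add: vec_eq_iff algebra_simps)
  then show ?thesis by (simp only: ddir_def)
qed

lemma holo_on_affine:
  assumes f: "holo_on S f" and T: "open T" "\<And>x. x \<in> T \<Longrightarrow> c + r *s x \<in> S"
  shows "holo_on T (\<lambda>x. f (c + r *s x))"
proof (rule holo_onI)
  show "continuous_on T (\<lambda>x. f (c + r *s x))"
    by (intro continuous_on_compose2[OF holo_on_continuous[OF f]] continuous_intros) (use T in auto)
  fix x v assume x: "x \<in> T"
  have "c + r *s (x + t *s v) = (c + r *s x) + t *s (r *s v)" for t
    by (simp add: vec_eq_iff algebra_simps)
  then show "(\<lambda>t. f (c + r *s (x + t *s v))) field_differentiable at 0"
    using holo_on_line_differentiable[OF f T(2)[OF x], of "r *s v"] by (simp only:)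
qed (rule T)

lemma ddir_scale: "holo_on S f \<Longrightarrow> x \<in> S \<Longrightarrow> ddir (c *s v) f x = c * ddir v f x"
  using linear_complexD(2)[OF holo_on_derivative(1)] by blast

lemma ddir_plus: "holo_on S f \<Longrightarrow> x \<in> S \<Longrightarrow> ddir (u + v) f x = ddir u f x + ddir v f x"
  using linear_complexD(1)[OF holo_on_derivative(1)] by blast

text \<open>Leibniz's rule is applied in one complex variable on each line, and Osgood's lemma
  assembles the lines.\<close>

lemma holo_on_integral:
  fixes F :: "complex ^ 'n \<Rightarrow> real \<Rightarrow> complex" and a b :: real
  assumes S: "open S" and contF: "continuous_on (S \<times> cbox a b) (\<lambda>(x, s). F x s)"
    and holF: "\<And>s. s \<in> cbox a b \<Longrightarrow> holo_on S (\<lambda>x. F x s)"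
    and contD: "\<And>w. continuous_on (S \<times> cbox a b) (\<lambda>(x, s). ddir w (\<lambda>y. F y s) x)"
  shows "holo_on S (\<lambda>x. integral (cbox a b) (F x))"
    and "\<And>x w. x \<in> S \<Longrightarrow> ddir w (\<lambda>x. integral (cbox a b) (F x)) x
           = integral (cbox a b) (\<lambda>s. ddir w (\<lambda>y. F y s) x)"
proof -
  have main: "((\<lambda>t. integral (cbox a b) (F (x + t *s w))) has_field_derivative
      integral (cbox a b) (\<lambda>s. ddir w (\<lambda>y. F y s) x)) (at 0)" if x: "x \<in> S" for x w
  proof -
    obtain \<rho> r where r: "\<rho> > 0" "r > 0"
      and sub: "\<And>y t. y \<in> ball x \<rho> \<Longrightarrow> norm t \<le> r \<Longrightarrow> y + t *s w \<in> S"
      using circle_in_open[OF S x, of w] by metis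
    have sub: "x + t *s w \<in> S" if "t \<in> ball 0 r" for t
      using sub[of x t] that r by auto
    have "((\<lambda>t. integral (cbox a b) (F (x + t *s w))) has_field_derivative
      integral (cbox a b) (\<lambda>s. ddir w (\<lambda>y. F y s) (x + 0 *s w))) (at 0 within ball 0 r)"
    proof (rule leibniz_rule_field_derivative[where fx="\<lambda>t s. ddir w (\<lambda>y. F y s) (x + t *s w)"])
      fix t s assume t: "t \<in> ball (0::complex) r" and s: "s \<in> cbox a b"
      show "((\<lambda>t. F (x + t *s w) s) has_field_derivative ddir w (\<lambda>y. F y s) (x + t *s w)) (at t within ball 0 r)"
        by (rule has_field_derivative_at_within[OF holo_on_line[OF holF[OF s] sub[OF t]]])
    next
      fix t assume t: "t \<in> ball (0::complex) r"
      have "continuous_on (cbox a b) (\<lambda>s. case (x + t *s w, s) of (x, s) \<Rightarrow> F x s)"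
        by (intro continuous_on_compose2[OF contF] continuous_intros) (use sub[OF t] in auto)
      then show "F (x + t *s w) integrable_on cbox a b"
        using integrable_continuous[of a b "F (x + t *s w)"] by simp
    next
      have "continuous_on (ball 0 r \<times> cbox a b)
         (\<lambda>ts. case (x + fst ts *s w, snd ts) of (x, s) \<Rightarrow> ddir w (\<lambda>y. F y s) x)"
        by (intro continuous_on_compose2[OF contD] continuous_intros) (use sub in auto)
      then show "continuous_on (ball 0 r \<times> cbox a b) (\<lambda>(t, s). ddir w (\<lambda>y. F y s) (x + t *s w))"
        by (simp add: case_prod_beta)
    qed (use r in auto)
    then show ?thesis
      using r by (simp add: at_within_open[of _ "ball 0 r"])
  qed
  show "holo_on S (\<lambda>x. integral (cbox a b) (F x))"
    by (rule holo_onI[OF S integral_continuous_on_param[OF contF]])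
       (use main field_differentiable_def in blast)
  show "ddir w (\<lambda>x. integral (cbox a b) (F x)) x
           = integral (cbox a b) (\<lambda>s. ddir w (\<lambda>y. F y s) x)" if "x \<in> S" for x w
    by (rule ddir_eqI[OF main[OF that]])
qed

text \<open>Near \<open>x0\<close> Cauchy's formula writes \<open>ddir v f\<close> as an integral of
  shifted copies of \<open>f\<close>, which is holomorphic by differentiation under the integral
  sign. That differentiation yields the Cauchy integral of \<open>ddir w f\<close>, hence the
  symmetry, as soon as \<open>ddir w f\<close> is known to be holomorphic. The second half is
  therefore conditional; \<open>holo_on_ddir\<close> discharges the condition afterwards.\<close>

lemma ddir_local:
  assumes f: "holo_on S f" and x0: "x0 \<in> S"
  shows "\<exists>T. x0 \<in> T \<and> holo_on T (ddir v f) \<and>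
     ((\<forall>w. holo_on S (ddir w f)) \<longrightarrow> (\<forall>w. ddir w (ddir v f) x0 = ddir v (ddir w f) x0))"
proof -
  have S: "open S" by (rule holo_on_open[OF f])
  obtain \<rho> r where pr: "\<rho> > 0" "r > 0" "ball x0 \<rho> \<subseteq> S"
    and sub: "\<And>x t. x \<in> ball x0 \<rho> \<Longrightarrow> norm t \<le> r \<Longrightarrow> x + t *s v \<in> S"
    using circle_in_open[OF S x0, of v] by metis
  define q where "q s = (of_real r * exp (2 * of_real pi * \<i> * of_real s)) *s v" for s :: real
  define c where "c s = exp (- (2 * of_real pi * \<i> * of_real s)) / complex_of_real r" for s :: real
  have qS: "q s + 1 *s x \<in> S" if "x \<in> ball x0 \<rho>" for x s
    using sub[OF that, of "of_real r * exp (2 * of_real pi * \<i> * of_real s)"] pr(2)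
    by (simp add: q_def norm_mult add.commute)
  have Cf: "ddir v g x = integral (cbox 0 1) (\<lambda>s. c s * g (q s + 1 *s x))"
    if "holo_on S g" "x \<in> ball x0 \<rho>" for g x
    using ddir_Cauchy_integral[OF holo_on_line_differentiable[OF that(1)] pr(2) sub[OF that(2)], THEN integral_unique]
    by (simp add: q_def c_def mult.commute add.commute)
  have cc: "continuous_on A c" for A unfolding c_def using pr(2) by (intro continuous_intros) auto
  have cq: "continuous_on A q" for A unfolding q_def by (intro continuous_intros)
  have cont: "continuous_on (ball x0 \<rho> \<times> cbox 0 1) (\<lambda>(x, s). c s * g (q s + 1 *s x))"
    if "continuous_on S g" for g
    unfolding case_prod_beta
    by (intro continuous_intros continuous_on_compose2[OF that]
         continuous_on_compose2[OF cc[of UNIV]] continuous_on_compose2[OF cq[of UNIV]])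
       (use qS in auto)
  have h1: "holo_on (ball x0 \<rho>) (\<lambda>x. f (q s + 1 *s x))" for s
    by (rule holo_on_affine[OF f]) (use qS in auto)
  have hol: "holo_on (ball x0 \<rho>) (\<lambda>x. c s * f (q s + 1 *s x))" for s
    by (intro holo_on_mult holo_on_const h1) auto
  have dF: "ddir w (\<lambda>y. c s * f (q s + 1 *s y)) x = c s * ddir w f (q s + 1 *s x)"
    if "x \<in> ball x0 \<rho>" for x s w
    unfolding ddir_cmult[OF h1 that] ddir_affine by simp
  have contD: "continuous_on (ball x0 \<rho> \<times> cbox 0 1) (\<lambda>(x, s). ddir w (\<lambda>y. c s * f (q s + 1 *s y)) x)" for w
    by (rule continuous_on_eq[OF cont[OF ddir_continuous_on[OF f]]]) (use dF in auto)
  note I = holo_on_integral[OF open_ball cont[OF holo_on_continuous[OF f]] hol contD]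
  have hv: "holo_on (ball x0 \<rho>) (ddir v f)"
    by (rule holo_on_cong[OF I(1)]) (simp add: Cf[OF f])
  have in0: "x0 \<in> ball x0 \<rho>" using pr by simp
  have dw: "ddir w (ddir v f) x0 = integral (cbox 0 1) (\<lambda>s. c s * ddir w f (q s + 1 *s x0))"
    for w
    using I(2)[OF in0, of w] ddir_cong[OF open_ball in0, of "ddir v f" "\<lambda>x. integral (cbox 0 1) (\<lambda>s. c s * f (q s + 1 *s x))" w]
      dF[OF in0] by (simp add: Cf[OF f])
  have "ddir v (ddir w f) x0 = integral (cbox 0 1) (\<lambda>s. c s * ddir w f (q s + 1 *s x0))"
    if "\<forall>w. holo_on S (ddir w f)" for w
    using Cf[OF _ in0, of "ddir w f"] that by blast
  with dw hv in0 show ?thesis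
    by (intro exI[of _ "ball x0 \<rho>"] conjI impI allI) simp_all
qed

lemma holo_on_ddir: "holo_on S f \<Longrightarrow> holo_on S (ddir v f)"
  by (rule holo_on_local[OF holo_on_open]) (assumption, meson ddir_local)

lemma ddir_commute:
  "holo_on S f \<Longrightarrow> x \<in> S \<Longrightarrow> ddir w (ddir v f) x = ddir v (ddir w f) x"
  by (meson ddir_local holo_on_ddir)

text \<open>On each complex line this is the one-variable theorem on locally uniform limits;
  continuity comes from the uniform limit theorem, and Osgood's lemma joins the lines.\<close>

lemma holo_on_uniform_limit:
  fixes f :: "nat \<Rightarrow> complex ^ 'n \<Rightarrow> complex"
  assumes S: "open S" and hol: "\<And>n. holo_on S (f n)" and lim: "uniform_limit S f g sequentially"
  shows "holo_on S g"
proof (rule holo_onI[OF S])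
  show "continuous_on S g"
    by (rule uniform_limit_theorem[OF _ lim]) (auto intro!: always_eventually holo_on_continuous[OF hol])
  fix x v assume x: "x \<in> S"
  define T where "T = (\<lambda>t::complex. x + t *s v) -` S"
  have T: "open T" unfolding T_def by (intro open_vimage S continuous_intros)
  have "(\<lambda>t. g (x + t *s v)) holomorphic_on T"
  proof (rule holomorphic_uniform_sequence[OF T])
    show "(\<lambda>t. f n (x + t *s v)) holomorphic_on T" for n
      unfolding holomorphic_on_def field_differentiable_def
      by (intro ballI exI, rule has_field_derivative_at_within, rule holo_on_line[OF hol])
         (simp add: T_def)
    fix t assume "t \<in> T"
    then obtain d where d: "d > 0" "cball t d \<subseteq> T" using T open_contains_cball by blast
    have "uniform_limit (cball t d) (\<lambda>n t. f n (x + t *s v)) (\<lambda>t. g (x + t *s v)) sequentially"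
      by (rule uniform_limit_compose'[OF lim]) (use d T_def in auto)
    with d show "\<exists>d>0. cball t d \<subseteq> T \<and>
        uniform_limit (cball t d) (\<lambda>n t. f n (x + t *s v)) (\<lambda>t. g (x + t *s v)) sequentially"
      by blast
  qed
  then show "(\<lambda>t. g (x + t *s v)) field_differentiable at 0"
    using x T by (simp add: T_def holomorphic_on_imp_differentiable_at)
qed

lemma holo_on_ray:
  assumes "holo_on S f" "of_real s *s x \<in> S"
  shows "((\<lambda>s. f (of_real s *s x)) has_vector_derivative ddir x f (of_real s *s x)) (at s within T)"
  using has_vector_derivative_real_field[OF holo_on_line[OF assms(1), of 0 "of_real s" x]] assms(2)
  by simp

section \<open>Integration along rays\<close>

lemma ray_mem_ball:
  assumes "x \<in> ball 0 \<rho>" "s \<in> cbox 0 (1::real)"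
  shows "of_real s *s (x :: complex ^ 'n) \<in> ball 0 \<rho>" "norm (of_real s *s x) \<le> norm x"
proof -
  show le: "norm (of_real s *s x) \<le> norm x"
    using assms(2) by (simp add: norm_smult mult_left_le_one_le)
  show "of_real s *s (x :: complex ^ 'n) \<in> ball 0 \<rho>"
    using le assms(1) by simp
qed

lemma continuous_on_ray:
  fixes f :: "complex ^ 'n \<Rightarrow> complex"
  assumes "continuous_on (ball 0 \<rho>) f" "x \<in> ball 0 \<rho>"
  shows "continuous_on (cbox 0 1) (\<lambda>s. f (of_real s *s x))"
  by (rule continuous_on_compose2[OF assms(1)])
     (use ray_mem_ball[OF assms(2)] in \<open>auto intro!: continuous_intros\<close>)

text \<open>The homotopy formula of the Poincare lemma for the 1-form with coefficients
  \<open>g l\<close>: \<open>P\<close> is the candidate primitive, and its defect is a ray integral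
  of the curl weighted by \<open>s\<close>. The curl is kept in the formula because in
  \<open>Frobenius\<close> it is known only in terms of the error that is to vanish.\<close>

lemma holo_on_ray_integral:
  fixes g :: "'n \<Rightarrow> complex ^ 'n \<Rightarrow> complex"
  assumes g: "\<And>l. holo_on (ball 0 \<rho>) (g l)"
  defines "P \<equiv> (\<lambda>x. integral (cbox 0 (1::real)) (\<lambda>s. \<Sum>l\<in>UNIV. x $ l * g l (of_real s *s x)))"
  shows "holo_on (ball 0 \<rho>) P"
    and "\<And>x k. x \<in> ball 0 \<rho> \<Longrightarrow> ddir (axis k 1) P x - g k x =
      integral (cbox 0 (1::real)) (\<lambda>s. \<Sum>l\<in>UNIV. x $ l * (of_real s *
        (ddir (axis k 1) (g l) (of_real s *s x) - ddir (axis l 1) (g k) (of_real s *s x))))"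
proof -
  let ?S = "ball (0 :: complex ^ 'n) \<rho>"
  define F where "F x s = (\<Sum>l\<in>UNIV. x $ l * g l (of_real s *s x))" for x and s :: real
  have cr: "continuous_on (?S \<times> cbox 0 (1::real)) (\<lambda>p. h (of_real (snd p) *s fst p))"
    if "continuous_on ?S h" for h :: "complex ^ 'n \<Rightarrow> complex"
  proof (rule continuous_on_compose2[OF that])
    show "(\<lambda>p. of_real (snd p) *s fst p) ` (?S \<times> cbox 0 (1::real)) \<subseteq> ?S"
      using ray_mem_ball(1) by force
  qed (intro continuous_intros)
  have hr: "holo_on ?S (\<lambda>x. g l (of_real s *s x))" if "s \<in> cbox 0 (1::real)" for s l
  proof -
    have "holo_on ?S (\<lambda>x. g l (0 + of_real s *s x))"
      by (rule holo_on_affine[OF g open_ball]) (simp only: add_0 ray_mem_ball(1)[OF _ that])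
    then show ?thesis by simp
  qed
  have hF: "holo_on ?S (\<lambda>x. F x s)" if "s \<in> cbox 0 1" for s
    unfolding F_def by (intro holo_on_sum holo_on_mult holo_on_nth hr that open_ball)
  have sa: "ddir w (\<lambda>y. g l (of_real s *s y)) x = of_real s * ddir w (g l) (of_real s *s x)"
    if x: "x \<in> ?S" and s: "s \<in> cbox 0 (1::real)" for w l s x
    using ddir_affine[of w "g l" 0 "of_real s" x] ddir_scale[OF g ray_mem_ball(1)[OF x s]] by simp
  have dF: "ddir w (\<lambda>y. F y s) x =
      (\<Sum>l\<in>UNIV. w $ l * g l (of_real s *s x) + x $ l * (of_real s * ddir w (g l) (of_real s *s x)))"
    if x: "x \<in> ?S" and s: "s \<in> cbox 0 (1::real)" for w s x
    unfolding F_def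
    by (subst ddir_sum[OF holo_on_mult[OF holo_on_nth[OF open_ball] hr[OF s]] x])
       (simp only: sa[OF x s] ddir_nth ddir_mult[OF holo_on_nth[OF open_ball] hr[OF s] x])
  have contF: "continuous_on (?S \<times> cbox 0 1) (\<lambda>(x, s). F x s)"
    unfolding F_def case_prod_beta by (intro continuous_intros cr holo_on_continuous g)
  have contD: "continuous_on (?S \<times> cbox 0 1) (\<lambda>(x, s). ddir w (\<lambda>y. F y s) x)" for w
  proof (rule continuous_on_eq)
    show "continuous_on (?S \<times> cbox 0 1) (\<lambda>p. \<Sum>l\<in>UNIV. w $ l * g l (of_real (snd p) *s fst p)
       + fst p $ l * (of_real (snd p) * ddir w (g l) (of_real (snd p) *s fst p)))"
      by (intro continuous_intros cr holo_on_continuous ddir_continuous_on g)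
  qed (use dF in auto)
  note I = holo_on_integral[OF open_ball contF hF contD]
  show "holo_on ?S P" unfolding P_def using I(1) by (simp add: F_def)
  fix x k assume x: "x \<in> ?S"
  have 1: "((\<lambda>s. \<Sum>l\<in>UNIV. axis k 1 $ l * g l (of_real s *s x) + x $ l * (of_real s * ddir (axis k 1) (g l) (of_real s *s x)))
       has_integral ddir (axis k 1) P x) (cbox 0 1)"
  proof -
    have "(\<lambda>s. \<Sum>l\<in>UNIV. axis k 1 $ l * g l (of_real s *s x) + x $ l * (of_real s * ddir (axis k 1) (g l) (of_real s *s x)))
      integrable_on (cbox 0 (1::real))"
      by (intro integrable_continuous continuous_intros continuous_on_ray[OF _ x] holo_on_continuous g
           ddir_continuous_on)
    moreover have "ddir (axis k 1) P x = integral (cbox 0 1) (\<lambda>s. \<Sum>l\<in>UNIV. axis k 1 $ l * g l (of_real s *s x) + x $ l * (of_real s * ddir (axis k 1) (g l) (of_real s *s x)))"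
    proof -
      have "ddir (axis k 1) P x = integral (cbox 0 1) (\<lambda>s. ddir (axis k 1) (\<lambda>y. F y s) x)"
        using I(2)[OF _ x, of "axis k 1"] unfolding P_def F_def .
      also have "\<dots> = integral (cbox 0 1) (\<lambda>s. \<Sum>l\<in>UNIV. axis k 1 $ l * g l (of_real s *s x) + x $ l * (of_real s * ddir (axis k 1) (g l) (of_real s *s x)))"
        by (rule integral_cong[OF dF[OF x]])
      finally show ?thesis .
    qed
    ultimately show ?thesis by (simp add: has_integral_integral)
  qed
  \<comment> \<open>The derivative of \<open>s * g k (s x)\<close> with respect to \<open>s\<close>
    is integrated over the unit interval.\<close>
  have 2: "((\<lambda>s. g k (of_real s *s x) + of_real s * ddir x (g k) (of_real s *s x)) has_integral g k x) (cbox 0 1)"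
  proof -
    have "((\<lambda>s. g k (of_real s *s x) + of_real s * ddir x (g k) (of_real s *s x)) has_integral
        of_real 1 * g k (of_real 1 *s x) - of_real 0 * g k (of_real 0 *s x)) {0..1}"
    proof (rule fundamental_theorem_of_calculus)
      fix s :: real assume "s \<in> {0..1}"
      then have "s \<in> cbox 0 1" by simp
      note h = holo_on_ray[OF g ray_mem_ball(1)[OF x this], where T = "{0..1}"]
      have i: "((\<lambda>s. complex_of_real s) has_vector_derivative 1) (at s within {0..1})"
        by (auto intro!: derivative_eq_intros)
      show "((\<lambda>s. of_real s * g k (of_real s *s x)) has_vector_derivative
         g k (of_real s *s x) + of_real s * ddir x (g k) (of_real s *s x)) (at s within {0..1})"
        using has_vector_derivative_mult[OF i h] by (simp add: add.commute)
    qed simp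
    then show ?thesis by simp
  qed
  have "integral (cbox 0 (1::real)) (\<lambda>s. \<Sum>l\<in>UNIV. x $ l * (of_real s *
        (ddir (axis k 1) (g l) (of_real s *s x) - ddir (axis l 1) (g k) (of_real s *s x))))
     = ddir (axis k 1) P x - g k x"
  proof (rule integral_unique[OF has_integral_eq[OF _ has_integral_diff[OF 1 2]]])
    fix s assume s: "s \<in> cbox 0 (1::real)"
    have "ddir x (g k) (of_real s *s x) = (\<Sum>l\<in>UNIV. x $ l * ddir (axis l 1) (g k) (of_real s *s x))"
      by (rule ddir_sum_basis[OF g ray_mem_ball(1)[OF x s]])
    moreover have "(\<Sum>l\<in>UNIV. axis k 1 $ l * g l (of_real s *s x)) = g k (of_real s *s x)"
      by (simp add: axis_def if_distrib[of "\<lambda>u. u * _"] cong: if_cong)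
    ultimately show "(\<Sum>l\<in>UNIV. axis k 1 $ l * g l (of_real s *s x) + x $ l * (of_real s * ddir (axis k 1) (g l) (of_real s *s x)))
        - (g k (of_real s *s x) + of_real s * ddir x (g k) (of_real s *s x)) =
       (\<Sum>l\<in>UNIV. x $ l * (of_real s *
        (ddir (axis k 1) (g l) (of_real s *s x) - ddir (axis l 1) (g k) (of_real s *s x))))"
      by (simp add: sum.distrib sum_distrib_left algebra_simps flip: sum_subtractf)
  qed
  then show "ddir (axis k 1) P x - g k x =
      integral (cbox 0 (1::real)) (\<lambda>s. \<Sum>l\<in>UNIV. x $ l * (of_real s *
        (ddir (axis k 1) (g l) (of_real s *s x) - ddir (axis l 1) (g k) (of_real s *s x))))"
    by simp
qed

lemma ray_fundamental:
  fixes f :: "complex ^ 'n \<Rightarrow> complex"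
  assumes f: "holo_on (ball 0 \<rho>) f" and x: "x \<in> ball 0 \<rho>"
  shows "f x - f 0 = integral (cbox 0 1) (\<lambda>s. \<Sum>l\<in>UNIV. x $ l * ddir (axis l 1) f (of_real s *s x))"
proof -
  have "((\<lambda>s. \<Sum>l\<in>UNIV. x $ l * ddir (axis l 1) f (of_real s *s x)) has_integral
        f (of_real 1 *s x) - f (of_real 0 *s x)) {0..1}"
  proof (rule fundamental_theorem_of_calculus)
    fix s :: real assume "s \<in> {0..1}"
    then have s: "s \<in> cbox 0 1" by simp
    show "((\<lambda>s. f (of_real s *s x)) has_vector_derivative
         (\<Sum>l\<in>UNIV. x $ l * ddir (axis l 1) f (of_real s *s x))) (at s within {0..1})"
      using holo_on_ray[OF f ray_mem_ball(1)[OF x s]]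
      by (simp only: ddir_sum_basis[OF f ray_mem_ball(1)[OF x s], of x])
  qed simp
  then show ?thesis by (simp add: integral_unique)
qed

lemma norm_ray_integral_le:
  fixes g :: "'n \<Rightarrow> complex ^ 'n \<Rightarrow> real \<Rightarrow> complex"
  assumes x: "x \<in> ball 0 \<rho>" and "\<And>l. continuous_on (cbox 0 1) (g l x)"
    and "\<And>l s. s \<in> cbox 0 1 \<Longrightarrow> norm (g l x s) \<le> C"
  shows "norm (integral (cbox 0 (1::real)) (\<lambda>s. \<Sum>l\<in>UNIV. x $ l * g l x s)) \<le> of_nat CARD('n) * \<rho> * C"
proof -
  have "norm (g undefined x 0) \<le> C" by (rule assms(3)) simp
  then have C: "0 \<le> C" by (rule order_trans[OF norm_ge_zero])
  have "norm x < \<rho>" using x by simp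
  then have \<rho>: "0 \<le> \<rho>" using norm_ge_zero[of x] by linarith
  have "norm (integral {0..1::real} (\<lambda>s. \<Sum>l\<in>UNIV. x $ l * g l x s)) \<le> of_nat CARD('n) * \<rho> * C * (1 - 0)"
  proof (rule integral_bound)
    show "continuous_on {0..1} (\<lambda>s. \<Sum>l\<in>UNIV. x $ l * g l x s)"
      using assms(2) by (intro continuous_intros) auto
    fix s :: real assume "s \<in> {0..1}"
    then have s: "s \<in> cbox 0 1" by simp
    have "norm (\<Sum>l\<in>UNIV. x $ l * g l x s) \<le> (\<Sum>l\<in>(UNIV :: 'n set). \<rho> * C)"
    proof (rule sum_norm_le)
      fix l
      have "norm (x $ l) \<le> \<rho>"
        using Finite_Cartesian_Product.norm_nth_le[of x l] x by simp
      then show "norm (x $ l * g l x s) \<le> \<rho> * C"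
        unfolding norm_mult using assms(3)[OF s, of l] C \<rho> by (intro mult_mono) auto
    qed
    then show "norm (\<Sum>l\<in>UNIV. x $ l * g l x s) \<le> of_nat CARD('n) * \<rho> * C" by simp
  qed simp
  then show ?thesis by simp
qed

text \<open>The closed ball of radius \<open>norm x\<close> is compact, so a first bound exists; then the hypothesis can be iterated.\<close>

lemma halving_imp_zero:
  fixes E :: "'i :: finite \<Rightarrow> complex ^ 'n \<Rightarrow> complex"
  assumes cont: "\<And>i. continuous_on (ball 0 \<rho>) (E i)"
    and half: "\<And>C x i. C \<ge> 0 \<Longrightarrow> x \<in> ball 0 \<rho> \<Longrightarrow> (\<And>y j. norm y \<le> norm x \<Longrightarrow> norm (E j y) \<le> C)
                \<Longrightarrow> norm (E i x) \<le> C / 2"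
    and x: "x \<in> ball 0 \<rho>"
  shows "E i x = 0"
proof -
  let ?K = "cball (0 :: complex ^ 'n) (norm x)"
  have K: "?K \<subseteq> ball 0 \<rho>" using x by auto
  have "compact ((\<lambda>y. \<Sum>j\<in>UNIV. norm (E j y)) ` ?K)"
    by (intro compact_continuous_image continuous_intros continuous_on_subset[OF cont K] compact_cball)
  then obtain C where C: "\<And>y. y \<in> ?K \<Longrightarrow> (\<Sum>j\<in>UNIV. norm (E j y)) \<le> C"
    using bounded_imp_bdd_above[OF compact_imp_bounded] by (fastforce simp: bdd_above_def)
  have C0: "C \<ge> 0" using C[of 0] sum_nonneg[of UNIV "\<lambda>j. norm (E j 0)"] by force
  have b: "norm (E j y) \<le> C / 2 ^ k" if "norm y \<le> norm x" for j y k
    using that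
  proof (induction k arbitrary: j y)
    case 0
    have "norm (E j y) \<le> (\<Sum>j\<in>UNIV. norm (E j y))" by (rule member_le_sum) auto
    with C[of y] 0 show ?case by simp
  next
    case (Suc k)
    have "norm (E j y) \<le> (C / 2 ^ k) / 2"
      by (rule half) (use Suc C0 x in auto)
    then show ?case by simp
  qed
  have "(\<lambda>k. C / 2 ^ k) \<longlonglongrightarrow> 0" by real_asymp
  then have "norm (E i x) \<le> 0"
    by (rule LIMSEQ_le_const) (use b in auto)
  then show ?thesis by simp
qed

section \<open>The Frobenius theorem for linear systems\<close>

text \<open>\<open>small\<close> makes ray integrals contract. The constant is 1/4 because the error
  in \<open>Frobenius\<close> is bounded by a difference of two terms of Picard type and must still
  be halved.\<close>

locale linear_system =
  fixes m :: "'n :: finite \<Rightarrow> 'm :: finite \<Rightarrow> 'm \<Rightarrow> complex ^ 'n \<Rightarrow> complex" and \<rho> B :: real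
  assumes m_holo: "\<And>l i j. holo_on (ball 0 \<rho>) (m l i j)"
    and m_bound: "\<And>l i j x. x \<in> ball 0 \<rho> \<Longrightarrow> norm (m l i j x) \<le> B"
    and rho_pos: "\<rho> > 0"
    and small: "of_nat CARD('n) * \<rho> * (of_nat CARD('m) * B) \<le> 1 / 4"
begin

abbreviation disc :: "(complex ^ 'n) set" where "disc \<equiv> ball 0 \<rho>"

definition rhs :: "('m \<Rightarrow> complex ^ 'n \<Rightarrow> complex) \<Rightarrow> 'n \<Rightarrow> 'm \<Rightarrow> complex ^ 'n \<Rightarrow> complex" where
  "rhs Y l i x = (\<Sum>j\<in>UNIV. m l i j x * Y j x)"

text \<open>The 1-form with coefficients \<open>rhs Y l i\<close> is integrated along the ray from 0
  to \<open>x\<close>. In several variables a fixed point directly satisfies the equations in the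
  radial direction only; the other directions are the content of \<open>Frobenius\<close>.\<close>

definition picard :: "('m \<Rightarrow> complex ^ 'n \<Rightarrow> complex) \<Rightarrow> 'm \<Rightarrow> complex ^ 'n \<Rightarrow> complex" where
  "picard Y i x = integral (cbox 0 (1::real)) (\<lambda>s. \<Sum>l\<in>UNIV. x $ l * rhs Y l i (of_real s *s x))"

lemma B_nonneg: "B \<ge> 0"
  by (rule order_trans[OF norm_ge_zero m_bound[of 0]]) (simp add: rho_pos)

lemma rhs_continuous: "(\<And>j. continuous_on disc (Y j)) \<Longrightarrow> continuous_on disc (rhs Y l i)"
  unfolding rhs_def by (intro continuous_on_sum continuous_on_mult holo_on_continuous[OF m_holo])

lemma rhs_holo: "(\<And>j. holo_on disc (Y j)) \<Longrightarrow> holo_on disc (rhs Y l i)"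
  unfolding rhs_def by (intro holo_on_sum holo_on_mult m_holo open_ball)

lemma rhs_bound:
  assumes "x \<in> disc" "\<And>j. norm (Y j x) \<le> C"
  shows "norm (rhs Y l i x) \<le> of_nat CARD('m) * B * C"
proof -
  have "norm (rhs Y l i x) \<le> (\<Sum>j\<in>(UNIV :: 'm set). B * C)"
    unfolding rhs_def
  proof (rule sum_norm_le)
    fix j
    show "norm (m l i j x * Y j x) \<le> B * C"
      unfolding norm_mult by (rule mult_mono[OF m_bound[OF assms(1)] assms(2) B_nonneg norm_ge_zero])
  qed
  then show ?thesis by (simp add: mult.assoc)
qed

text \<open>A ray to \<open>x\<close> stays among the points of norm at most \<open>norm x\<close>,
  so the bound on \<open>Y\<close> is asked only there, which is what
  \<open>halving_imp_zero\<close> provides.\<close>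

lemma picard_bound:
  assumes Y: "\<And>j. continuous_on disc (Y j)" and x: "x \<in> disc" and "C \<ge> 0"
    and b: "\<And>y j. norm y \<le> norm x \<Longrightarrow> norm (Y j y) \<le> C"
  shows "norm (picard Y i x) \<le> C / 2"
proof -
  have "norm (picard Y i x) \<le> of_nat CARD('n) * \<rho> * (of_nat CARD('m) * B * C)"
    unfolding picard_def
  proof (rule norm_ray_integral_le[OF x, where g="\<lambda>l x s. rhs Y l i (of_real s *s x)"])
    show "continuous_on (cbox 0 1) (\<lambda>s. rhs Y l i (of_real s *s x))" for l
      by (rule continuous_on_ray[OF rhs_continuous[OF Y] x])
    show "norm (rhs Y l i (of_real s *s x)) \<le> of_nat CARD('m) * B * C" if "s \<in> cbox 0 1" for l s
      by (rule rhs_bound) (use ray_mem_ball[OF x that] b in auto)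
  qed
  also have "\<dots> = (of_nat CARD('n) * \<rho> * (of_nat CARD('m) * B)) * C"
    by (simp only: mult.assoc)
  also have "\<dots> \<le> 1 / 4 * C" using small \<open>C \<ge> 0\<close> by (rule mult_right_mono)
  finally show ?thesis using \<open>C \<ge> 0\<close> by linarith
qed

lemma picard_holo: "(\<And>j. holo_on disc (Y j)) \<Longrightarrow> holo_on disc (picard Y i)"
  using holo_on_ray_integral(1)[of \<rho> "\<lambda>l. rhs Y l i"] rhs_holo by (simp add: picard_def[abs_def])

lemma picard_diff:
  assumes "\<And>j. continuous_on disc (Y j)" "\<And>j. continuous_on disc (Z j)" "x \<in> disc"
  shows "picard Y i x - picard Z i x = picard (\<lambda>j y. Y j y - Z j y) i x"
proof -
  have "(\<lambda>s. \<Sum>l\<in>UNIV. x $ l * rhs X l i (of_real s *s x)) integrable_on cbox 0 (1::real)"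
    if "\<And>j. continuous_on disc (X j)" for X
    by (intro integrable_continuous continuous_intros continuous_on_ray[OF rhs_continuous[OF that] assms(3)])
  note 1 = integral_diff[OF this[OF assms(1)] this[OF assms(2)]]
  have 2: "rhs Y l i y - rhs Z l i y = rhs (\<lambda>j y. Y j y - Z j y) l i y" for l y
    by (simp add: rhs_def algebra_simps sum_subtractf)
  show ?thesis
    unfolding picard_def 1[symmetric] sum_subtractf[symmetric] right_diff_distrib[symmetric] 2 ..
qed

text \<open>The fundamental theorem of calculus along rays identifies a solution vanishing at 0 with
  its own Picard integral, and this at least halves every bound.\<close>

lemma unique_solution:
  assumes Y: "\<And>j. holo_on disc (Y j)"
    and eq: "\<And>l i x. x \<in> disc \<Longrightarrow> ddir (axis l 1) (Y i) x = rhs Y l i x"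
    and init: "\<And>i. Y i 0 = 0" and x: "x \<in> disc"
  shows "Y i x = 0"
proof (rule halving_imp_zero[OF holo_on_continuous[OF Y] _ x])
  fix C x i assume *: "0 \<le> C" "x \<in> disc" "\<And>y j. norm y \<le> norm x \<Longrightarrow> norm (Y j y) \<le> C"
  have "Y i x = integral (cbox 0 1) (\<lambda>s. \<Sum>l\<in>UNIV. x $ l * ddir (axis l 1) (Y i) (of_real s *s x))"
    using ray_fundamental[OF Y *(2)] init by simp
  also have "\<dots> = picard Y i x"
    unfolding picard_def
    by (rule integral_cong) (simp only: eq[OF ray_mem_ball(1)[OF *(2)]])
  finally have "norm (Y i x) = norm (picard Y i x)" by (rule arg_cong)
  then show "norm (Y i x) \<le> C / 2"
    using picard_bound[OF holo_on_continuous[OF Y] *(2,1,3)] by (simp only:)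
qed

lemma picard_fixpoint:
  "\<exists>Y. (\<forall>i. holo_on disc (Y i)) \<and> (\<forall>i. \<forall>x\<in>disc. Y i x = c i + picard Y i x)"
proof -
  \<comment> \<open>Iteration from 0, so the first iterate is the constant \<open>c\<close> and the
    differences start with norm at most \<open>C\<close>.\<close>
  define S where "S = rec_nat (\<lambda>i x. 0) (\<lambda>_ Z i x. c i + picard Z i x)"
  have S0: "S 0 = (\<lambda>i x. 0)" and SS: "S (Suc k) = (\<lambda>i x. c i + picard (S k) i x)" for k
    by (simp_all add: S_def)
  have Sh: "holo_on disc (S k i)" for k i
    by (induction k arbitrary: i) (auto simp: S0 SS intro!: holo_on_const holo_on_add picard_holo)
  note Sc = holo_on_continuous[OF Sh]
  define D where "D k i x = S (Suc k) i x - S k i x" for k i x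
  have Dc: "continuous_on disc (D k i)" for k i
    unfolding D_def by (intro continuous_intros Sc)
  define C where "C = (\<Sum>i\<in>UNIV. norm (c i))"
  have C0: "C \<ge> 0" by (simp add: C_def sum_nonneg)
  have Db: "norm (D k i x) \<le> C * (1/2) ^ k" if "x \<in> disc" for k i x
    using that
  proof (induction k arbitrary: i x)
    case 0
    have "picard (\<lambda>i x. 0) i x = 0" by (simp add: picard_def rhs_def)
    moreover have "norm (c i) \<le> C" unfolding C_def by (rule member_le_sum) auto
    ultimately show ?case by (simp add: D_def SS S0)
  next
    case (Suc k)
    have "S (Suc j) i x = c i + picard (S j) i x" for j by (simp add: SS)
    then have "D (Suc k) i x = picard (S (Suc k)) i x - picard (S k) i x"
      unfolding D_def by (simp only: add_diff_cancel_left)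
    also have "\<dots> = picard (\<lambda>j y. S (Suc k) j y - S k j y) i x"
      by (rule picard_diff[OF Sc Sc Suc.prems])
    also have "(\<lambda>j y. S (Suc k) j y - S k j y) = D k" by (simp only: D_def[abs_def])
    finally have "D (Suc k) i x = picard (D k) i x" .
    moreover have "norm (picard (D k) i x) \<le> C * (1/2) ^ k / 2"
      by (rule picard_bound[OF Dc Suc.prems]) (use C0 Suc in auto)
    ultimately show ?case by simp
  qed
  define Y where "Y i x = (\<Sum>k. D k i x)" for i x
  have lim: "uniform_limit disc (\<lambda>k. S k i) (Y i) sequentially" for i
  proof -
    have "uniform_limit disc (\<lambda>k x. \<Sum>j<k. D j i x) (Y i) sequentially"
      unfolding Y_def
      by (rule Weierstrass_m_test[OF Db]) (auto intro!: summable_mult summable_geometric)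
    moreover have "(\<Sum>j<k. D j i x) = S k i x" for k x
      unfolding D_def using sum_lessThan_telescope[of "\<lambda>k. S k i x" k] by (simp add: S0)
    ultimately show ?thesis by simp
  qed
  have Yh: "holo_on disc (Y i)" for i
    by (rule holo_on_uniform_limit[OF open_ball Sh lim])
  have "Y i x = c i + picard Y i x" if x: "x \<in> disc" for i x
  proof (rule ccontr)
    assume ne: "Y i x \<noteq> c i + picard Y i x"
    \<comment> \<open>The defect has norm \<open>2 * e\<close>, while the uniform approximations
      below bound it by \<open>e + e / 2\<close>.\<close>
    define e where "e = norm (Y i x - (c i + picard Y i x)) / 2"
    have e: "e > 0" using ne by (simp add: e_def)
    have ev: "\<forall>\<^sub>F k in sequentially. \<forall>j. \<forall>y\<in>disc. norm (Y j y - S k j y) \<le> e"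
    proof (rule eventually_all_finite)
      fix j
      show "\<forall>\<^sub>F k in sequentially. \<forall>y\<in>disc. norm (Y j y - S k j y) \<le> e"
        using uniform_limitD[OF lim e, of j]
        by eventually_elim (auto simp: dist_norm norm_minus_commute less_imp_le)
    qed
    then have "\<forall>\<^sub>F k in sequentially. (\<forall>j. \<forall>y\<in>disc. norm (Y j y - S k j y) \<le> e) \<and>
        (\<forall>j. \<forall>y\<in>disc. norm (Y j y - S (Suc k) j y) \<le> e)"
      using eventually_conj eventually_sequentially_Suc[of "\<lambda>k. \<forall>j. \<forall>y\<in>disc. norm (Y j y - S k j y) \<le> e"]
      by blast
    then obtain k where k: "\<And>j y. y \<in> disc \<Longrightarrow> norm (Y j y - S k j y) \<le> e"
        "norm (Y i x - S (Suc k) i x) \<le> e"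
      using x unfolding eventually_sequentially by blast
    have "norm (picard (\<lambda>j y. S k j y - Y j y) i x) \<le> e / 2"
    proof (rule picard_bound[OF _ x])
      show "continuous_on disc (\<lambda>y. S k j y - Y j y)" for j
        by (intro continuous_intros Sc holo_on_continuous[OF Yh])
      fix y :: "complex ^ 'n" and j assume "norm y \<le> norm x"
      then show "norm (S k j y - Y j y) \<le> e"
        using k(1)[of y j] x by (simp add: norm_minus_commute)
    qed (use e in auto)
    moreover have "picard (S k) i x - picard Y i x = picard (\<lambda>j y. S k j y - Y j y) i x"
      by (rule picard_diff[OF Sc holo_on_continuous[OF Yh] x])
    ultimately have "norm (picard (S k) i x - picard Y i x) \<le> e / 2" by (simp only:)
    moreover have "Y i x - (c i + picard Y i x)
        = (Y i x - S (Suc k) i x) + (picard (S k) i x - picard Y i x)"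
      by (simp add: SS)
    ultimately have "norm (Y i x - (c i + picard Y i x)) \<le> e + e / 2"
      using norm_triangle_le[OF add_mono[OF k(2)]] by (simp only:)
    then show False using e unfolding e_def by simp
  qed
  with Yh show ?thesis by blast
qed

text \<open>\<open>flat\<close> is the equality of mixed derivatives of a solution, computed through
  the system and read coefficient by coefficient. A fixed point of the Picard map satisfies the
  system up to an error \<open>E\<close>, which by the homotopy formula is a ray integral of the
  curl of \<open>rhs Y\<close>. Under \<open>flat\<close> this curl is linear in \<open>E\<close>,
  so \<open>E\<close> obeys the halving bound.\<close>

theorem Frobenius:
  assumes flat: "\<And>x k l i r. x \<in> disc \<Longrightarrow>
      ddir (axis k 1) (m l i r) x - ddir (axis l 1) (m k i r) x
        + (\<Sum>j\<in>UNIV. m l i j x * m k j r x - m k i j x * m l j r x) = 0"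
  shows "\<exists>Y. (\<forall>i. holo_on disc (Y i)) \<and> (\<forall>i. Y i 0 = c i) \<and>
           (\<forall>l i. \<forall>x\<in>disc. ddir (axis l 1) (Y i) x = rhs Y l i x)"
proof -
  obtain Y where Y: "\<And>i. holo_on disc (Y i)" "\<And>i x. x \<in> disc \<Longrightarrow> Y i x = c i + picard Y i x"
    using picard_fixpoint by blast
  define E where "E p x = ddir (axis (fst p) 1) (Y (snd p)) x - rhs Y (fst p) (snd p) x" for p x
  have dY: "ddir (axis k 1) (Y j) x = E (k, j) x + rhs Y k j x" for k j x by (simp add: E_def)
  have Ec: "continuous_on disc (E p)" for p
    unfolding E_def by (intro continuous_intros ddir_continuous_on Y rhs_continuous holo_on_continuous)
  have curl: "ddir (axis k 1) (rhs Y l i) x - ddir (axis l 1) (rhs Y k i) x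
      = rhs (\<lambda>j. E (k, j)) l i x - rhs (\<lambda>j. E (l, j)) k i x" if x: "x \<in> disc" for k l i x
  proof -
    \<comment> \<open>Substituting \<open>E\<close> plus \<open>rhs Y\<close> for the derivatives of
      \<open>Y\<close> isolates the part that is linear in \<open>E\<close>; the other terms are
      those of \<open>flat\<close>.\<close>
    have d: "ddir (axis k 1) (rhs Y l i) x = (\<Sum>r\<in>UNIV. ddir (axis k 1) (m l i r) x * Y r x)
        + rhs (\<lambda>j. E (k, j)) l i x + (\<Sum>r\<in>UNIV. (\<Sum>j\<in>UNIV. m l i j x * m k j r x) * Y r x)" for k l
    proof -
      have "ddir (axis k 1) (rhs Y l i) x
         = (\<Sum>j\<in>UNIV. ddir (axis k 1) (m l i j) x * Y j x + m l i j x * ddir (axis k 1) (Y j) x)"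
        unfolding rhs_def[abs_def]
        by (subst ddir_sum[OF _ x]) (auto intro!: holo_on_mult m_holo Y sum.cong ddir_mult[OF m_holo Y(1) x])
      also have "\<dots> = (\<Sum>r\<in>UNIV. ddir (axis k 1) (m l i r) x * Y r x)
        + rhs (\<lambda>j. E (k, j)) l i x + (\<Sum>j\<in>UNIV. m l i j x * (\<Sum>r\<in>UNIV. m k j r x * Y r x))"
        unfolding dY by (simp add: rhs_def sum.distrib algebra_simps)
      also have "(\<Sum>j\<in>UNIV. m l i j x * (\<Sum>r\<in>UNIV. m k j r x * Y r x))
          = (\<Sum>r\<in>UNIV. (\<Sum>j\<in>UNIV. m l i j x * m k j r x) * Y r x)"
        by (simp add: sum_distrib_left sum_distrib_right mult.assoc) (rule sum.swap)
      finally show ?thesis .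
    qed
    have "(\<Sum>r\<in>UNIV. (ddir (axis k 1) (m l i r) x - ddir (axis l 1) (m k i r) x
        + (\<Sum>j\<in>UNIV. m l i j x * m k j r x - m k i j x * m l j r x)) * Y r x) = 0"
      using flat[OF x] by simp
    then show ?thesis unfolding d
      by (simp add: algebra_simps sum.distrib sum_subtractf)
  qed
  have P: "ddir (axis k 1) (Y i) x = ddir (axis k 1) (picard Y i) x" if x: "x \<in> disc" for i x k
  proof -
    have "ddir (axis k 1) (Y i) x = ddir (axis k 1) (\<lambda>x. c i + picard Y i x) x"
      by (rule ddir_cong[OF open_ball x]) (rule Y(2))
    also have "\<dots> = ddir (axis k 1) (picard Y i) x"
      by (subst ddir_add[OF holo_on_const picard_holo x]) (auto intro: Y)
    finally show ?thesis .
  qed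
  have E0: "E p x = 0" if "x \<in> disc" for p x
  proof (rule halving_imp_zero[OF Ec _ that])
    fix C x and p :: "'n \<times> 'm" assume *: "0 \<le> C" "x \<in> disc" "\<And>y q. norm y \<le> norm x \<Longrightarrow> norm (E q y) \<le> C"
    obtain k i where p: "p = (k, i)" by (cases p)
    have "E p x = integral (cbox 0 1) (\<lambda>s. \<Sum>l\<in>UNIV. x $ l * (of_real s *
        (ddir (axis k 1) (rhs Y l i) (of_real s *s x) - ddir (axis l 1) (rhs Y k i) (of_real s *s x))))"
      using holo_on_ray_integral(2)[of \<rho> "\<lambda>l. rhs Y l i" x k] rhs_holo[of Y] Y(1) *(2) P[OF *(2)]
      by (simp add: p E_def picard_def[abs_def])
    also have "norm \<dots> \<le> of_nat CARD('n) * \<rho> * (2 * (of_nat CARD('m) * B * C))"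
    proof (rule norm_ray_integral_le[OF *(2), where g="\<lambda>l x s. of_real s *
        (ddir (axis k 1) (rhs Y l i) (of_real s *s x) - ddir (axis l 1) (rhs Y k i) (of_real s *s x))"])
      show "continuous_on (cbox 0 1) (\<lambda>s. complex_of_real s *
        (ddir (axis k 1) (rhs Y l i) (of_real s *s x) - ddir (axis l 1) (rhs Y k i) (of_real s *s x)))" for l
        by (intro continuous_intros continuous_on_ray[OF _ *(2)] ddir_continuous_on rhs_holo Y)
      fix l and s :: real assume s: "s \<in> cbox 0 1"
      note r = ray_mem_ball[OF *(2) s]
      have b: "norm (rhs (\<lambda>j. E (k, j)) l i (of_real s *s x)) \<le> of_nat CARD('m) * B * C" for k l
        by (rule rhs_bound) (use r *(3) in auto)
      have "norm (of_real s * (ddir (axis k 1) (rhs Y l i) (of_real s *s x) - ddir (axis l 1) (rhs Y k i) (of_real s *s x)))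
         \<le> 1 * norm (rhs (\<lambda>j. E (k, j)) l i (of_real s *s x) - rhs (\<lambda>j. E (l, j)) k i (of_real s *s x))"
        unfolding norm_mult curl[OF r(1)] using s by (intro mult_right_mono) auto
      also have "\<dots> \<le> 2 * (of_nat CARD('m) * B * C)"
        unfolding mult_2 mult_1 by (rule norm_triangle_le_diff[OF add_mono[OF b b]])
      finally show "norm (of_real s * (ddir (axis k 1) (rhs Y l i) (of_real s *s x) - ddir (axis l 1) (rhs Y k i) (of_real s *s x)))
         \<le> 2 * (of_nat CARD('m) * B * C)" .
    qed
    also have "\<dots> = (of_nat CARD('n) * \<rho> * (of_nat CARD('m) * B)) * (2 * C)"
      by (simp only: mult_ac)
    also have "\<dots> \<le> 1 / 4 * (2 * C)" using small *(1) by (intro mult_right_mono) auto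
    finally show "norm (E p x) \<le> C / 2" by simp
  qed
  have "Y i 0 = c i" for i
    using Y(2)[of 0 i] rho_pos by (simp add: picard_def)
  moreover have "ddir (axis l 1) (Y i) x = rhs Y l i x" if "x \<in> disc" for l i x
    using E0[OF that, of "(l, i)"] by (simp add: E_def)
  ultimately show ?thesis using Y(1) by blast
qed

end

lemma linear_system_exists:
  fixes m :: "'n :: finite \<Rightarrow> 'm :: finite \<Rightarrow> 'm \<Rightarrow> complex ^ 'n \<Rightarrow> complex"
  assumes m: "\<And>l i j. holo_on X (m l i j)" and X: "open X" "0 \<in> X"
  shows "\<exists>\<rho> B. ball 0 \<rho> \<subseteq> X \<and> linear_system m \<rho> B"
proof -
  obtain r0 where r0: "r0 > 0" "cball 0 r0 \<subseteq> X" using X open_contains_cball by blast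
  have "compact ((\<lambda>y. \<Sum>l\<in>UNIV. \<Sum>i\<in>UNIV. \<Sum>j\<in>UNIV. norm (m l i j y)) ` cball 0 r0)"
    by (intro compact_continuous_image continuous_intros compact_cball
        continuous_on_subset[OF holo_on_continuous[OF m] r0(2)])
  then obtain B where B: "\<And>y. y \<in> cball 0 r0 \<Longrightarrow> (\<Sum>l\<in>UNIV. \<Sum>i\<in>UNIV. \<Sum>j\<in>UNIV. norm (m l i j y)) \<le> B"
    using bounded_imp_bdd_above[OF compact_imp_bounded] by (fastforce simp: bdd_above_def)
  have mb: "norm (m l i j y) \<le> B" if "y \<in> cball 0 r0" for l i j y
  proof -
    have "norm (m l i j y) \<le> (\<Sum>j\<in>UNIV. norm (m l i j y))" by (rule member_le_sum) auto
    also have "\<dots> \<le> (\<Sum>i\<in>UNIV. \<Sum>j\<in>UNIV. norm (m l i j y))"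
      by (rule member_le_sum[of i UNIV "\<lambda>i. \<Sum>j\<in>UNIV. norm (m l i j y)"]) (auto intro!: sum_nonneg)
    also have "\<dots> \<le> (\<Sum>l\<in>UNIV. \<Sum>i\<in>UNIV. \<Sum>j\<in>UNIV. norm (m l i j y))"
      by (rule member_le_sum[of l UNIV "\<lambda>l. \<Sum>i\<in>UNIV. \<Sum>j\<in>UNIV. norm (m l i j y)"]) (auto intro!: sum_nonneg)
    also have "\<dots> \<le> B" by (rule B[OF that])
    finally show ?thesis .
  qed
  have B0: "B \<ge> 0"
    by (rule order_trans[OF norm_ge_zero mb[of 0]]) (use r0 in simp)
  define M where "M = real CARD('n) * (real CARD('m) * B)"
  have M0: "M \<ge> 0" using B0 by (simp add: M_def)
  \<comment> \<open>\<open>M + 1\<close> keeps the quotient meaningful when \<open>M = 0\<close>;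
    the factor 4 gives the 1/4 of \<open>small\<close>.\<close>
  define \<rho> where "\<rho> = min r0 (1 / (4 * (M + 1)))"
  have \<rho>: "\<rho> > 0" "\<rho> \<le> r0" using r0 M0 by (auto simp: \<rho>_def)
  have "\<rho> * M \<le> 1 / (4 * (M + 1)) * M" using M0 by (intro mult_right_mono) (auto simp: \<rho>_def)
  also have "\<dots> \<le> 1 / 4" using M0 by (simp add: divide_simps)
  finally have small: "real CARD('n) * \<rho> * (real CARD('m) * B) \<le> 1 / 4"
    by (simp add: M_def mult_ac)
  have sub: "ball 0 \<rho> \<subseteq> cball 0 r0" using \<rho> by auto
  have "linear_system m \<rho> B"
  proof
    show "holo_on (ball 0 \<rho>) (m l i j)" for l i j
      by (rule holo_on_subset[OF m]) (use sub r0 in auto)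
    show "norm (m l i j x) \<le> B" if "x \<in> ball 0 \<rho>" for l i j x
      by (rule mb) (use sub that in blast)
  qed (use \<rho> small in auto)
  then show ?thesis using sub r0(2) by blast
qed

section \<open>Root systems\<close>

lemma root_eval_add: "root_eval (x + y) u = root_eval x u + root_eval y u"
  by (simp add: root_eval_def algebra_simps sum.distrib)

lemma root_eval_scaleR: "root_eval (c *\<^sub>R x) u = of_real c * root_eval x u"
  by (simp add: root_eval_def algebra_simps sum_distrib_left)

lemma root_eval_zero [simp]: "root_eval 0 u = 0" "root_eval x 0 = 0"
  by (simp_all add: root_eval_def)

lemma root_eval_plus: "root_eval x (u + v) = root_eval x u + root_eval x v"
  by (simp add: root_eval_def algebra_simps sum.distrib)

lemma root_eval_minus: "root_eval x (u - v) = root_eval x u - root_eval x v"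
  by (simp add: root_eval_def algebra_simps sum_subtractf)

lemma root_eval_smult: "root_eval x (c *s u) = c * root_eval x u"
  by (simp add: root_eval_def algebra_simps sum_distrib_left)

lemma root_eval_sum: "root_eval x (\<Sum>i\<in>I. f i) = (\<Sum>i\<in>I. root_eval x (f i))"
  by (induction I rule: infinite_finite_induct) (auto simp: root_eval_plus)

lemma root_eval_lattice:
  "root_eval (\<Sum>\<alpha>\<in>I. c \<alpha> *\<^sub>R \<alpha>) u = (\<Sum>\<alpha>\<in>I. of_real (c \<alpha>) * root_eval \<alpha> u)"
  by (induction I rule: infinite_finite_induct) (auto simp: root_eval_add root_eval_scaleR)

lemma root_eval_cvec: "root_eval x (cvec y) = of_real (x \<bullet> y)"
  by (simp add: root_eval_def cvec_def inner_vec_def)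

lemma continuous_on_root_eval [continuous_intros]:
  "continuous_on A f \<Longrightarrow> continuous_on A (\<lambda>z. root_eval x (f z))"
  unfolding root_eval_def by (intro continuous_intros)

text \<open>\<open>f\<close> behaves under the reflection in \<open>\<alpha>\<close> like a linear
  map. The reflection permutes \<open>R\<close> and negates
  \<open>\<alpha> \<bullet> \<beta>\<close>, so reindexing the sum turns it into twice the
  right-hand side minus itself. Used with the identity map and, through \<open>dual_frame\<close>,
  with logarithms.\<close>

lemma root_system_reflection_sum:
  assumes R: "root_system R" and \<alpha>: "\<alpha> \<in> R"
    and f: "\<And>\<beta>. \<beta> \<in> R \<Longrightarrow> f (reflection \<alpha> \<beta>) = f \<beta> - (2 * (\<alpha> \<bullet> \<beta>) / (\<alpha> \<bullet> \<alpha>)) *\<^sub>R f \<alpha>"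
  shows "(\<Sum>\<beta>\<in>R. (\<alpha> \<bullet> \<beta>) *\<^sub>R f \<beta>) = ((\<Sum>\<beta>\<in>R. (\<alpha> \<bullet> \<beta>)\<^sup>2) / (\<alpha> \<bullet> \<alpha>)) *\<^sub>R (f \<alpha> :: 'b :: real_vector)"
proof -
  have fin: "finite R" and sub: "reflection \<alpha> ` R \<subseteq> R" and "\<alpha> \<noteq> 0"
    using R \<alpha> unfolding root_system_def by auto
  then have aa: "\<alpha> \<bullet> \<alpha> \<noteq> 0" by simp
  have neg: "\<alpha> \<bullet> reflection \<alpha> x = - (\<alpha> \<bullet> x)" for x
    using aa by (simp add: reflection_def inner_diff_right)
  have inv: "reflection \<alpha> (reflection \<alpha> x) = x" for x
    unfolding reflection_def[of \<alpha> "reflection \<alpha> x"] neg by (simp add: reflection_def)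
  have inj: "inj_on (reflection \<alpha>) R" using inv by (metis inj_onI)
  have bij: "bij_betw (reflection \<alpha>) R R"
    using inj endo_inj_surj[OF fin sub inj] by (simp add: bij_betw_def)
  let ?S = "\<Sum>\<beta>\<in>R. (\<alpha> \<bullet> \<beta>) *\<^sub>R f \<beta>"
  have "?S = (\<Sum>\<beta>\<in>R. (\<alpha> \<bullet> reflection \<alpha> \<beta>) *\<^sub>R f (reflection \<alpha> \<beta>))"
    using sum.reindex_bij_betw[OF bij, of "\<lambda>\<beta>. (\<alpha> \<bullet> \<beta>) *\<^sub>R f \<beta>"] by simp
  also have "\<dots> = (\<Sum>\<beta>\<in>R. (2 * ((\<alpha> \<bullet> \<beta>)\<^sup>2 / (\<alpha> \<bullet> \<alpha>))) *\<^sub>R f \<alpha> - (\<alpha> \<bullet> \<beta>) *\<^sub>R f \<beta>)"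
    by (rule sum.cong) (simp_all add: neg f scaleR_right_diff_distrib power2_eq_square mult_ac)
  also have "\<dots> = 2 *\<^sub>R (((\<Sum>\<beta>\<in>R. (\<alpha> \<bullet> \<beta>)\<^sup>2) / (\<alpha> \<bullet> \<alpha>)) *\<^sub>R f \<alpha>) - ?S"
    by (simp add: sum_subtractf sum_distrib_left sum_divide_distrib flip: scaleR_left.sum)
  finally have "?S + ?S = 2 *\<^sub>R (((\<Sum>\<beta>\<in>R. (\<alpha> \<bullet> \<beta>)\<^sup>2) / (\<alpha> \<bullet> \<alpha>)) *\<^sub>R f \<alpha>)"
    by (simp add: algebra_simps)
  then have "2 *\<^sub>R ?S = 2 *\<^sub>R (((\<Sum>\<beta>\<in>R. (\<alpha> \<bullet> \<beta>)\<^sup>2) / (\<alpha> \<bullet> \<alpha>)) *\<^sub>R f \<alpha>)"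
    by (simp only: scaleR_2)
  then show ?thesis by (simp only: scaleR_cancel_left) simp
qed

lemma orthogonal_to_roots:
  assumes "root_system R" "\<And>\<beta>. \<beta> \<in> R \<Longrightarrow> \<beta> \<bullet> x = 0"
  shows "x = 0"
proof -
  have "x \<in> span R" using assms(1) by (simp add: root_system_def)
  then have "orthogonal x x"
    by (rule orthogonal_to_span) (use assms(2) in \<open>auto simp: orthogonal_def inner_commute\<close>)
  then show ?thesis by (simp add: orthogonal_def)
qed

text \<open>The second clause says that values on the roots which are compatible with the reflection
  in \<open>\<alpha>\<close> are reproduced at \<open>\<alpha>\<close> by the linear form that the
  frame builds from them. It serves to construct a vector with prescribed root values.\<close>

definition dual_frame :: "(real ^ 'n) set \<Rightarrow> (real ^ 'n \<Rightarrow> real ^ 'n) \<Rightarrow> bool" where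
  "dual_frame R S \<longleftrightarrow> (\<forall>x. (\<Sum>\<beta>\<in>R. (\<beta> \<bullet> x) *\<^sub>R S \<beta>) = x) \<and>
     (\<forall>\<alpha>\<in>R. \<forall>f :: real ^ 'n \<Rightarrow> complex.
       (\<forall>\<beta>\<in>R. f (reflection \<alpha> \<beta>) = f \<beta> - (2 * (\<alpha> \<bullet> \<beta>) / (\<alpha> \<bullet> \<alpha>)) *\<^sub>R f \<alpha>) \<longrightarrow>
       (\<Sum>\<beta>\<in>R. (\<alpha> \<bullet> S \<beta>) *\<^sub>R f \<beta>) = f \<alpha>)"

text \<open>\<open>S\<close> is the inverse of \<open>x \<mapsto> \<Sum>\<^sub>\<beta> (\<beta> \<bullet> x) \<beta>\<close>, which has every root as an eigenvector.\<close>

lemma dual_frame_exists: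
  fixes R :: "(real ^ 'n) set"
  assumes R: "root_system R"
  shows "\<exists>S. dual_frame R S"
proof -
  define T where "T x = (\<Sum>\<beta>\<in>R. (\<beta> \<bullet> x) *\<^sub>R \<beta>)" for x :: "real ^ 'n"
  have fin: "finite R" using R by (simp add: root_system_def)
  have lin: "linear T"
    by (rule linearI) (auto simp: T_def inner_add_right scaleR_add_left sum.distrib scaleR_sum_right)
  have Tsym: "T x \<bullet> y = x \<bullet> T y" for x y
    by (simp add: T_def inner_sum_left inner_sum_right inner_commute mult.commute)
  have "x = 0" if "T x = 0" for x
  proof (rule orthogonal_to_roots[OF R])
    fix \<beta> assume \<beta>: "\<beta> \<in> R"
    have "(\<Sum>\<beta>\<in>R. (\<beta> \<bullet> x)\<^sup>2) = T x \<bullet> x"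
      by (simp add: T_def inner_sum_left power2_eq_square)
    with that have "(\<Sum>\<beta>\<in>R. (\<beta> \<bullet> x)\<^sup>2) = 0" by simp
    then show "\<beta> \<bullet> x = 0" using \<beta> fin by (simp add: sum_nonneg_eq_0_iff)
  qed
  then have inj: "inj T" using lin by (simp add: linear_injective_0)
  obtain S where S: "linear S" "S \<circ> T = id" using linear_injective_left_inverse[OF lin inj] by blast
  have ST: "S (T x) = x" for x using S(2) by (metis comp_apply id_apply)
  have "surj T" using lin inj linear_injective_imp_surjective by blast
  then have TS: "T (S x) = x" for x using ST by (metis surjD)
  have Ssym: "x \<bullet> S y = S x \<bullet> y" for x y
    using Tsym[of "S x" "S y"] TS by simp
  have "dual_frame R S"
    unfolding dual_frame_def
  proof (intro conjI allI ballI impI)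
    show "(\<Sum>\<beta>\<in>R. (\<beta> \<bullet> x) *\<^sub>R S \<beta>) = x" for x
      using ST[of x] by (simp add: T_def linear_sum[OF S(1)] linear_cmul[OF S(1)])
    fix \<alpha> and f :: "real ^ 'n \<Rightarrow> complex"
    assume \<alpha>: "\<alpha> \<in> R"
      and f: "\<forall>\<beta>\<in>R. f (reflection \<alpha> \<beta>) = f \<beta> - (2 * (\<alpha> \<bullet> \<beta>) / (\<alpha> \<bullet> \<alpha>)) *\<^sub>R f \<alpha>"
    define c where "c = (\<Sum>\<beta>\<in>R. (\<alpha> \<bullet> \<beta>)\<^sup>2) / (\<alpha> \<bullet> \<alpha>)"
    \<comment> \<open>The reflection sum for the identity map. The eigenvalue \<open>c\<close>
      cannot vanish, since \<open>e\<close> below would then give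
      \<open>\<alpha> = 0\<close>.\<close>
    have "T \<alpha> = c *\<^sub>R \<alpha>"
      using root_system_reflection_sum[OF R \<alpha>, of "\<lambda>x. x"]
      by (simp add: T_def c_def reflection_def inner_commute)
    then have e: "\<alpha> = c *\<^sub>R S \<alpha>" using ST[of \<alpha>] linear_cmul[OF S(1)] by metis
    moreover have "\<alpha> \<noteq> 0" using R \<alpha> by (auto simp: root_system_def)
    ultimately have c: "c \<noteq> 0" by auto
    have Sa: "S \<alpha> = (1 / c) *\<^sub>R \<alpha>"
      by (subst (2) e) (simp add: c)
    have "(\<Sum>\<beta>\<in>R. (\<alpha> \<bullet> S \<beta>) *\<^sub>R f \<beta>) = (1 / c) *\<^sub>R (\<Sum>\<beta>\<in>R. (\<alpha> \<bullet> \<beta>) *\<^sub>R f \<beta>)"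
      by (simp add: Ssym Sa scaleR_sum_right)
    also have "(\<Sum>\<beta>\<in>R. (\<alpha> \<bullet> \<beta>) *\<^sub>R f \<beta>) = c *\<^sub>R f \<alpha>"
      unfolding c_def by (rule root_system_reflection_sum[OF R \<alpha> bspec[OF f]])
    also have "(1 / c) *\<^sub>R (c *\<^sub>R f \<alpha>) = f \<alpha>" using c by simp
    finally show "(\<Sum>\<beta>\<in>R. (\<alpha> \<bullet> S \<beta>) *\<^sub>R f \<beta>) = f \<alpha>" .
  qed
  then show ?thesis by blast
qed

lemma dual_frame_expand: "dual_frame R S \<Longrightarrow> (\<Sum>\<beta>\<in>R. (\<beta> \<bullet> x) *\<^sub>R S \<beta>) = x"
  unfolding dual_frame_def by blast

lemma dual_frame_expand': "dual_frame R S \<Longrightarrow> (\<Sum>\<beta>\<in>R. (S \<beta> \<bullet> x) *\<^sub>R \<beta>) = x"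
proof (rule vector_eq_rdot[THEN iffD1], rule allI)
  fix y assume S: "dual_frame R S"
  have "(\<Sum>\<beta>\<in>R. (S \<beta> \<bullet> x) *\<^sub>R \<beta>) \<bullet> y = (\<Sum>\<beta>\<in>R. (\<beta> \<bullet> y) *\<^sub>R S \<beta>) \<bullet> x"
    by (simp add: inner_sum_left mult.commute)
  then show "(\<Sum>\<beta>\<in>R. (S \<beta> \<bullet> x) *\<^sub>R \<beta>) \<bullet> y = x \<bullet> y"
    by (simp add: dual_frame_expand[OF S] inner_commute)
qed

lemma complex_expand:
  assumes S: "\<And>x. (\<Sum>\<beta>\<in>R. (P \<beta> \<bullet> x) *\<^sub>R Q \<beta>) = x"
  shows "(\<Sum>\<beta>\<in>R. root_eval (P \<beta>) u *s cvec (Q \<beta>)) = u"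
proof -
  define a where "a = (\<chi> i. Re (u $ i))"
  define b where "b = (\<chi> i. Im (u $ i))"
  have re: "Re (root_eval x u) = x \<bullet> a" "Im (root_eval x u) = x \<bullet> b" for x
    by (simp_all add: root_eval_def inner_vec_def a_def b_def)
  have "(\<Sum>\<beta>\<in>R. root_eval (P \<beta>) u *s cvec (Q \<beta>)) $ i = u $ i" for i
  proof (rule complex_eqI)
    have "Re ((\<Sum>\<beta>\<in>R. root_eval (P \<beta>) u *s cvec (Q \<beta>)) $ i) = (\<Sum>\<beta>\<in>R. (P \<beta> \<bullet> a) *\<^sub>R Q \<beta>) $ i"
      by (simp add: cvec_def re)
    then show "Re ((\<Sum>\<beta>\<in>R. root_eval (P \<beta>) u *s cvec (Q \<beta>)) $ i) = Re (u $ i)"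
      by (simp add: S a_def)
    have "Im ((\<Sum>\<beta>\<in>R. root_eval (P \<beta>) u *s cvec (Q \<beta>)) $ i) = (\<Sum>\<beta>\<in>R. (P \<beta> \<bullet> b) *\<^sub>R Q \<beta>) $ i"
      by (simp add: cvec_def re)
    then show "Im ((\<Sum>\<beta>\<in>R. root_eval (P \<beta>) u *s cvec (Q \<beta>)) $ i) = Im (u $ i)"
      by (simp add: S b_def)
  qed
  then show ?thesis by (simp add: vec_eq_iff)
qed

section \<open>Charts of the torus\<close>

lemma root_latticeI: "x = (\<Sum>\<alpha>\<in>R. real_of_int (m \<alpha>) *\<^sub>R \<alpha>) \<Longrightarrow> x \<in> root_lattice R"
  by (auto simp: root_lattice_def)

lemma root_lattice_root:
  assumes "finite R" "\<alpha> \<in> R"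
  shows "\<alpha> \<in> root_lattice R"
proof -
  have "\<alpha> = (\<Sum>\<beta>\<in>R. real_of_int (if \<beta> = \<alpha> then 1 else 0) *\<^sub>R \<beta>)"
    using assms by (simp add: if_distrib[of real_of_int] if_distrib[of "\<lambda>c. c *\<^sub>R _"] cong: if_cong)
  then show ?thesis by (rule root_latticeI)
qed

lemma root_lattice_add: "x \<in> root_lattice R \<Longrightarrow> y \<in> root_lattice R \<Longrightarrow> x + y \<in> root_lattice R"
proof -
  assume "x \<in> root_lattice R" "y \<in> root_lattice R"
  then obtain m m' where "x = (\<Sum>\<alpha>\<in>R. real_of_int (m \<alpha>) *\<^sub>R \<alpha>)" "y = (\<Sum>\<alpha>\<in>R. real_of_int (m' \<alpha>) *\<^sub>R \<alpha>)"
    unfolding root_lattice_def by blast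
  then have "x + y = (\<Sum>\<alpha>\<in>R. real_of_int (m \<alpha> + m' \<alpha>) *\<^sub>R \<alpha>)"
    by (simp add: sum.distrib scaleR_add_left)
  then show ?thesis by (rule root_latticeI)
qed

lemma root_lattice_uminus: "x \<in> root_lattice R \<Longrightarrow> - x \<in> root_lattice R"
proof -
  assume "x \<in> root_lattice R"
  then obtain m where "x = (\<Sum>\<alpha>\<in>R. real_of_int (m \<alpha>) *\<^sub>R \<alpha>)"
    unfolding root_lattice_def by blast
  then have "- x = (\<Sum>\<alpha>\<in>R. real_of_int (- m \<alpha>) *\<^sub>R \<alpha>)"
    by (simp add: sum_negf)
  then show ?thesis by (rule root_latticeI)
qed

lemma root_lattice_zero: "0 \<in> root_lattice R"
  by (rule root_latticeI[where m = "\<lambda>_. 0"]) simp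

lemma torus_add: "h \<in> torus R \<Longrightarrow> x \<in> root_lattice R \<Longrightarrow> y \<in> root_lattice R \<Longrightarrow> h (x + y) = h x * h y"
  by (simp add: torus_def)

lemma torus_nonzero: "h \<in> torus R \<Longrightarrow> x \<in> root_lattice R \<Longrightarrow> h x \<noteq> 0"
  by (simp add: torus_def)

lemma torus_zero: "h \<in> torus R \<Longrightarrow> h 0 = 1"
  using torus_add[of h R 0 0] torus_nonzero[of h R 0] root_lattice_zero[of R] by simp

lemma torus_uminus:
  assumes "h \<in> torus R" "x \<in> root_lattice R"
  shows "h (- x) = inverse (h x)"
proof -
  have "h x * h (- x) = 1"
    using torus_add[OF assms root_lattice_uminus[OF assms(2)]] torus_zero[OF assms(1)] by simp
  then show ?thesis by (simp add: inverse_unique)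
qed

lemma translate_torus: "p \<in> torus R \<Longrightarrow> translate R u p \<in> torus R"
  by (auto simp: torus_def translate_def torus_exp_def root_lattice_add root_eval_add exp_add)

lemma translate_translate: "translate R v (translate R u p) = translate R (u + v) p"
  by (auto simp: translate_def torus_exp_def fun_eq_iff root_eval_plus exp_add)

lemma translate_0 [simp]: "translate R 0 p = p"
  by (auto simp: translate_def torus_exp_def fun_eq_iff)

lemma translate_root:
  "finite R \<Longrightarrow> \<alpha> \<in> R \<Longrightarrow> translate R u p \<alpha> = p \<alpha> * exp (root_eval \<alpha> u)"
  by (simp add: translate_def torus_exp_def root_lattice_root)

lemma continuous_on_translate: "continuous_on A (\<lambda>u. translate R u p)"
proof (rule continuous_on_coordinatewise_then_product)
  show "continuous_on A (\<lambda>u. translate R u p x)" for x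
    by (cases "x \<in> root_lattice R")
       (auto simp: translate_def torus_exp_def intro!: continuous_intros)
qed

lemma open_chart_preimage:
  assumes "openin (top_of_set (torus R)) U" "p \<in> torus R"
  shows "open ((\<lambda>u. translate R u p) -` U)"
proof -
  obtain W where W: "open W" "U = torus R \<inter> W" using assms(1) by (auto simp: openin_open)
  have "(\<lambda>u. translate R u p) -` U = (\<lambda>u. translate R u p) -` W"
    using W translate_torus[OF assms(2)] by auto
  then show ?thesis using open_vimage[OF W(1) continuous_on_translate] by simp
qed

text \<open>The topology of pointwise convergence lets an open set constrain finitely many
  coordinates, and \<open>R\<close> is finite.\<close>

lemma openin_coordinates:
  fixes R :: "(real ^ 'n) set"
  assumes "finite R" "\<And>\<alpha>. open (W \<alpha>)"
  shows "openin (top_of_set (torus R)) {h \<in> torus R. \<forall>\<alpha>\<in>R. h \<alpha> \<in> W \<alpha>}"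
proof -
  have "open (\<Inter>\<alpha>\<in>R. (\<lambda>h :: 'n torus_pt. h \<alpha>) -` W \<alpha>)"
    by (intro open_INT assms ballI open_vimage continuous_on_product_coordinates)
  moreover have "{h \<in> torus R. \<forall>\<alpha>\<in>R. h \<alpha> \<in> W \<alpha>} = torus R \<inter> (\<Inter>\<alpha>\<in>R. (\<lambda>h. h \<alpha>) -` W \<alpha>)"
    by auto
  ultimately show ?thesis by (simp add: openin_open_Int)
qed

lemma open_reg_torus_reg: "finite R \<Longrightarrow> open_reg R (torus_reg R)"
  using openin_coordinates[of R "\<lambda>_. - {1}"] by (simp add: open_reg_def torus_reg_def open_Compl)

text \<open>\<open>z\<close> is some logarithm of \<open>h x / p x\<close>. Such pairs form an
  additive group, which a fixed branch of the logarithm would not respect; hence a relation and not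
  a function.\<close>

definition log_pair :: "(real ^ 'n) set \<Rightarrow> 'n torus_pt \<Rightarrow> 'n torus_pt \<Rightarrow> real ^ 'n \<Rightarrow> complex \<Rightarrow> bool" where
  "log_pair R p h x z \<longleftrightarrow> x \<in> root_lattice R \<and> h x = p x * exp z"

context
  fixes R :: "(real ^ 'n) set" and p h :: "'n torus_pt"
  assumes p: "p \<in> torus R" and h: "h \<in> torus R"
begin

lemma log_pair_zero: "log_pair R p h 0 0"
  using torus_zero[OF p] torus_zero[OF h] by (simp add: log_pair_def root_lattice_zero)

lemma log_pair_add: "log_pair R p h x z \<Longrightarrow> log_pair R p h y w \<Longrightarrow> log_pair R p h (x + y) (z + w)"
  using torus_add[OF p] torus_add[OF h] by (auto simp: log_pair_def root_lattice_add exp_add)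

lemma log_pair_uminus: "log_pair R p h x z \<Longrightarrow> log_pair R p h (- x) (- z)"
  using torus_uminus[OF p] torus_uminus[OF h] by (auto simp: log_pair_def root_lattice_uminus exp_minus)

lemma log_pair_int: "log_pair R p h x z \<Longrightarrow> log_pair R p h (of_int n *\<^sub>R x) (of_int n * z)"
proof (induction n rule: int_induct[of _ 0])
  case base
  show ?case using log_pair_zero by simp
next
  case (step1 i)
  then show ?case using log_pair_add[of "of_int i *\<^sub>R x" "of_int i * z" x z] by (simp add: algebra_simps)
next
  case (step2 i)
  then show ?case using log_pair_add[of "of_int i *\<^sub>R x" "of_int i * z" "- x" "- z"] log_pair_uminus
    by (simp add: algebra_simps)
qed

lemma log_pair_sum:
  "(\<And>i. i \<in> I \<Longrightarrow> log_pair R p h (f i) (g i)) \<Longrightarrow> log_pair R p h (\<Sum>i\<in>I. f i) (\<Sum>i\<in>I. g i)"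
  by (induction I rule: infinite_finite_induct) (auto simp: log_pair_zero log_pair_add)

text \<open>The pairs on the roots extend to integral combinations, that is, to the whole
  lattice.\<close>

lemma log_pair_imp_translate:
  assumes "\<And>\<alpha>. \<alpha> \<in> R \<Longrightarrow> log_pair R p h \<alpha> (root_eval \<alpha> u)"
  shows "h = translate R u p"
proof
  fix x
  show "h x = translate R u p x"
  proof (cases "x \<in> root_lattice R")
    case True
    then obtain m where x: "x = (\<Sum>\<alpha>\<in>R. real_of_int (m \<alpha>) *\<^sub>R \<alpha>)" unfolding root_lattice_def by blast
    have "log_pair R p h x (\<Sum>\<alpha>\<in>R. of_int (m \<alpha>) * root_eval \<alpha> u)"
      unfolding x by (intro log_pair_sum log_pair_int assms)
    moreover have "root_eval x u = (\<Sum>\<alpha>\<in>R. of_int (m \<alpha>) * root_eval \<alpha> u)"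
      unfolding x root_eval_lattice by simp
    ultimately have "log_pair R p h x (root_eval x u)" by simp
    then show ?thesis by (simp add: log_pair_def translate_def torus_exp_def)
  next
    \<comment> \<open>Outside the lattice both sides are the dummy value 1.\<close>
    case False
    then show ?thesis using p h by (simp add: torus_def translate_def torus_exp_def)
  qed
qed

end

text \<open>The bound 1 stays below \<open>pi / 2\<close>, so the exponential has positive real part
  and the principal logarithm inverts it.\<close>

lemma exp_small_in_slit:
  assumes "norm z < 1"
  shows "exp z \<notin> \<real>\<^sub>\<le>\<^sub>0" "Ln (exp z) = z"
proof -
  have im: "\<bar>Im z\<bar> < 1" using abs_Im_le_cmod[of z] assms by linarith
  have "cos (Im z) > 0" by (rule cos_gt_zero_pi) (use im pi_gt3 in auto)
  then have "Re (exp z) > 0" by (simp add: Re_exp)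
  then show "exp z \<notin> \<real>\<^sub>\<le>\<^sub>0" by (auto simp: complex_nonpos_Reals_iff)
  show "Ln (exp z) = z" by (rule Ln_exp) (use im pi_gt3 in auto)
qed

text \<open>The bound 6 stays below the period: \<open>6 < 2 * pi\<close>.\<close>

lemma exp_eq_imp_eq:
  fixes z w :: complex
  assumes "exp z = exp w" "norm (z - w) < 6"
  shows "z = w"
proof (rule exp_complex_eqI[OF _ assms(1)])
  have "\<bar>Im (z - w)\<bar> < 6" using abs_Im_le_cmod[of "z - w"] assms(2) by linarith
  then show "\<bar>Im z - Im w\<bar> < 2 * pi" using pi_gt3 unfolding minus_complex.sel by linarith
qed

text \<open>For \<open>h\<close> near \<open>p\<close> the small logarithms of \<open>h \<alpha> / p \<alpha>\<close> respect the relations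
  \<open>\<beta> - \<langle>\<beta>, \<alpha>\<^sup>\<or>\<rangle> \<alpha> \<in> R\<close>, and by the dual frame such a function on the roots is linear.\<close>

lemma chart_exists:
  fixes R :: "(real ^ 'n) set"
  assumes R: "root_system R" and p: "p \<in> torus R" and \<delta>: "\<delta> > 0"
  obtains V where "open V" "0 \<in> V" "V \<subseteq> ball 0 \<delta>" "inj_on (\<lambda>u. translate R u p) V"
    "openin (top_of_set (torus R)) ((\<lambda>u. translate R u p) ` V)"
proof -
  have fin: "finite R" and refl: "\<And>\<alpha> \<beta>. \<alpha> \<in> R \<Longrightarrow> \<beta> \<in> R \<Longrightarrow> reflection \<alpha> \<beta> \<in> R"
    and int: "\<And>\<alpha> \<beta>. \<alpha> \<in> R \<Longrightarrow> \<beta> \<in> R \<Longrightarrow> 2 * (\<alpha> \<bullet> \<beta>) / (\<alpha> \<bullet> \<alpha>) \<in> \<int>"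
    using R unfolding root_system_def by blast+
  obtain S where S: "dual_frame R S" using dual_frame_exists[OF R] by blast
  \<comment> \<open>\<open>K\<close> bounds a vector by its values on the roots, through the dual
    frame.\<close>
  define K where "K = (\<Sum>\<beta>\<in>R. norm (cvec (S \<beta>)))"
  have K0: "K \<ge> 0" by (simp add: K_def sum_nonneg)
  have K: "norm u \<le> e * K" if "\<And>\<alpha>. \<alpha> \<in> R \<Longrightarrow> norm (root_eval \<alpha> u) \<le> e" for u e
  proof -
    have "norm u = norm (\<Sum>\<beta>\<in>R. root_eval \<beta> u *s cvec (S \<beta>))" by (simp add: complex_expand[OF dual_frame_expand[OF S]])
    also have "\<dots> \<le> (\<Sum>\<beta>\<in>R. e * norm (cvec (S \<beta>)))"
      by (rule sum_norm_le) (simp add: norm_smult mult_right_mono that)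
    finally show ?thesis by (simp add: K_def sum_distrib_left)
  qed
  define N where "N = (\<Sum>\<alpha>\<in>R. \<Sum>\<beta>\<in>R. \<bar>2 * (\<alpha> \<bullet> \<beta>) / (\<alpha> \<bullet> \<alpha>)\<bar>)"
  have N: "\<bar>2 * (\<alpha> \<bullet> \<beta>) / (\<alpha> \<bullet> \<alpha>)\<bar> \<le> N" if "\<alpha> \<in> R" "\<beta> \<in> R" for \<alpha> \<beta>
  proof -
    have "\<bar>2 * (\<alpha> \<bullet> \<beta>) / (\<alpha> \<bullet> \<alpha>)\<bar> \<le> (\<Sum>\<beta>\<in>R. \<bar>2 * (\<alpha> \<bullet> \<beta>) / (\<alpha> \<bullet> \<alpha>)\<bar>)"
      by (rule member_le_sum[OF that(2)]) (use fin in auto)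
    also have "\<dots> \<le> N" unfolding N_def
      by (rule member_le_sum[OF that(1), of "\<lambda>\<alpha>. \<Sum>\<beta>\<in>R. \<bar>2 * (\<alpha> \<bullet> \<beta>) / (\<alpha> \<bullet> \<alpha>)\<bar>"])
         (use fin in \<open>auto intro!: sum_nonneg\<close>)
    finally show ?thesis .
  qed
  have N0: "N \<ge> 0" unfolding N_def by (intro sum_nonneg) auto
  \<comment> \<open>The first entry places \<open>V\<close> in the ball of radius
    \<open>\<delta>\<close> via \<open>K\<close>. The second keeps the logarithms compared in
    \<open>lr\<close> at distance at most 1, where \<open>N\<close> bounds the Cartan
    integers.\<close>
  define e where "e = min (\<delta> / (2 * (K + 1))) (1 / (2 + N))"
  have e0: "e > 0" using \<delta> K0 N0 by (simp add: e_def)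
  have eN: "e * (2 + N) \<le> 1"
  proof -
    have "e \<le> 1 / (2 + N)" by (simp add: e_def)
    then have "e * (2 + N) \<le> 1 / (2 + N) * (2 + N)" using N0 by (intro mult_right_mono) auto
    then show ?thesis using N0 by simp
  qed
  have "e * 1 < e * (2 + N)" using e0 N0 by (intro mult_strict_left_mono) auto
  then have e1: "e < 1" using eN by linarith
  have eK: "e * K < \<delta>"
  proof -
    have "e * K \<le> \<delta> / (2 * (K + 1)) * K" using K0 by (intro mult_right_mono) (auto simp: e_def)
    also have "\<dots> < \<delta>" using \<delta> K0 by (simp add: divide_simps)
    finally show ?thesis .
  qed
  define V where "V = {u :: complex ^ 'n. \<forall>\<alpha>\<in>R. norm (root_eval \<alpha> u) < e}"
  have "open (\<Inter>\<alpha>\<in>R. (\<lambda>u. norm (root_eval \<alpha> u)) -` {..<e})"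
    by (intro open_INT fin ballI open_vimage continuous_intros)
  also have "(\<Inter>\<alpha>\<in>R. (\<lambda>u. norm (root_eval \<alpha> u)) -` {..<e}) = V" by (auto simp: V_def)
  finally have V: "open V" .
  have V0: "0 \<in> V" using e0 by (simp add: V_def)
  have Vd: "V \<subseteq> ball 0 \<delta>"
  proof
    fix u assume "u \<in> V"
    then have "norm u \<le> e * K" by (intro K) (auto simp: V_def less_imp_le)
    with eK show "u \<in> ball 0 \<delta>" by simp
  qed
  have pn: "p \<alpha> \<noteq> 0" if "\<alpha> \<in> R" for \<alpha> using torus_nonzero[OF p root_lattice_root[OF fin that]] .
  have inj: "inj_on (\<lambda>u. translate R u p) V"
  proof (rule inj_onI)
    fix u v assume u: "u \<in> V" and v: "v \<in> V" and eq: "translate R u p = translate R v p"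
    have "root_eval \<alpha> (u - v) = 0" if a: "\<alpha> \<in> R" for \<alpha>
    proof -
      have "exp (root_eval \<alpha> u) = exp (root_eval \<alpha> v)"
        using fun_cong[OF eq, of \<alpha>] pn[OF a] by (simp add: translate_root[OF fin a])
      moreover have "norm (root_eval \<alpha> u - root_eval \<alpha> v) < 6"
        using u v a norm_triangle_ineq4[of "root_eval \<alpha> u" "root_eval \<alpha> v"] e1
        by (fastforce simp: V_def)
      ultimately show ?thesis using exp_eq_imp_eq by (simp add: root_eval_minus)
    qed
    then have "norm (u - v) \<le> 0 * K" by (intro K) simp
    then show "u = v" by simp
  qed
  \<comment> \<open>Excluding the slit makes \<open>Ln\<close> continuous, so \<open>W\<close> is
    open.\<close>
  define W where "W = {z. z \<notin> \<real>\<^sub>\<le>\<^sub>0 \<and> norm (Ln z) < e}"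
  have W: "open W"
  proof -
    have "open ((- \<real>\<^sub>\<le>\<^sub>0) \<inter> (\<lambda>z. norm (Ln z)) -` {..<e})"
      by (rule continuous_open_preimage) (auto intro!: continuous_intros)
    also have "(- \<real>\<^sub>\<le>\<^sub>0) \<inter> (\<lambda>z. norm (Ln z)) -` {..<e} = W" by (auto simp: W_def)
    finally show ?thesis .
  qed
  \<comment> \<open>Finitely many coordinate conditions describe the image, which makes it
    open.\<close>
  have im: "(\<lambda>u. translate R u p) ` V = {h \<in> torus R. \<forall>\<alpha>\<in>R. h \<alpha> \<in> (\<lambda>z. z / p \<alpha>) -` W}"
  proof (intro equalityI subsetI)
    fix h assume "h \<in> (\<lambda>u. translate R u p) ` V"
    then obtain u where u: "u \<in> V" and h: "h = translate R u p" by blast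
    have "h \<alpha> / p \<alpha> \<in> W" if a: "\<alpha> \<in> R" for \<alpha>
    proof -
      have "norm (root_eval \<alpha> u) < e" using u a by (simp add: V_def)
      then show ?thesis
        using exp_small_in_slit[of "root_eval \<alpha> u"] e1 pn[OF a]
        by (simp add: h translate_root[OF fin a] W_def)
    qed
    then show "h \<in> {h \<in> torus R. \<forall>\<alpha>\<in>R. h \<alpha> \<in> (\<lambda>z. z / p \<alpha>) -` W}"
      using translate_torus[OF p] h by simp
  next
    fix h assume "h \<in> {h \<in> torus R. \<forall>\<alpha>\<in>R. h \<alpha> \<in> (\<lambda>z. z / p \<alpha>) -` W}"
    then have h: "h \<in> torus R" and hW: "\<And>\<alpha>. \<alpha> \<in> R \<Longrightarrow> h \<alpha> / p \<alpha> \<in> W" by auto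
    define l where "l \<alpha> = Ln (h \<alpha> / p \<alpha>)" for \<alpha>
    have le: "norm (l \<alpha>) < e" if "\<alpha> \<in> R" for \<alpha> using hW[OF that] by (simp add: l_def W_def)
    have lp: "log_pair R p h \<alpha> (l \<alpha>)" if a: "\<alpha> \<in> R" for \<alpha>
      using root_lattice_root[OF fin a] torus_nonzero[OF h, of \<alpha>] pn[OF a]
      by (simp add: log_pair_def l_def)
    \<comment> \<open>The relation holds modulo \<open>2 * pi * \<i>\<close> by additivity of
      \<open>log_pair\<close>; smallness removes the ambiguity.\<close>
    have lr: "l (reflection \<alpha> \<beta>) = l \<beta> - (2 * (\<alpha> \<bullet> \<beta>) / (\<alpha> \<bullet> \<alpha>)) *\<^sub>R l \<alpha>"
      if a: "\<alpha> \<in> R" and b: "\<beta> \<in> R" for \<alpha> \<beta>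
    proof -
      obtain n where n: "2 * (\<alpha> \<bullet> \<beta>) / (\<alpha> \<bullet> \<alpha>) = of_int n" using int[OF a b] by (auto elim: Ints_cases)
      have "log_pair R p h (\<beta> + - (of_int n *\<^sub>R \<alpha>)) (l \<beta> + - (of_int n * l \<alpha>))"
        by (intro log_pair_add log_pair_uminus log_pair_int p h lp a b)
      then have 1: "log_pair R p h (reflection \<alpha> \<beta>) (l \<beta> - of_int n * l \<alpha>)"
        by (simp add: reflection_def n)
      have r: "reflection \<alpha> \<beta> \<in> R" by (rule refl[OF a b])
      have "exp (l (reflection \<alpha> \<beta>)) = exp (l \<beta> - of_int n * l \<alpha>)"
        using 1 lp[OF r] pn[OF r] by (simp add: log_pair_def)
      moreover have "norm (l (reflection \<alpha> \<beta>) - (l \<beta> - of_int n * l \<alpha>)) < 6"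
      proof -
        have "norm (of_int n * l \<alpha>) \<le> N * e"
          using N[OF a b] le[OF a] N0 unfolding norm_mult n by (intro mult_mono) auto
        then have "norm (l (reflection \<alpha> \<beta>) - (l \<beta> - of_int n * l \<alpha>)) \<le> e + (e + N * e)"
          using le[OF r] le[OF b]
          by (intro norm_triangle_le_diff add_mono) auto
        also have "\<dots> = e * (2 + N)" by (simp add: algebra_simps)
        finally show ?thesis using eN by simp
      qed
      ultimately have "l (reflection \<alpha> \<beta>) = l \<beta> - of_int n * l \<alpha>" by (rule exp_eq_imp_eq)
      then show ?thesis by (simp add: n scaleR_conv_of_real)
    qed
    define u where "u = (\<Sum>\<beta>\<in>R. l \<beta> *s cvec (S \<beta>))"
    have ru: "root_eval \<alpha> u = l \<alpha>" if "\<alpha> \<in> R" for \<alpha>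
    proof -
      have "(\<Sum>\<beta>\<in>R. (\<alpha> \<bullet> S \<beta>) *\<^sub>R l \<beta>) = l \<alpha>"
        using S lr[OF that] that unfolding dual_frame_def by blast
      then show ?thesis
        by (simp add: u_def root_eval_sum root_eval_smult root_eval_cvec scaleR_conv_of_real mult.commute)
    qed
    have "h = translate R u p"
      by (rule log_pair_imp_translate[OF p h]) (simp add: ru lp)
    moreover have "u \<in> V" using ru le by (simp add: V_def)
    ultimately show "h \<in> (\<lambda>u. translate R u p) ` V" by blast
  qed
  \<comment> \<open>\<open>openin_coordinates\<close> wants an open set for every vector, root or
    not; should \<open>p \<alpha>\<close> be 0, division gives the constant 0.\<close>
  have "continuous_on UNIV (\<lambda>z. z / p \<alpha>)" for \<alpha>
    by (cases "p \<alpha> = 0") (auto intro!: continuous_intros)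
  then have "open ((\<lambda>z. z / p \<alpha>) -` W)" for \<alpha>
    by (rule open_vimage[OF W])
  from openin_coordinates[OF fin this] im
  have "openin (top_of_set (torus R)) ((\<lambda>u. translate R u p) ` V)" by simp
  from that[OF V V0 Vd inj this] show thesis .
qed

section \<open>Invariant forms\<close>

lemma complexify_reflection:
  "complexify (reflection \<alpha>) u = u - root_eval \<alpha> u *s coroot \<alpha>"
proof -
  define a where "a = (\<chi> i. Re (u $ i))"
  define b where "b = (\<chi> i. Im (u $ i))"
  have re: "root_eval \<alpha> u = of_real (\<alpha> \<bullet> a) + \<i> * of_real (\<alpha> \<bullet> b)"
    by (rule complex_eqI) (simp_all add: root_eval_def inner_vec_def a_def b_def)
  have "u = cvec a + \<i> *s cvec b"
    by (simp add: vec_eq_iff cvec_def a_def b_def complex_eq_iff)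
  moreover have "complexify (reflection \<alpha>) u = cvec (reflection \<alpha> a) + \<i> *s cvec (reflection \<alpha> b)"
    by (simp add: complexify_def a_def b_def)
  ultimately show ?thesis
    by (simp add: re vec_eq_iff cvec_def reflection_def coroot_def algebra_simps add_divide_distrib)
qed

lemma root_eval_coroot: "\<alpha> \<noteq> 0 \<Longrightarrow> root_eval \<alpha> (coroot \<alpha>) = 2"
  by (simp add: coroot_def root_eval_cvec)

lemma root_eval_axis: "root_eval \<alpha> (axis i 1) = of_real (\<alpha> $ i)"
  by (simp add: root_eval_def axis_def if_distrib cong: if_cong)

text \<open>Roots are real multiples of their coroots, and the transposed frame expands every
  complex vector in roots.\<close>

lemma linear_vanish_on_coroots:
  fixes L :: "complex ^ 'n \<Rightarrow> complex"
  assumes R: "root_system R" and L: "Vector_Spaces.linear (*s) (*) L"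
    and zero: "\<And>\<alpha>. \<alpha> \<in> R \<Longrightarrow> L (coroot \<alpha>) = 0"
  shows "L u = 0"
proof -
  interpret L: Vector_Spaces.linear "(*s)" "(*)" L by (rule L)
  obtain S where S: "dual_frame R S" using dual_frame_exists[OF R] by blast
  have c: "L (cvec \<alpha>) = 0" if "\<alpha> \<in> R" for \<alpha>
  proof -
    have "\<alpha> \<noteq> 0" using R that by (auto simp: root_system_def)
    then have "cvec \<alpha> = of_real ((\<alpha> \<bullet> \<alpha>) / 2) *s coroot \<alpha>"
      by (simp add: vec_eq_iff cvec_def coroot_def)
    then show ?thesis using zero[OF that] by (simp only: L.scale) simp
  qed
  have "L u = L (\<Sum>\<beta>\<in>R. root_eval (S \<beta>) u *s cvec \<beta>)"
    by (simp add: complex_expand[OF dual_frame_expand'[OF S]])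
  also have "\<dots> = 0" by (simp add: L.sum L.scale c)
  finally show ?thesis .
qed

lemma sym_bilinear_linear:
  assumes "sym_bilinear (*) a"
  shows "Vector_Spaces.linear (*s) (*) (a u)" "Vector_Spaces.linear (*s) (*) (\<lambda>u. a u v)" "a u v = a v u"
proof -
  show 1: "Vector_Spaces.linear (*s) (*) (a u)" for u using assms by (simp add: sym_bilinear_def)
  show s: "a u v = a v u" for u v using assms by (simp add: sym_bilinear_def)
  have "(\<lambda>u. a u v) = a v" by (rule ext) (rule s)
  then show "Vector_Spaces.linear (*s) (*) (\<lambda>u. a u v)" using 1[of v] by (simp only:)
qed

lemma sym_bilinear_vec_linear:
  assumes "sym_bilinear (*s) b"
  shows "Vector_Spaces.linear (*s) (*s) (b u)" "b u v = b v u"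
  using assms by (simp_all add: sym_bilinear_def)

lemma linear_complex_basis:
  assumes "Vector_Spaces.linear (*s) (*) (L :: complex ^ 'n \<Rightarrow> complex)"
  shows "L v = (\<Sum>j\<in>UNIV. v $ j * L (axis j 1))"
proof -
  interpret L: Vector_Spaces.linear "(*s)" "(*)" L by (rule assms)
  have "L v = L (\<Sum>j\<in>UNIV. v $ j *s axis j 1)" by (simp add: basis_expansion)
  also have "\<dots> = (\<Sum>j\<in>UNIV. v $ j * L (axis j 1))" by (simp only: L.sum L.scale)
  finally show ?thesis .
qed

lemma linear_complexI:
  assumes "\<And>u v. L (u + v) = L u + L v" "\<And>c u. L (c *s u) = c * L u"
  shows "Vector_Spaces.linear (*s) (*) (L :: complex ^ 'n \<Rightarrow> complex)"
  unfolding Vector_Spaces.linear_iff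
  by (intro conjI allI assms) (unfold_locales, auto simp: algebra_simps)

text \<open>Invariance is recorded for the reflections, which generate the Weyl group and have the
  explicit complex form \<open>complexify_reflection\<close>.\<close>

locale toric_data =
  fixes R Rp :: "(real ^ 'n) set" and k :: "real ^ 'n \<Rightarrow> complex"
    and a :: "complex ^ 'n \<Rightarrow> complex ^ 'n \<Rightarrow> complex"
    and b :: "complex ^ 'n \<Rightarrow> complex ^ 'n \<Rightarrow> complex ^ 'n"
  assumes R: "root_system R" and Rp: "Rp \<subseteq> R"
    and a: "sym_bilinear (*) a" and b: "sym_bilinear (*s) b"
    and a_inv: "\<And>\<alpha> u v. \<alpha> \<in> R \<Longrightarrow>
      a (complexify (reflection \<alpha>) u) (complexify (reflection \<alpha>) v) = a u v"
    and b_inv: "\<And>\<alpha> u v. \<alpha> \<in> R \<Longrightarrow>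
      b (complexify (reflection \<alpha>) u) (complexify (reflection \<alpha>) v) = complexify (reflection \<alpha>) (b u v)"
begin

lemma fin: "finite R" and nz: "\<alpha> \<in> R \<Longrightarrow> \<alpha> \<noteq> 0"
  using R by (auto simp: root_system_def)

lemma a_right: "a u (x + y) = a u x + a u y" "a u (c *s x) = c * a u x" "a u (x - y) = a u x - a u y"
proof -
  interpret L: Vector_Spaces.linear "(*s)" "(*)" "a u" by (rule sym_bilinear_linear(1)[OF a])
  show "a u (x + y) = a u x + a u y" "a u (c *s x) = c * a u x" "a u (x - y) = a u x - a u y"
    by (rule L.add L.scale L.diff)+
qed

lemma a_sym: "a u v = a v u"
  by (rule sym_bilinear_linear(3)[OF a])

lemma a_left: "a (x + y) u = a x u + a y u" "a (c *s x) u = c * a x u" "a (x - y) u = a x u - a y u"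
  by (simp_all add: a_sym[of _ u] a_right)

lemma b_right: "b u (x + y) = b u x + b u y" "b u (c *s x) = c *s b u x"
proof -
  interpret L: Vector_Spaces.linear "(*s)" "(*s)" "b u" by (rule sym_bilinear_vec_linear(1)[OF b])
  show "b u (x + y) = b u x + b u y" "b u (c *s x) = c *s b u x"
    by (rule L.add L.scale)+
qed

lemma b_sym: "b u v = b v u"
  by (rule sym_bilinear_vec_linear(2)[OF b])

lemma b_left: "b (x + y) u = b x u + b y u" "b (c *s x) u = c *s b x u"
  by (simp_all add: b_sym[of _ u] b_right)

text \<open>The reflection negates its coroot and moves \<open>u\<close> by a multiple of it, so
  invariance compares \<open>a u (coroot \<alpha>)\<close> with its negative up to that
  multiple.\<close>

lemma a_coroot:
  assumes "\<alpha> \<in> R"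
  shows "2 * a u (coroot \<alpha>) = root_eval \<alpha> u * a (coroot \<alpha>) (coroot \<alpha>)"
proof -
  have "a (u - root_eval \<alpha> u *s coroot \<alpha>) (coroot \<alpha> - 2 *s coroot \<alpha>) = a u (coroot \<alpha>)"
    using a_inv[OF assms, of u "coroot \<alpha>"] by (simp add: complexify_reflection root_eval_coroot[OF nz[OF assms]])
  then show ?thesis by (simp add: a_left a_right algebra_simps)
qed

definition asym :: "complex ^ 'n \<Rightarrow> complex ^ 'n \<Rightarrow> complex ^ 'n \<Rightarrow> complex" where
  "asym u v w = a u (b v w) - a v (b u w)"

lemma asym_linear:
  "asym u v (x + y) = asym u v x + asym u v y" "asym u v (c *s x) = c * asym u v x"
  "asym u (x + y) w = asym u x w + asym u y w" "asym u (c *s x) w = c * asym u x w"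
  "asym (x + y) v w = asym x v w + asym y v w" "asym (c *s x) v w = c * asym x v w"
  by (simp_all add: asym_def a_left a_right b_left b_right algebra_simps)

lemma asym_anti: "asym u v w = - asym v u w" "asym u u w = 0"
  by (simp_all add: asym_def)

lemma asym_inv:
  assumes "\<alpha> \<in> R"
  shows "asym (complexify (reflection \<alpha>) u) (complexify (reflection \<alpha>) v) (complexify (reflection \<alpha>) w) = asym u v w"
  by (simp add: asym_def b_inv[OF assms] a_inv[OF assms])

text \<open>By invariance under the reflection in \<open>\<alpha>\<close>, \<open>asym (coroot \<alpha>) v w\<close> is a multiple of \<open>\<alpha>(w)\<close>.
  For two non-proportional roots the antisymmetry in the first two arguments then forces it to vanish.\<close>

lemma asym_coroot:
  assumes "\<alpha> \<in> R"
  shows "2 * asym (coroot \<alpha>) v w = root_eval \<alpha> w * asym (coroot \<alpha>) v (coroot \<alpha>)"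
proof -
  let ?C = "coroot \<alpha>"
  have C: "complexify (reflection \<alpha>) ?C = (-1) *s ?C"
    by (simp add: complexify_reflection root_eval_coroot[OF nz[OF assms]] vec_eq_iff)
  have s: "complexify (reflection \<alpha>) x = x + (- root_eval \<alpha> x) *s ?C" for x
    by (simp add: complexify_reflection vec_eq_iff)
  have "(-1) * asym ?C (v + (- root_eval \<alpha> v) *s ?C) (w + (- root_eval \<alpha> w) *s ?C) = asym ?C v w"
    using asym_inv[OF assms, of ?C v w] unfolding C s[of v] s[of w] asym_linear(6) .
  \<comment> \<open>Moving \<open>v\<close> by a multiple of \<open>?C\<close> changes nothing,
    since \<open>asym ?C ?C\<close> vanishes; only the shift of \<open>w\<close> survives.\<close>
  then show ?thesis unfolding asym_linear asym_anti(2) by (simp add: algebra_simps)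
qed

lemma asym_coroots:
  assumes \<alpha>: "\<alpha> \<in> R" and \<beta>: "\<beta> \<in> R"
  shows "asym (coroot \<alpha>) (coroot \<beta>) w = 0"
proof (rule ccontr)
  let ?p = "asym (coroot \<alpha>) (coroot \<beta>) (coroot \<alpha>)" and ?q = "asym (coroot \<beta>) (coroot \<alpha>) (coroot \<beta>)"
  assume ne: "asym (coroot \<alpha>) (coroot \<beta>) w \<noteq> 0"
  \<comment> \<open>The same value is computed once from \<open>\<alpha>\<close> and once from
    \<open>\<beta>\<close>, for every third argument. If it is nonzero somewhere, the two
    functionals are proportional, hence so are the coroots, and antisymmetry makes it vanish after
    all.\<close>
  have 1: "root_eval \<alpha> x * ?p = - root_eval \<beta> x * ?q" for x
    using asym_coroot[OF \<alpha>, of "coroot \<beta>" x] asym_coroot[OF \<beta>, of "coroot \<alpha>" x]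
      asym_anti(1)[of "coroot \<alpha>" "coroot \<beta>" x] by simp
  have "?p \<noteq> 0" using asym_coroot[OF \<alpha>, of "coroot \<beta>" w] ne by auto
  then have "of_real (\<alpha> $ i) = - (?q / ?p) * of_real (\<beta> $ i)" for i
    using 1[of "axis i 1"] by (simp add: root_eval_axis field_simps)
  then have "cvec \<alpha> = (- (?q / ?p)) *s cvec \<beta>" by (simp add: vec_eq_iff cvec_def)
  moreover have "coroot \<alpha> = of_real (2 / (\<alpha> \<bullet> \<alpha>)) *s cvec \<alpha>"
    "cvec \<beta> = of_real ((\<beta> \<bullet> \<beta>) / 2) *s coroot \<beta>"
    using nz[OF \<beta>] by (simp_all add: vec_eq_iff cvec_def coroot_def)
  ultimately obtain c where "coroot \<alpha> = c *s coroot \<beta>" by (metis vector_smult_assoc)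
  then show False using ne by (simp add: asym_linear asym_anti(2))
qed

text \<open>The coroots span, so each of the two antisymmetric arguments of \<open>asym\<close> may
  be replaced by a coroot.\<close>

lemma a_b_symmetric: "a u (b v w) = a v (b u w)"
proof -
  have "asym u v w = 0"
  proof (rule linear_vanish_on_coroots[OF R, of "\<lambda>u. asym u v w"])
    show "Vector_Spaces.linear (*s) (*) (\<lambda>u. asym u v w)" for v
      by (rule linear_complexI) (rule asym_linear)+
    fix \<alpha> assume \<alpha>: "\<alpha> \<in> R"
    have "asym v (coroot \<alpha>) w = 0"
    proof (rule linear_vanish_on_coroots[OF R, of "\<lambda>v. asym v (coroot \<alpha>) w"])
      show "Vector_Spaces.linear (*s) (*) (\<lambda>u. asym u (coroot \<alpha>) w)"
        by (rule linear_complexI) (rule asym_linear)+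
    qed (rule asym_coroots[OF _ \<alpha>])
    then show "asym (coroot \<alpha>) v w = 0" using asym_anti(1)[of "coroot \<alpha>" v w] by simp
  qed
  then show ?thesis by (simp add: asym_def)
qed

section \<open>The connection and its curvature\<close>

text \<open>The field \<open>\<Gamma>(u, v)\<close> at \<open>h\<close>: the vector at which
  \<open>Omega_form\<close> evaluates its 1-form.\<close>

definition christoffel :: "'n torus_pt \<Rightarrow> complex ^ 'n \<Rightarrow> complex ^ 'n \<Rightarrow> complex ^ 'n" where
  "christoffel h u v = (\<Sum>\<alpha>\<in>Rp. (1/2 * k \<alpha> * ((h \<alpha> + 1) / (h \<alpha> - 1)) * root_eval \<alpha> u * root_eval \<alpha> v) *s coroot \<alpha>)
      + b u v"

lemma christoffel_sym: "christoffel h u v = christoffel h v u"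
  by (simp add: christoffel_def b_sym[of u v] mult_ac)

lemma christoffel_nth_linear: "Vector_Spaces.linear (*s) (*) (\<lambda>v. christoffel h u v $ i)"
proof -
  define c where "c \<alpha> = 1/2 * k \<alpha> * ((h \<alpha> + 1) / (h \<alpha> - 1)) * root_eval \<alpha> u * coroot \<alpha> $ i" for \<alpha>
  have "christoffel h u v $ i = (\<Sum>\<alpha>\<in>Rp. c \<alpha> * root_eval \<alpha> v) + b u v $ i" for v
    by (simp add: christoffel_def c_def mult_ac)
  then show ?thesis
    by (intro linear_complexI)
       (simp_all add: root_eval_plus root_eval_smult b_right algebra_simps sum.distrib sum_distrib_left)
qed

lemma christoffel_basis: "christoffel h u v $ i = (\<Sum>j\<in>UNIV. v $ j * christoffel h u (axis j 1) $ i)"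
  by (rule linear_complex_basis[OF christoffel_nth_linear])

text \<open>An arbitrary functional \<open>L\<close> is allowed because three kinds are used: a
  1-form at a point, \<open>a u\<close>, and the derivative of a function at a point.\<close>

lemma linear_christoffel:
  assumes "Vector_Spaces.linear (*s) (*) L"
  shows "L (christoffel h u v) =
    1/2 * (\<Sum>\<alpha>\<in>Rp. k \<alpha> * ((h \<alpha> + 1) / (h \<alpha> - 1)) * L (coroot \<alpha>) * (root_eval \<alpha> u * root_eval \<alpha> v)) + L (b u v)"
proof -
  interpret L: Vector_Spaces.linear "(*s)" "(*)" L by (rule assms)
  show ?thesis
    unfolding christoffel_def L.add L.sum L.scale
    by (simp add: sum_distrib_left mult_ac)
qed

text \<open>By \<open>a_coroot\<close> each root contributes a multiple of \<open>root_eval \<alpha>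
  u * root_eval \<alpha> v * root_eval \<alpha> w\<close>, which is symmetric; the summand with
  \<open>b\<close> is \<open>a_b_symmetric\<close>.\<close>

lemma a_christoffel_symmetric: "a u (christoffel h v w) = a v (christoffel h u w)"
proof -
  have eq: "a u (christoffel h v w) = 1/2 * (\<Sum>\<alpha>\<in>Rp. k \<alpha> * ((h \<alpha> + 1) / (h \<alpha> - 1)) *
      (1/2 * root_eval \<alpha> u * a (coroot \<alpha>) (coroot \<alpha>)) * (root_eval \<alpha> v * root_eval \<alpha> w)) + a u (b v w)" for u v
  proof -
    have e: "a u (coroot \<alpha>) = 1/2 * root_eval \<alpha> u * a (coroot \<alpha>) (coroot \<alpha>)" if "\<alpha> \<in> Rp" for \<alpha>
      using a_coroot[OF subsetD[OF Rp that], of u] by (simp add: mult.commute)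
    show ?thesis
      unfolding linear_christoffel[OF sym_bilinear_linear(1)[OF a]] by (simp only: e cong: sum.cong)
  qed
  show ?thesis unfolding eq[of u v] eq[of v u] a_b_symmetric[of u v w] by (simp only: mult_ac)
qed

lemma nabla_eq:
  assumes "Vector_Spaces.linear (*s) (*) (\<zeta> h)"
  shows "nabla R Rp k b \<zeta> h u v = pd R u (\<lambda>g. \<zeta> g v) h + \<zeta> h (christoffel h u v)"
  unfolding nabla_def nabla0_def Omega_form_def linear_christoffel[OF assms] ..

section \<open>The connection and its coefficients in a chart\<close>

lemma pd_const [simp]: "pd R u (\<lambda>g. c) h = 0"
  by (simp add: pd_def)

lemma dz_linear: "Vector_Spaces.linear (*s) (*) (dz j h)"
  by (rule linear_complexI) (simp_all add: dz_def)

lemma nabla_dz: "nabla R Rp k b (dz j) h u v = christoffel h u v $ j"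
  unfolding nabla_eq[OF dz_linear] by (simp add: dz_def)

text \<open>Translations compose additively, so the single chart at \<open>p\<close> computes
  \<open>pd\<close> at every point it reaches.\<close>

lemma pd_chart: "pd R v f (translate R x p) = ddir v (\<lambda>x. f (translate R x p)) x"
  by (simp add: pd_def ddir_def translate_translate)

lemma pd_at: "pd R v f p = ddir v (\<lambda>x. f (translate R x p)) 0"
  using pd_chart[of v f 0 p] by simp

text \<open>\<open>holomorphic_fun\<close> refers at each point to the chart centred there; shifting
  the origin transfers this to the one chart centred at \<open>p\<close>.\<close>

lemma holo_on_chart:
  assumes U: "open_reg R U" and p: "p \<in> torus R" and f: "holomorphic_fun R U f"
  shows "holo_on ((\<lambda>x. translate R x p) -` U) (\<lambda>x. f (translate R x p))"
  unfolding holo_on_def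
proof (intro conjI ballI)
  show "open ((\<lambda>x. translate R x p) -` U)"
    using U open_chart_preimage[OF _ p] by (simp add: open_reg_def)
  fix x assume "x \<in> (\<lambda>x. translate R x p) -` U"
  then obtain D where D: "Vector_Spaces.linear (*s) (*) D"
    "((\<lambda>u. f (translate R u (translate R x p))) has_derivative D) (at 0)"
    using f unfolding holomorphic_fun_def by auto
  have "((\<lambda>y. f (translate R (y - x) (translate R x p))) has_derivative (\<lambda>y. D (y - 0))) (at x)"
    by (rule has_derivative_compose[of "\<lambda>y. y - x", OF has_derivative_diff[OF has_derivative_ident has_derivative_const]])
       (simp add: D(2))
  then have "((\<lambda>y. f (translate R y p)) has_derivative D) (at x)"
    by (simp add: translate_translate)
  with D(1) show "\<exists>D. Vector_Spaces.linear (*s) (*) D \<and> ((\<lambda>x. f (translate R x p)) has_derivative D) (at x)"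
    by blast
qed

lemma holo_on_christoffel:
  assumes p: "p \<in> torus R" and X: "open X" "X \<subseteq> (\<lambda>x. translate R x p) -` torus_reg R"
  shows "holo_on X (\<lambda>x. christoffel (translate R x p) u v $ i)"
proof -
  have r: "holo_on X (root_eval \<alpha>)" for \<alpha>
    unfolding root_eval_def[abs_def] by (intro holo_on_sum holo_on_mult holo_on_const holo_on_nth X)
  have t: "translate R x p \<alpha> = p \<alpha> * exp (root_eval \<alpha> x)" if "\<alpha> \<in> Rp" for \<alpha> x
    using translate_root[OF fin] that Rp by blast
  have n: "p \<alpha> * exp (root_eval \<alpha> x) - 1 \<noteq> 0" if "x \<in> X" "\<alpha> \<in> Rp" for \<alpha> x
  proof -
    have "translate R x p \<alpha> \<noteq> 1"
      using vimageD[OF subsetD[OF X(2) that(1)]] subsetD[OF Rp that(2)] by (simp add: torus_reg_def)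
    then show ?thesis using t[OF that(2), of x] by simp
  qed
  have "holo_on X (\<lambda>x. (\<Sum>\<alpha>\<in>Rp. (1/2 * k \<alpha> * ((p \<alpha> * exp (root_eval \<alpha> x) + 1) / (p \<alpha> * exp (root_eval \<alpha> x) - 1))
       * root_eval \<alpha> u * root_eval \<alpha> v) * coroot \<alpha> $ i) + b u v $ i)"
    by (intro holo_on_add holo_on_sum holo_on_mult holo_on_divide holo_on_diff holo_on_exp holo_on_const r X n)
  then show ?thesis
    by (rule holo_on_cong) (simp add: christoffel_def t)
qed

text \<open>Component \<open>i\<close> of \<open>K(u, v)w\<close> at \<open>h\<close>, in the
  notation of the overview.\<close>

definition flatness :: "'n torus_pt \<Rightarrow> complex ^ 'n \<Rightarrow> complex ^ 'n \<Rightarrow> complex ^ 'n \<Rightarrow> 'n \<Rightarrow> complex" where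
  "flatness h u v w i = pd R u (\<lambda>g. christoffel g v w $ i) h - pd R v (\<lambda>g. christoffel g u w $ i) h
     - christoffel h u (christoffel h v w) $ i + christoffel h v (christoffel h u w) $ i"

text \<open>Index bookkeeping for \<open>curvature_formula\<close>: \<open>G\<close> and
  \<open>H\<close> are the coefficients of \<open>\<Gamma>(u, _)\<close> and
  \<open>\<Gamma>(v, _)\<close>, \<open>B\<close> is the derivative of \<open>G\<close> along
  \<open>v\<close>, \<open>A\<close> that of \<open>H\<close> along \<open>u\<close>, and
  \<open>z\<close> are the components of a 1-form with derivatives \<open>du\<close> and
  \<open>dv\<close>. The terms in \<open>du\<close> and \<open>dv\<close> cancel, which is the
  tensoriality of the curvature.\<close>

lemma curvature_sum_identity:
  fixes w z du dv :: "'n \<Rightarrow> complex" and A B G H :: "'n \<Rightarrow> 'n \<Rightarrow> complex"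
  shows "(\<Sum>j\<in>UNIV. ((\<Sum>i\<in>UNIV. A j i * z i + H j i * du i) - (\<Sum>i\<in>UNIV. B j i * z i + G j i * dv i)) * w j
       - ((du j + (\<Sum>i\<in>UNIV. G j i * z i)) * (\<Sum>m\<in>UNIV. w m * H m j)
          - (dv j + (\<Sum>i\<in>UNIV. H j i * z i)) * (\<Sum>m\<in>UNIV. w m * G m j)))
    = (\<Sum>j\<in>UNIV. w j * (\<Sum>i\<in>UNIV. z i * (A j i - B j i - (\<Sum>s\<in>UNIV. H j s * G s i) + (\<Sum>s\<in>UNIV. G j s * H s i))))"
proof -
  have 1: "(\<Sum>j\<in>UNIV. (\<Sum>i\<in>UNIV. H j i * d i) * w j) = (\<Sum>j\<in>UNIV. d j * (\<Sum>m\<in>UNIV. w m * H m j))"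
    for H :: "'n \<Rightarrow> 'n \<Rightarrow> complex" and d
    unfolding sum_distrib_left sum_distrib_right by (subst sum.swap) (simp add: mult_ac)
  have 2: "(\<Sum>j\<in>UNIV. (\<Sum>i\<in>UNIV. G j i * z i) * (\<Sum>m\<in>UNIV. w m * H m j))
     = (\<Sum>m\<in>UNIV. w m * (\<Sum>i\<in>UNIV. z i * (\<Sum>s\<in>UNIV. H m s * G s i)))" for G H :: "'n \<Rightarrow> 'n \<Rightarrow> complex"
  proof -
    have "(\<Sum>j\<in>UNIV. (\<Sum>i\<in>UNIV. G j i * z i) * (\<Sum>m\<in>UNIV. w m * H m j))
       = (\<Sum>j\<in>UNIV. \<Sum>m\<in>UNIV. \<Sum>i\<in>UNIV. w m * (z i * (H m j * G j i)))"
      by (rule sum.cong[OF refl]) (subst mult.commute, simp add: sum_product mult_ac)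
    also have "\<dots> = (\<Sum>m\<in>UNIV. \<Sum>j\<in>UNIV. \<Sum>i\<in>UNIV. w m * (z i * (H m j * G j i)))"
      by (rule sum.swap)
    also have "\<dots> = (\<Sum>m\<in>UNIV. \<Sum>i\<in>UNIV. \<Sum>j\<in>UNIV. w m * (z i * (H m j * G j i)))"
      by (rule sum.cong[OF refl]) (rule sum.swap)
    finally show ?thesis unfolding sum_distrib_left .
  qed
  define P where "P G j = (\<Sum>i\<in>UNIV. G j i * z i)" for G :: "'n \<Rightarrow> 'n \<Rightarrow> complex" and j
  define P' where "P' G d j = (\<Sum>i\<in>UNIV. G j i * d i)" for G :: "'n \<Rightarrow> 'n \<Rightarrow> complex" and d :: "'n \<Rightarrow> complex" and j
  define Q where "Q G j = (\<Sum>m\<in>UNIV. w m * G m j)" for G :: "'n \<Rightarrow> 'n \<Rightarrow> complex" and j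
  define T where "T G H j = (\<Sum>i\<in>UNIV. z i * (\<Sum>s\<in>UNIV. G j s * H s i))" for G H :: "'n \<Rightarrow> 'n \<Rightarrow> complex" and j
  have 3: "(\<Sum>j\<in>UNIV. P' H d j * w j) = (\<Sum>j\<in>UNIV. d j * Q H j)" for H d
    using 1[of H d] by (simp only: P'_def Q_def)
  have 4: "(\<Sum>j\<in>UNIV. P G j * Q H j) = (\<Sum>j\<in>UNIV. w j * T H G j)" for G H
    using 2[of G H] by (simp only: P_def Q_def T_def)
  have "(\<Sum>j\<in>UNIV. ((P A j + P' H du j) - (P B j + P' G dv j)) * w j
       - ((du j + P G j) * Q H j - (dv j + P H j) * Q G j))
    = (\<Sum>j\<in>UNIV. P A j * w j) - (\<Sum>j\<in>UNIV. P B j * w j)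
      + (\<Sum>j\<in>UNIV. P' H du j * w j) - (\<Sum>j\<in>UNIV. P' G dv j * w j)
      - (\<Sum>j\<in>UNIV. du j * Q H j) + (\<Sum>j\<in>UNIV. dv j * Q G j)
      - (\<Sum>j\<in>UNIV. P G j * Q H j) + (\<Sum>j\<in>UNIV. P H j * Q G j)"
    by (simp add: algebra_simps sum.distrib sum_subtractf)
  also have "\<dots> = (\<Sum>j\<in>UNIV. w j * (P A j - P B j - T H G j + T G H j))"
    unfolding 3 4 by (simp add: algebra_simps sum.distrib sum_subtractf)
  also have "\<dots> = (\<Sum>j\<in>UNIV. w j * (\<Sum>i\<in>UNIV. z i * (A j i - B j i - (\<Sum>s\<in>UNIV. H j s * G s i) + (\<Sum>s\<in>UNIV. G j s * H s i))))"
    by (simp add: P_def T_def ring_distribs mult.commute[of _ "z _"] sum.distrib sum_subtractf)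
  finally show ?thesis
    by (simp add: P_def P'_def Q_def sum.distrib)
qed

text \<open>The second derivatives of \<open>\<zeta>\<close> cancel by \<open>ddir_commute\<close>,
  the first ones by \<open>curvature_sum_identity\<close>; only the value of \<open>\<zeta>\<close>
  at \<open>h\<close> remains.\<close>

lemma curvature_formula:
  assumes U: "open_reg R U" and \<zeta>: "one_form R U \<zeta>" and h: "h \<in> U"
  shows "curvature R (nabla R Rp k b) \<zeta> h u v w =
    (\<Sum>j\<in>UNIV. w $ j * (\<Sum>i\<in>UNIV. \<zeta> h (axis i 1) * flatness h u v (axis j 1) i))"
proof -
  have p: "h \<in> torus R" using U h by (auto simp: open_reg_def torus_reg_def)
  define X where "X = (\<lambda>x. translate R x h) -` U"
  have X: "open X" "0 \<in> X" "X \<subseteq> (\<lambda>x. translate R x h) -` torus_reg R"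
    using U open_chart_preimage[OF _ p, of U] h by (auto simp: X_def open_reg_def)
  have lin: "Vector_Spaces.linear (*s) (*) (\<zeta> (translate R x h))" if "x \<in> X" for x
    using \<zeta> that by (simp add: one_form_def X_def)
  define z where "z i x = \<zeta> (translate R x h) (axis i 1)" for i x
  have z: "holo_on X (z i)" for i
    using holo_on_chart[OF U p, of "\<lambda>g. \<zeta> g (axis i 1)"] \<zeta>
    by (simp add: one_form_def X_def z_def[abs_def])
  define C where "C v j i x = christoffel (translate R x h) v (axis j 1) $ i" for v j i x
  have C: "holo_on X (C v j i)" for v j i
    unfolding C_def[abs_def] by (rule holo_on_christoffel[OF p X(1,3)])
  define N where "N v j x = nabla R Rp k b \<zeta> (translate R x h) v (axis j 1)" for v j x
  have N: "N v j x = ddir v (z j) x + (\<Sum>i\<in>UNIV. C v j i x * z i x)" if x: "x \<in> X" for v j x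
    unfolding N_def nabla_eq[where \<zeta>=\<zeta>, OF lin[OF x]] pd_chart linear_complex_basis[OF lin[OF x], of "christoffel _ _ _"]
    by (simp add: z_def[abs_def] C_def)
  have dN: "ddir u (N v j) 0 = ddir u (ddir v (z j)) 0 + (\<Sum>i\<in>UNIV. ddir u (C v j i) 0 * z i 0 + C v j i 0 * ddir u (z i) 0)" for u v j
  proof -
    have "ddir u (N v j) 0 = ddir u (\<lambda>x. ddir v (z j) x + (\<Sum>i\<in>UNIV. C v j i x * z i x)) 0"
      by (rule ddir_cong[OF X(1,2)]) (rule N)
    also have "\<dots> = ddir u (ddir v (z j)) 0 + ddir u (\<lambda>x. \<Sum>i\<in>UNIV. C v j i x * z i x) 0"
      by (intro ddir_add[OF _ _ X(2)] holo_on_ddir z holo_on_sum holo_on_mult C X)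
    also have "ddir u (\<lambda>x. \<Sum>i\<in>UNIV. C v j i x * z i x) 0 = (\<Sum>i\<in>UNIV. ddir u (\<lambda>x. C v j i x * z i x) 0)"
      by (intro ddir_sum[OF _ X(2)] holo_on_mult C z)
    also have "\<dots> = (\<Sum>i\<in>UNIV. ddir u (C v j i) 0 * z i 0 + C v j i 0 * ddir u (z i) 0)"
      by (simp only: ddir_mult[OF C z X(2)])
    finally show ?thesis .
  qed
  have comm: "ddir u (ddir v (z j)) 0 = ddir v (ddir u (z j)) 0" for j
    by (rule ddir_commute[OF z X(2)])
  have Cw: "christoffel h v w $ j = (\<Sum>m\<in>UNIV. w $ m * C v m j 0)" for v j
    using christoffel_basis[of h v w j] by (simp add: C_def)
  have fl: "flatness h u v (axis j 1) i = ddir u (C v j i) 0 - ddir v (C u j i) 0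
      - (\<Sum>s\<in>UNIV. C v j s 0 * C u s i 0) + (\<Sum>s\<in>UNIV. C u j s 0 * C v s i 0)" for j i
    unfolding flatness_def pd_at
      christoffel_basis[of h u "christoffel _ _ _"] christoffel_basis[of h v "christoffel _ _ _"]
    by (simp add: C_def[abs_def])
  have "curvature R (nabla R Rp k b) \<zeta> h u v w =
     (\<Sum>j\<in>UNIV. (ddir u (N v j) 0 - ddir v (N u j) 0) * w $ j
       - (N u j 0 * christoffel h v w $ j - N v j 0 * christoffel h u w $ j))"
    unfolding curvature_def ext_conn_def Let_def ext_d_def wedge_def nabla_dz pd_at
    by (simp add: N_def[abs_def] dz_def)
  also have "\<dots> = (\<Sum>j\<in>UNIV. ((\<Sum>i\<in>UNIV. ddir u (C v j i) 0 * z i 0 + C v j i 0 * ddir u (z i) 0)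
         - (\<Sum>i\<in>UNIV. ddir v (C u j i) 0 * z i 0 + C u j i 0 * ddir v (z i) 0)) * w $ j
       - ((ddir u (z j) 0 + (\<Sum>i\<in>UNIV. C u j i 0 * z i 0)) * (\<Sum>m\<in>UNIV. w $ m * C v m j 0)
        - (ddir v (z j) 0 + (\<Sum>i\<in>UNIV. C v j i 0 * z i 0)) * (\<Sum>m\<in>UNIV. w $ m * C u m j 0)))"
    by (simp only: dN N[OF X(2)] Cw comm add_diff_cancel_left)
  also have "\<dots> = (\<Sum>j\<in>UNIV. w $ j * (\<Sum>i\<in>UNIV. z i 0 * flatness h u v (axis j 1) i))"
    unfolding fl by (rule curvature_sum_identity)
  finally show ?thesis by (simp add: z_def)
qed

text \<open>The third argument runs over the basis only, since \<open>curvature_formula\<close>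
  expands \<open>w\<close>.\<close>

definition curvature_eq :: bool where
  "curvature_eq \<longleftrightarrow> (\<forall>h\<in>torus_reg R. \<forall>u v j i.
     flatness h u v (axis j 1) i = a u (axis j 1) * v $ i - a v (axis j 1) * u $ i)"

lemma curvature_eq_iff:
  "(\<forall>U \<zeta>. open_reg R U \<and> one_form R U \<zeta> \<longrightarrow>
     (\<forall>h\<in>U. \<forall>u v w. curvature R (nabla R Rp k b) \<zeta> h u v w = - wedge \<zeta> (A_field a) h u v w))
   \<longleftrightarrow> curvature_eq"
proof (intro iffI)
  assume L: "\<forall>U \<zeta>. open_reg R U \<and> one_form R U \<zeta> \<longrightarrow>
     (\<forall>h\<in>U. \<forall>u v w. curvature R (nabla R Rp k b) \<zeta> h u v w = - wedge \<zeta> (A_field a) h u v w)"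
  have Ureg: "open_reg R (torus_reg R)" by (rule open_reg_torus_reg[OF fin])
  \<comment> \<open>The constant forms \<open>dz i\<close> on the whole regular set are test forms
    that pick out single components.\<close>
  have dz: "one_form R (torus_reg R) (dz i)" for i
    unfolding one_form_def holomorphic_fun_def
  proof (intro conjI ballI allI dz_linear exI)
    show "Vector_Spaces.linear (*s) (*) (\<lambda>v :: complex ^ 'n. 0)" by (rule linear_complexI) auto
    show "((\<lambda>u. dz i (translate R u h) v) has_derivative (\<lambda>v. 0)) (at 0)" for h v
      by (simp add: dz_def)
  qed
  show curvature_eq
    unfolding curvature_eq_def
  proof (intro ballI allI)
    fix h u v j i assume h: "h \<in> torus_reg R"
    have "curvature R (nabla R Rp k b) (dz i) h u v (axis j 1) = - wedge (dz i) (A_field a) h u v (axis j 1)"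
      using L Ureg dz h by blast
    moreover have "curvature R (nabla R Rp k b) (dz i) h u v (axis j 1) = flatness h u v (axis j 1) i"
      unfolding curvature_formula[OF Ureg dz h]
      by (simp add: dz_def axis_def if_distrib[of "\<lambda>u. u * _"] cong: if_cong)
    ultimately show "flatness h u v (axis j 1) i = a u (axis j 1) * v $ i - a v (axis j 1) * u $ i"
      by (simp add: wedge_def A_field_def dz_def)
  qed
next
  assume S: curvature_eq
  show "\<forall>U \<zeta>. open_reg R U \<and> one_form R U \<zeta> \<longrightarrow>
     (\<forall>h\<in>U. \<forall>u v w. curvature R (nabla R Rp k b) \<zeta> h u v w = - wedge \<zeta> (A_field a) h u v w)"
  proof (intro allI impI ballI)
    fix U \<zeta> h u v w assume A: "open_reg R U \<and> one_form R U \<zeta>" and h: "h \<in> U"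
    have lin: "Vector_Spaces.linear (*s) (*) (\<zeta> h)" using A h by (simp add: one_form_def)
    have f: "flatness h u v (axis j 1) i = a u (axis j 1) * v $ i - a v (axis j 1) * u $ i" for i j
      using S A h unfolding curvature_eq_def open_reg_def by blast
    have "curvature R (nabla R Rp k b) \<zeta> h u v w =
      (\<Sum>j\<in>UNIV. w $ j * (\<Sum>i\<in>UNIV. \<zeta> h (axis i 1) * (a u (axis j 1) * v $ i - a v (axis j 1) * u $ i)))"
      using curvature_formula[of U \<zeta> h u v w] A h by (simp add: f)
    also have "\<dots> = (\<Sum>j\<in>UNIV. w $ j * a u (axis j 1)) * (\<Sum>i\<in>UNIV. v $ i * \<zeta> h (axis i 1))
        - (\<Sum>j\<in>UNIV. w $ j * a v (axis j 1)) * (\<Sum>i\<in>UNIV. u $ i * \<zeta> h (axis i 1))"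
      by (simp add: sum_product sum_distrib_left right_diff_distrib sum_subtractf mult_ac)
    also have "\<dots> = a u w * \<zeta> h v - a v w * \<zeta> h u"
      by (simp only: linear_complex_basis[OF lin, symmetric]
          linear_complex_basis[OF sym_bilinear_linear(1)[OF a], symmetric])
    finally show "curvature R (nabla R Rp k b) \<zeta> h u v w = - wedge \<zeta> (A_field a) h u v w"
      by (simp add: wedge_def A_field_def)
  qed
qed

section \<open>Local solutions in a chart\<close>

definition chart_solution :: "'n torus_pt \<Rightarrow> (complex ^ 'n) set \<Rightarrow> (complex ^ 'n \<Rightarrow> complex) \<Rightarrow> bool" where
  "chart_solution p X g \<longleftrightarrow> holo_on X g \<and> X \<subseteq> (\<lambda>x. translate R x p) -` torus_reg R \<and>
     (\<forall>x\<in>X. \<forall>u v. ddir u (ddir v g) x + ddir (christoffel (translate R x p) u v) g x + a u v * g x = 0)"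

text \<open>An identity of operators rather than of equations, because it is used in both
  directions: in \<open>solution_chart\<close> and in
  \<open>chart_solution_solution\<close>.\<close>

lemma solution_operator:
  assumes g: "holo_on X (\<lambda>x. f (translate R x p))" and x: "x \<in> X" and h: "h = translate R x p"
  shows "pd R u (pd R v f) h
        + 1/2 * (\<Sum>\<alpha>\<in>Rp. k \<alpha> * root_eval \<alpha> u * root_eval \<alpha> v * ((h \<alpha> + 1) / (h \<alpha> - 1))
                     * pd R (coroot \<alpha>) f h)
        + pd R (b u v) f h + a u v * f h
    = ddir u (ddir v (\<lambda>x. f (translate R x p))) x
      + ddir (christoffel h u v) (\<lambda>x. f (translate R x p)) x + a u v * f (translate R x p)"
  unfolding linear_christoffel[OF holo_on_derivative(1)[OF g x]] unfolding h pd_chart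
  by (simp add: mult_ac)

lemma solution_chart:
  assumes "open_reg R U" "p \<in> torus R" "solution R Rp k a b U f"
  shows "chart_solution p ((\<lambda>x. translate R x p) -` U) (\<lambda>x. f (translate R x p))"
  unfolding chart_solution_def
proof (intro conjI ballI allI)
  show g: "holo_on ((\<lambda>x. translate R x p) -` U) (\<lambda>x. f (translate R x p))"
    using holo_on_chart assms by (simp add: solution_def)
  show "(\<lambda>x. translate R x p) -` U \<subseteq> (\<lambda>x. translate R x p) -` torus_reg R"
    using assms(1) by (auto simp: open_reg_def)
  fix x u v assume x: "x \<in> (\<lambda>x. translate R x p) -` U"
  show "ddir u (ddir v (\<lambda>x. f (translate R x p))) x
      + ddir (christoffel (translate R x p) u v) (\<lambda>x. f (translate R x p)) x + a u v * f (translate R x p) = 0"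
    unfolding solution_operator[OF g x refl, symmetric]
    using assms(3) x unfolding solution_def by blast
qed

lemma chart_solution_subset:
  "chart_solution p X g \<Longrightarrow> open T \<Longrightarrow> T \<subseteq> X \<Longrightarrow> chart_solution p T g"
  unfolding chart_solution_def using holo_on_subset by blast

lemma chart_solution_cong:
  assumes "chart_solution p X g" "\<And>x. x \<in> X \<Longrightarrow> g x = g' x"
  shows "chart_solution p X g'"
proof -
  have h: "holo_on X g" using assms(1) by (simp add: chart_solution_def)
  note X = holo_on_open[OF h]
  have d: "ddir v g' x = ddir v g x" if "x \<in> X" for x v
    using ddir_cong[OF X that, of g g' v] assms(2) by simp
  have dd: "ddir u (ddir v g') x = ddir u (ddir v g) x" if "x \<in> X" for x u v
    by (rule ddir_cong[OF X that d])
  show ?thesis using assms holo_on_cong[OF h assms(2)] by (simp add: chart_solution_def d dd)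
qed

lemma chart_solution_solution:
  assumes V: "open V" "inj_on (\<lambda>u. translate R u p) V" and g: "chart_solution p V g"
  shows "solution R Rp k a b ((\<lambda>u. translate R u p) ` V) (\<lambda>h. g (the_inv_into V (\<lambda>u. translate R u p) h))"
    (is "solution R Rp k a b ?U ?f")
proof -
  have f: "?f (translate R x p) = g x" if "x \<in> V" for x
    by (simp only: the_inv_into_f_f[OF V(2) that])
  have gh: "holo_on V g" using g by (simp add: chart_solution_def)
  have G: "chart_solution p V (\<lambda>x. ?f (translate R x p))"
    by (rule chart_solution_cong[OF g]) (simp add: f)
  then have fh: "holo_on V (\<lambda>x. ?f (translate R x p))" by (simp add: chart_solution_def)
  show ?thesis
    unfolding solution_def
  proof (intro conjI ballI allI)
    show "holomorphic_fun R ?U ?f"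
      unfolding holomorphic_fun_def
    proof
      fix h assume "h \<in> ?U"
      then obtain x where x: "x \<in> V" and h: "h = translate R x p" by blast
      let ?D = "\<lambda>v. ddir v (\<lambda>x. ?f (translate R x p)) x"
      have "((\<lambda>u. ?f (translate R (x + u) p)) has_derivative ?D) (at 0)"
        by (rule has_derivative_compose[of "\<lambda>u. x + u" "\<lambda>u. 0 + u", simplified])
           (use holo_on_derivative(2)[OF fh x] in \<open>auto intro!: derivative_eq_intros\<close>)
      then show "\<exists>D. Vector_Spaces.linear (*s) (*) D \<and> ((\<lambda>u. ?f (translate R u h)) has_derivative D) (at 0)"
        using holo_on_derivative(1)[OF fh x] unfolding h translate_translate by blast
    qed
    fix h u v assume "h \<in> ?U"
    then obtain x where x: "x \<in> V" and h: "h = translate R x p" by blast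
    show "pd R u (pd R v ?f) h
        + 1/2 * (\<Sum>\<alpha>\<in>Rp. k \<alpha> * root_eval \<alpha> u * root_eval \<alpha> v * ((h \<alpha> + 1) / (h \<alpha> - 1))
                     * pd R (coroot \<alpha>) ?f h)
        + pd R (b u v) ?f h + a u v * ?f h = 0"
      unfolding solution_operator[OF fh x h] using G x unfolding chart_solution_def h by blast
  qed
qed

lemma chart_solution_sum:
  assumes "open X" "X \<subseteq> (\<lambda>x. translate R x p) -` torus_reg R"
    and g: "\<And>i. i \<in> I \<Longrightarrow> chart_solution p X (g i)"
  shows "chart_solution p X (\<lambda>x. \<Sum>i\<in>I. c i * g i x)"
proof -
  have h: "holo_on X (g i)" if "i \<in> I" for i using g[OF that] by (simp add: chart_solution_def)
  have d: "ddir v (\<lambda>x. \<Sum>i\<in>I. c i * G i x) x = (\<Sum>i\<in>I. c i * ddir v (G i) x)"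
    if "x \<in> X" "\<And>i. i \<in> I \<Longrightarrow> holo_on X (G i)" for G x v
  proof -
    have "ddir v (\<lambda>x. \<Sum>i\<in>I. c i * G i x) x = (\<Sum>i\<in>I. ddir v (\<lambda>x. c i * G i x) x)"
      by (rule ddir_sum[OF _ that(1)]) (intro holo_on_mult holo_on_const assms(1) that(2))
    then show ?thesis by (simp add: ddir_cmult[OF that(2) that(1)])
  qed
  have dd: "ddir u (ddir v (\<lambda>x. \<Sum>i\<in>I. c i * g i x)) x = (\<Sum>i\<in>I. c i * ddir u (ddir v (g i)) x)"
    if "x \<in> X" for x u v
  proof -
    have "ddir u (ddir v (\<lambda>x. \<Sum>i\<in>I. c i * g i x)) x = ddir u (\<lambda>x. \<Sum>i\<in>I. c i * ddir v (g i) x) x"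
      by (rule ddir_cong[OF assms(1) that d[OF _ h]])
    also have "\<dots> = (\<Sum>i\<in>I. c i * ddir u (ddir v (g i)) x)"
      by (rule d[OF that holo_on_ddir[OF h]])
    finally show ?thesis .
  qed
  show ?thesis
    unfolding chart_solution_def
  proof (intro conjI ballI allI assms(2))
    show "holo_on X (\<lambda>x. \<Sum>i\<in>I. c i * g i x)"
      by (intro holo_on_sum holo_on_mult holo_on_const h assms)
    fix x u v assume x: "x \<in> X"
    have "(\<Sum>i\<in>I. c i * (ddir u (ddir v (g i)) x + ddir (christoffel (translate R x p) u v) (g i) x + a u v * g i x)) = 0"
      using g x by (intro sum.neutral) (simp add: chart_solution_def)
    moreover have "ddir v (\<lambda>x. \<Sum>i\<in>I. c i * g i x) x = (\<Sum>i\<in>I. c i * ddir v (g i) x)" for v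
      by (rule d[OF x h])
    ultimately show "ddir u (ddir v (\<lambda>x. \<Sum>i\<in>I. c i * g i x)) x
      + ddir (christoffel (translate R x p) u v) (\<lambda>x. \<Sum>i\<in>I. c i * g i x) x + a u v * (\<Sum>i\<in>I. c i * g i x) = 0"
      unfolding dd[OF x]
      by (simp add: algebra_simps sum.distrib sum_distrib_left)
  qed
qed

text \<open>The equation is differentiated once more, second derivatives are eliminated by the
  equation itself, and the two orders of the third derivative are compared. What remains is a linear
  relation between the components of the jet of \<open>g\<close> at 0.\<close>

lemma chart_solution_compatible:
  assumes g: "chart_solution p X g" and 0: "0 \<in> X" and p: "p \<in> torus R"
  shows "(\<Sum>i\<in>UNIV. ddir (axis i 1) g 0 * (a u w * v $ i - a v w * u $ i - flatness p u v w i))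
      + g 0 * (a u (christoffel p v w) - a v (christoffel p u w)) = 0"
proof -
  have h: "holo_on X g" and sub: "X \<subseteq> (\<lambda>x. translate R x p) -` torus_reg R"
    using g unfolding chart_solution_def by blast+
  have eq: "ddir u (ddir v g) x = - (ddir (christoffel (translate R x p) u v) g x + a u v * g x)"
    if "x \<in> X" for x u v
  proof -
    have "ddir u (ddir v g) x + ddir (christoffel (translate R x p) u v) g x + a u v * g x = 0"
      using g that unfolding chart_solution_def by blast
    then show ?thesis by (simp only: eq_neg_iff_add_eq_0 add.assoc)
  qed
  note X = holo_on_open[OF h]
  define C where "C v i x = christoffel (translate R x p) v w $ i" for v i x
  have C: "holo_on X (C v i)" for v i
    unfolding C_def[abs_def] by (rule holo_on_christoffel[OF p X sub])
  define e where "e i = ddir (axis i 1) g" for i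
  have e: "holo_on X (e i)" for i unfolding e_def by (rule holo_on_ddir[OF h])
  have third: "ddir u (ddir v (ddir w g)) 0 =
      - ((\<Sum>i\<in>UNIV. ddir u (C v i) 0 * e i 0) - (ddir (christoffel p u (christoffel p v w)) g 0
           + a u (christoffel p v w) * g 0) + a v w * ddir u g 0)" for u v
  proof -
    have "ddir u (ddir v (ddir w g)) 0 = ddir u (\<lambda>x. - ((\<Sum>i\<in>UNIV. C v i x * e i x) + a v w * g x)) 0"
    proof (rule ddir_cong[OF X 0])
      fix x assume x: "x \<in> X"
      show "ddir v (ddir w g) x = - ((\<Sum>i\<in>UNIV. C v i x * e i x) + a v w * g x)"
        unfolding eq[OF x] by (subst ddir_sum_basis[OF h x]) (simp add: C_def e_def)
    qed
    also have "\<dots> = - (ddir u (\<lambda>x. (\<Sum>i\<in>UNIV. C v i x * e i x) + a v w * g x) 0)"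
      by (intro ddir_minus[OF _ 0] holo_on_add holo_on_sum holo_on_mult C e holo_on_const X h)
    also have "ddir u (\<lambda>x. (\<Sum>i\<in>UNIV. C v i x * e i x) + a v w * g x) 0
        = ddir u (\<lambda>x. \<Sum>i\<in>UNIV. C v i x * e i x) 0 + ddir u (\<lambda>x. a v w * g x) 0"
      by (intro ddir_add[OF _ _ 0] holo_on_sum holo_on_mult C e holo_on_const X h)
    also have "ddir u (\<lambda>x. a v w * g x) 0 = a v w * ddir u g 0" by (rule ddir_cmult[OF h 0])
    also have "ddir u (\<lambda>x. \<Sum>i\<in>UNIV. C v i x * e i x) 0 = (\<Sum>i\<in>UNIV. ddir u (\<lambda>x. C v i x * e i x) 0)"
      by (intro ddir_sum[OF _ 0] holo_on_mult C e)
    also have "\<dots> = (\<Sum>i\<in>UNIV. ddir u (C v i) 0 * e i 0) + (\<Sum>i\<in>UNIV. C v i 0 * ddir u (e i) 0)"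
      by (simp only: ddir_mult[OF C e 0] sum.distrib)
    \<comment> \<open>Freezing the coefficients at 0 turns this sum into a second derivative in a
      constant direction, to which the equation applies again.\<close>
    also have "(\<Sum>i\<in>UNIV. C v i 0 * ddir u (e i) 0) = ddir u (ddir (christoffel p v w) g) 0"
    proof -
      have "ddir u (ddir (christoffel p v w) g) 0 = ddir u (\<lambda>x. \<Sum>i\<in>UNIV. C v i 0 * e i x) 0"
        by (rule ddir_cong[OF X 0]) (simp add: ddir_sum_basis[OF h, of _ "christoffel p v w"] C_def e_def)
      also have "\<dots> = (\<Sum>i\<in>UNIV. ddir u (\<lambda>x. C v i 0 * e i x) 0)"
        by (intro ddir_sum[OF _ 0] holo_on_mult holo_on_const X e)
      finally show ?thesis by (simp only: ddir_cmult[OF e 0])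
    qed
    also have "\<dots> = - (ddir (christoffel p u (christoffel p v w)) g 0 + a u (christoffel p v w) * g 0)"
      using eq[OF 0] by simp
    finally show ?thesis by (simp only: diff_conv_add_uminus)
  qed
  have s: "ddir u (ddir v (ddir w g)) 0 = ddir v (ddir u (ddir w g)) 0"
    by (rule ddir_commute[OF holo_on_ddir[OF h] 0])
  have b: "ddir y g 0 = (\<Sum>i\<in>UNIV. y $ i * e i 0)" for y
    unfolding e_def by (rule ddir_sum_basis[OF h 0])
  have fl: "flatness p u v w i = ddir u (C v i) 0 - ddir v (C u i) 0
      - christoffel p u (christoffel p v w) $ i + christoffel p v (christoffel p u w) $ i" for i
    by (simp add: flatness_def pd_at C_def[abs_def])
  from s[unfolded third] show ?thesis
    unfolding fl b e_def[symmetric]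
    by (simp add: algebra_simps sum.distrib sum_subtractf sum_distrib_left)
qed

end

section \<open>Jets and their first-order system\<close>

lemma sum_option: "(\<Sum>r\<in>UNIV. f r) = f None + (\<Sum>i\<in>UNIV. f (Some (i :: 'i :: finite)))"
  by (simp add: UNIV_option_conv sum.reindex)

text \<open>The index type has \<open>n + 1\<close> elements, the dimension asserted for the local
  solution space.\<close>

definition jet :: "(complex ^ 'n \<Rightarrow> complex) \<Rightarrow> 'n option \<Rightarrow> complex ^ 'n \<Rightarrow> complex" where
  "jet g r x = (case r of None \<Rightarrow> g x | Some i \<Rightarrow> ddir (axis i 1) g x)"

lemma jet_simps [simp]: "jet g None = g" "jet g (Some i) = ddir (axis i 1) g"
  by (simp_all add: jet_def fun_eq_iff)

lemma jet_holo: "holo_on X g \<Longrightarrow> holo_on X (jet g r)"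
  by (cases r) (simp_all add: holo_on_ddir)

lemma jet_cong:
  assumes "open T" "x \<in> T" "\<And>y. y \<in> T \<Longrightarrow> f y = g y"
  shows "jet f r x = jet g r x"
  using ddir_cong[OF assms] assms(2,3) by (cases r) simp_all

lemma jet_const_0 [simp]: "jet (\<lambda>x. 0) r x = 0"
  by (cases r) simp_all

lemma jet_sum:
  assumes "x \<in> X" "\<And>i. i \<in> I \<Longrightarrow> holo_on X (g i)" "open X"
  shows "jet (\<lambda>x. \<Sum>i\<in>I. c i * g i x) r x = (\<Sum>i\<in>I. c i * jet (g i) r x)"
proof (cases r)
  case (Some l)
  have "ddir (axis l 1) (\<lambda>x. \<Sum>i\<in>I. c i * g i x) x = (\<Sum>i\<in>I. ddir (axis l 1) (\<lambda>x. c i * g i x) x)"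
    by (rule ddir_sum[OF _ assms(1)]) (intro holo_on_mult holo_on_const assms)
  then show ?thesis by (simp add: Some ddir_cmult[OF assms(2,1)])
qed simp

context toric_data
begin

text \<open>Coefficients of the first-order system for jets. Row \<open>None\<close> says that the
  other entries are the partial derivatives of the first; row \<open>Some j\<close> is the
  differential equation for the basis vectors \<open>l\<close> and \<open>j\<close>.\<close>

definition sysmat :: "'n torus_pt \<Rightarrow> 'n \<Rightarrow> 'n option \<Rightarrow> 'n option \<Rightarrow> complex ^ 'n \<Rightarrow> complex" where
  "sysmat p l r s x = (case r of
       None \<Rightarrow> (case s of None \<Rightarrow> 0 | Some i \<Rightarrow> if i = l then 1 else 0)
     | Some j \<Rightarrow> (case s of None \<Rightarrow> - a (axis l 1) (axis j 1)
                 | Some i \<Rightarrow> - christoffel (translate R x p) (axis l 1) (axis j 1) $ i))"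

lemma sysmat_simps:
  "sysmat p l None None = (\<lambda>x. 0)"
  "sysmat p l None (Some i) = (\<lambda>x. if i = l then 1 else 0)"
  "sysmat p l (Some j) None = (\<lambda>x. - a (axis l 1) (axis j 1))"
  "sysmat p l (Some j) (Some i) = (\<lambda>x. - christoffel (translate R x p) (axis l 1) (axis j 1) $ i)"
  by (simp_all add: sysmat_def fun_eq_iff)

lemma sysmat_holo:
  assumes "p \<in> torus R" "open X" "X \<subseteq> (\<lambda>x. translate R x p) -` torus_reg R"
  shows "holo_on X (sysmat p l r s)"
  by (cases r; cases s) (auto simp: sysmat_simps intro!: holo_on_const holo_on_minus holo_on_christoffel assms)

lemma sysmat_system:
  assumes "p \<in> torus R" "open X" "0 \<in> X" "X \<subseteq> (\<lambda>x. translate R x p) -` torus_reg R"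
  shows "\<exists>\<rho> B. ball 0 \<rho> \<subseteq> X \<and> linear_system (sysmat p) \<rho> B"
  by (rule linear_system_exists) (rule sysmat_holo assms)+

lemma sysmat_rhs:
  "(\<Sum>s\<in>UNIV. sysmat p l None s x * Y s) = Y (Some l)"
  "(\<Sum>s\<in>UNIV. sysmat p l (Some j) s x * Y s) = - a (axis l 1) (axis j 1) * Y None
      - (\<Sum>i\<in>UNIV. christoffel (translate R x p) (axis l 1) (axis j 1) $ i * Y (Some i))"
  by (simp_all add: sum_option sysmat_simps sum_negf if_distrib[of "\<lambda>u. u * _"] cong: if_cong)

lemma chart_solution_jet:
  assumes g: "chart_solution p X g" and x: "x \<in> X"
  shows "ddir (axis l 1) (jet g r) x = (\<Sum>s\<in>UNIV. sysmat p l r s x * jet g s x)"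
proof (cases r)
  case None
  then show ?thesis by (simp add: sysmat_rhs)
next
  case (Some j)
  have h: "holo_on X g" using g by (simp add: chart_solution_def)
  have "ddir (axis l 1) (ddir (axis j 1) g) x + ddir (christoffel (translate R x p) (axis l 1) (axis j 1)) g x
      + a (axis l 1) (axis j 1) * g x = 0"
    using g x unfolding chart_solution_def by blast
  then have "ddir (axis l 1) (ddir (axis j 1) g) x = - a (axis l 1) (axis j 1) * g x
      - ddir (christoffel (translate R x p) (axis l 1) (axis j 1)) g x"
    by (simp only: eq_diff_eq mult_minus_left eq_neg_iff_add_eq_0)
  then show ?thesis
    unfolding Some sysmat_rhs ddir_sum_basis[OF h x, of "christoffel _ _ _"] by simp
qed

lemma chart_preimage_reg:
  assumes "p \<in> torus R"
  shows "open ((\<lambda>x. translate R x p) -` torus_reg R)"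
  using open_reg_torus_reg[OF fin] open_chart_preimage[OF _ assms] by (simp add: open_reg_def)

text \<open>Uniqueness for the first-order system. That system is set up on a small ball, so
  vanishing is asserted near 0, which suffices for germs.\<close>

lemma chart_solution_zero:
  assumes g: "chart_solution p X g" and X: "0 \<in> X" and p: "p \<in> torus R"
    and j: "\<And>r. jet g r 0 = 0"
  shows "\<exists>\<rho>>0. ball 0 \<rho> \<subseteq> X \<and> (\<forall>x\<in>ball 0 \<rho>. g x = 0)"
proof -
  have h: "holo_on X g" and sub: "X \<subseteq> (\<lambda>x. translate R x p) -` torus_reg R"
    using g by (simp_all add: chart_solution_def)
  note oX = holo_on_open[OF h]
  obtain \<rho> B where \<rho>: "ball 0 \<rho> \<subseteq> X" and ls: "linear_system (sysmat p) \<rho> B"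
    using sysmat_system[OF p oX X sub] by blast
  interpret linear_system "sysmat p" \<rho> B by (rule ls)
  have "jet g None x = 0" if x: "x \<in> ball 0 \<rho>" for x
  proof (rule unique_solution[where Y = "jet g", OF _ _ j x])
    show "holo_on (ball 0 \<rho>) (jet g r)" for r
      by (rule holo_on_subset[OF jet_holo[OF h] open_ball \<rho>])
    show "ddir (axis l 1) (jet g r) x = rhs (jet g) l r x" if "x \<in> ball 0 \<rho>" for l r x
      unfolding rhs_def by (rule chart_solution_jet[OF g]) (use \<rho> that in blast)
  qed
  with rho_pos \<rho> show ?thesis by auto
qed

text \<open>The four blocks of the flatness condition are, in the order of the cases, the symmetry
  of \<open>a\<close>, the symmetry of \<open>christoffel\<close>,
  \<open>a_christoffel_symmetric\<close> and the curvature equation.\<close>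

lemma sysmat_flat:
  assumes S: curvature_eq and p: "p \<in> torus R" and x: "translate R x p \<in> torus_reg R"
  shows "ddir (axis k' 1) (sysmat p l r s) x - ddir (axis l 1) (sysmat p k' r s) x
     + (\<Sum>t\<in>UNIV. sysmat p l r t x * sysmat p k' t s x - sysmat p k' r t x * sysmat p l t s x) = 0"
proof -
  let ?h = "translate R x p" and ?X = "(\<lambda>x. translate R x p) -` torus_reg R"
  have dneg: "ddir v (\<lambda>x. - christoffel (translate R x p) u w $ i) x
      = - ddir v (\<lambda>x. christoffel (translate R x p) u w $ i) x" for v u w i
    by (rule ddir_minus[OF holo_on_christoffel[OF p chart_preimage_reg[OF p] subset_refl]]) (use x in simp)
  have fl: "ddir (axis k' 1) (\<lambda>x. christoffel (translate R x p) (axis l 1) (axis j 1) $ i) x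
     - ddir (axis l 1) (\<lambda>x. christoffel (translate R x p) (axis k' 1) (axis j 1) $ i) x
     - (\<Sum>t\<in>UNIV. christoffel ?h (axis l 1) (axis j 1) $ t * christoffel ?h (axis k' 1) (axis t 1) $ i)
     + (\<Sum>t\<in>UNIV. christoffel ?h (axis k' 1) (axis j 1) $ t * christoffel ?h (axis l 1) (axis t 1) $ i)
     = a (axis k' 1) (axis j 1) * axis l 1 $ i - a (axis l 1) (axis j 1) * axis k' 1 $ i" for i j
  proof -
    have "flatness ?h (axis k' 1) (axis l 1) (axis j 1) i
        = a (axis k' 1) (axis j 1) * axis l 1 $ i - a (axis l 1) (axis j 1) * axis k' 1 $ i"
      using S x unfolding curvature_eq_def by blast
    then show ?thesis
      unfolding flatness_def pd_chart
        christoffel_basis[of ?h "axis k' 1" "christoffel _ _ _"] christoffel_basis[of ?h "axis l 1" "christoffel _ _ _"] .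
  qed
  have ac: "(\<Sum>t\<in>UNIV. christoffel ?h v w $ t * a u (axis t 1)) = a u (christoffel ?h v w)" for u v w
    by (rule linear_complex_basis[OF sym_bilinear_linear(1)[OF a], symmetric])
  have delta: "(\<Sum>t\<in>UNIV. (if t = l then 1 else 0) * f t) = f l" for l and f :: "'n \<Rightarrow> complex"
    by (simp add: if_distrib[of "\<lambda>u. u * _"] cong: if_cong)
  show ?thesis
  proof (cases r)
    case None
    show ?thesis
    proof (cases s)
      case None
      then show ?thesis using \<open>r = None\<close>
        by (simp add: sum_option sysmat_simps sum_subtractf sum_negf delta a_sym[of "axis l 1" "axis k' 1"])
    next
      case (Some i)
      then show ?thesis using \<open>r = None\<close>
        by (simp add: sum_option sysmat_simps sum_subtractf sum_negf delta
             christoffel_sym[of ?h "axis l 1" "axis k' 1"])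
    qed
  next
    case (Some j)
    show ?thesis
    proof (cases s)
      case None
      then show ?thesis using \<open>r = Some j\<close> a_christoffel_symmetric[of "axis k' 1" ?h "axis l 1" "axis j 1"]
        by (simp add: sum_option sysmat_simps sum_subtractf ac)
    next
      case (Some i)
      then show ?thesis using \<open>r = Some j\<close> fl[of j i]
        by (simp add: sum_option sysmat_simps sum_subtractf dneg axis_def algebra_simps)
    qed
  qed
qed

text \<open>The radius precedes the initial jet: it comes from the coefficients of the linear
  system, so all jets share one domain.\<close>

lemma chart_solutions_exist:
  assumes S: curvature_eq and p: "p \<in> torus_reg R"
  shows "\<exists>\<rho>>0. \<forall>c. \<exists>g. chart_solution p (ball 0 \<rho>) g \<and> (\<forall>r. jet g r 0 = c r)"
proof -
  let ?X = "(\<lambda>x. translate R x p) -` torus_reg R"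
  have pt: "p \<in> torus R" using p by (simp add: torus_reg_def)
  note oX = chart_preimage_reg[OF pt]
  obtain \<rho> B where \<rho>: "ball 0 \<rho> \<subseteq> ?X" and ls: "linear_system (sysmat p) \<rho> B"
    using sysmat_system[OF pt oX _ subset_refl] p by auto
  interpret linear_system "sysmat p" \<rho> B by (rule ls)
  have "\<exists>g. chart_solution p (ball 0 \<rho>) g \<and> (\<forall>r. jet g r 0 = c r)" for c
  proof -
    have "\<exists>Y. (\<forall>i. holo_on (ball 0 \<rho>) (Y i)) \<and> (\<forall>i. Y i 0 = c i) \<and>
           (\<forall>l i. \<forall>x\<in>ball 0 \<rho>. ddir (axis l 1) (Y i) x = rhs Y l i x)"
      by (rule Frobenius, rule sysmat_flat[OF S pt]) (use \<rho> in blast)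
    then obtain Y where Y: "\<And>r. holo_on (ball 0 \<rho>) (Y r)" "\<And>r. Y r 0 = c r"
      and dY: "\<And>l r x. x \<in> ball 0 \<rho> \<Longrightarrow> ddir (axis l 1) (Y r) x = rhs Y l r x" by blast
    define g where "g = Y None"
    have d1: "ddir (axis l 1) g x = Y (Some l) x" if "x \<in> ball 0 \<rho>" for l x
      unfolding g_def dY[OF that] rhs_def sysmat_rhs ..
    have d2: "ddir (axis l 1) (ddir (axis j 1) g) x = - a (axis l 1) (axis j 1) * g x
      - ddir (christoffel (translate R x p) (axis l 1) (axis j 1)) g x" if x: "x \<in> ball 0 \<rho>" for l j x
    proof -
      have "ddir (axis l 1) (ddir (axis j 1) g) x = ddir (axis l 1) (Y (Some j)) x"
        by (rule ddir_cong[OF open_ball x d1])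
      also have "\<dots> = - a (axis l 1) (axis j 1) * g x
         - (\<Sum>i\<in>UNIV. christoffel (translate R x p) (axis l 1) (axis j 1) $ i * ddir (axis i 1) g x)"
        unfolding dY[OF x] rhs_def sysmat_rhs d1[OF x] by (simp add: g_def)
      finally show ?thesis
        unfolding ddir_sum_basis[OF Y(1)[of None, folded g_def] x, of "christoffel _ _ _"] .
    qed
    have gh: "holo_on (ball 0 \<rho>) g" unfolding g_def by (rule Y)
    have "chart_solution p (ball 0 \<rho>) g"
      unfolding chart_solution_def
    proof (intro conjI ballI allI gh \<rho>)
      fix x u v assume x: "x \<in> ball (0 :: complex ^ 'n) \<rho>"
      let ?h = "translate R x p"
      \<comment> \<open>So far the equation holds for basis vectors. Both sides are linear in the
        first argument and symmetric, which extends it to all \<open>u\<close> and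
        \<open>v\<close>.\<close>
      let ?L = "\<lambda>u v. ddir u (ddir v g) x" and ?M = "\<lambda>u v. - a u v * g x - ddir (christoffel ?h u v) g x"
      have comm: "?L u v = ?L v u" for u v by (rule ddir_commute[OF gh x])
      have Llin: "Vector_Spaces.linear (*s) (*) (\<lambda>u. ?L u v)" for v
        by (rule holo_on_derivative(1)[OF holo_on_ddir[OF gh] x])
      have cadd: "christoffel ?h (u + u') v = christoffel ?h u v + christoffel ?h u' v"
        and csc: "christoffel ?h (c *s u) v = c *s christoffel ?h u v" for u u' v c
        using linear_complexD[OF christoffel_nth_linear[of ?h v]]
        by (simp_all add: vec_eq_iff christoffel_sym[of ?h _ v])
      have Mlin: "Vector_Spaces.linear (*s) (*) (\<lambda>u. ?M u v)" for v
        by (rule linear_complexI)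
           (simp_all add: cadd csc a_left ddir_plus[OF gh x] ddir_scale[OF gh x] algebra_simps)
      have Msym: "?M u v = ?M v u" for u v by (simp only: a_sym[of u v] christoffel_sym[of _ u v])
      have 1: "?L u (axis j 1) = ?M u (axis j 1)" for u j
        unfolding linear_complex_basis[OF Llin, of u] linear_complex_basis[OF Mlin, of u] d2[OF x] ..
      have "?L v u = ?M v u"
        unfolding linear_complex_basis[OF Llin, of v] linear_complex_basis[OF Mlin, of v]
          comm[of "axis _ 1" u] Msym[of "axis _ 1" u] 1 ..
      then show "ddir u (ddir v g) x + ddir (christoffel ?h u v) g x + a u v * g x = 0"
        unfolding comm[of u v] Msym[of v u] by simp
    qed
    moreover have "jet g r 0 = c r" for r
      using Y(2) d1[of 0] rho_pos by (cases r) (auto simp: g_def)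
    ultimately show ?thesis by blast
  qed
  with rho_pos show ?thesis by blast
qed

section \<open>Germs in a chart\<close>

lemma germ_eq_chartD:
  assumes "germ_eq R p f g" "p \<in> torus R"
  shows "\<exists>T. open T \<and> 0 \<in> T \<and> (\<forall>x\<in>T. f (translate R x p) = g (translate R x p))"
proof -
  obtain U where U: "open_reg R U" "p \<in> U" "\<forall>h\<in>U. f h = g h" using assms(1) unfolding germ_eq_def by blast
  then show ?thesis
    using open_chart_preimage[OF _ assms(2), of U]
    by (intro exI[of _ "(\<lambda>x. translate R x p) -` U"]) (auto simp: open_reg_def)
qed

lemma open_reg_chart_image:
  assumes "openin (top_of_set (torus R)) ((\<lambda>u. translate R u p) ` V)"
    "V \<subseteq> (\<lambda>x. translate R x p) -` torus_reg R" "0 \<in> V"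
  shows "open_reg R ((\<lambda>u. translate R u p) ` V)" "p \<in> (\<lambda>u. translate R u p) ` V"
proof -
  show "open_reg R ((\<lambda>u. translate R u p) ` V)" using assms(1,2) unfolding open_reg_def by blast
  have "translate R 0 p \<in> (\<lambda>u. translate R u p) ` V" using assms(3) by (rule imageI)
  then show "p \<in> (\<lambda>u. translate R u p) ` V" by simp
qed

text \<open>\<open>chart_exists\<close> supplies, inside \<open>T\<close>, a neighbourhood of 0
  whose image is open in the torus.\<close>

lemma germ_eq_chartI:
  assumes T: "open T" "0 \<in> T" and eq: "\<And>x. x \<in> T \<Longrightarrow> f (translate R x p) = g (translate R x p)"
    and p: "p \<in> torus_reg R"
  shows "germ_eq R p f g"
proof -
  have pt: "p \<in> torus R" using p by (simp add: torus_reg_def)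
  have "open (T \<inter> (\<lambda>x. translate R x p) -` torus_reg R)"
    "0 \<in> T \<inter> (\<lambda>x. translate R x p) -` torus_reg R"
    using T p chart_preimage_reg[OF pt] by auto
  then obtain \<delta> where \<delta>: "\<delta> > 0" "ball 0 \<delta> \<subseteq> T \<inter> (\<lambda>x. translate R x p) -` torus_reg R"
    using open_contains_ball by blast
  obtain V where V: "open V" "0 \<in> V" "V \<subseteq> ball 0 \<delta>"
    "openin (top_of_set (torus R)) ((\<lambda>u. translate R u p) ` V)"
    using chart_exists[OF R pt \<delta>(1)] by blast
  have "V \<subseteq> (\<lambda>x. translate R x p) -` torus_reg R" using V(3) \<delta>(2) by blast
  note U = open_reg_chart_image[OF V(4) this V(2)]
  moreover have "f h = g h" if "h \<in> (\<lambda>u. translate R u p) ` V" for h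
    using that eq V(3) \<delta>(2) by blast
  ultimately show ?thesis unfolding germ_eq_def by blast
qed

section \<open>The two implications\<close>

lemma integrable_imp_curvature_eq:
  assumes I: "integrable_system R Rp k a b"
  shows curvature_eq
  unfolding curvature_eq_def
proof (intro ballI allI)
  fix p u v j i assume p: "p \<in> torus_reg R"
  have pt: "p \<in> torus R" using p by (simp add: torus_reg_def)
  let ?d = "CARD('n) + 1"
  obtain F where F: "\<And>i. i < ?d \<Longrightarrow> F i \<in> local_solutions R Rp k a b p"
    and indep: "\<And>c i. germ_eq R p (\<lambda>h. \<Sum>i<?d. c i * F i h) (\<lambda>h. 0) \<Longrightarrow> i < ?d \<Longrightarrow> c i = (0::complex)"
    using I p unfolding integrable_system_def has_germ_dim_def by blast
  have "\<forall>i. \<exists>U. i < ?d \<longrightarrow> open_reg R U \<and> p \<in> U \<and> solution R Rp k a b U (F i)"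
    using F unfolding local_solutions_def by blast
  then obtain U where U: "\<And>i. i < ?d \<Longrightarrow> open_reg R (U i) \<and> p \<in> U i \<and> solution R Rp k a b (U i) (F i)"
    by metis
  define X where "X = (\<Inter>i\<in>{..<?d}. (\<lambda>x. translate R x p) -` U i)"
  have X: "open X" unfolding X_def
    by (intro open_INT ballI open_chart_preimage[OF _ pt]) (use U in \<open>auto simp: open_reg_def\<close>)
  have X0: "0 \<in> X" using U by (simp add: X_def)
  define g where "g i x = F i (translate R x p)" for i x
  have g: "chart_solution p X (g i)" if "i < ?d" for i
    using chart_solution_subset[OF solution_chart[OF _ pt] X, of "U i" "F i"] U[OF that] that
    by (auto simp: g_def[abs_def] X_def)
  have sub: "X \<subseteq> (\<lambda>x. translate R x p) -` torus_reg R" using g[of 0] by (simp add: chart_solution_def)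
  have gh: "holo_on X (g i)" if "i < ?d" for i using g[OF that] by (simp add: chart_solution_def)
  have "card (UNIV :: 'n option set) = card {..<?d}" by simp
  then obtain e where e: "bij_betw e (UNIV :: 'n option set) {..<?d}"
    using finite_same_card_bij[OF finite finite_lessThan] by blast
  have ed: "e s < ?d" for s using e by (auto simp: bij_betw_def)
  \<comment> \<open>Sends coefficients to the jet at 0 of the combination. \<open>L\<close> maps a
    space of dimension \<open>n + 1\<close> to itself, so injectivity, from uniqueness and the
    independence of the germs, gives surjectivity.\<close>
  define L where "L c = (\<chi> r. \<Sum>s\<in>UNIV. c $ s * jet (g (e s)) r 0)" for c :: "complex ^ 'n option"
  have Llin: "Vector_Spaces.linear (*s) (*s) L"
    unfolding Vector_Spaces.linear_iff
    by (intro conjI allI vec.vector_space_axioms)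
       (simp_all add: L_def vec_eq_iff algebra_simps sum.distrib sum_distrib_left)
  interpret L: Vector_Spaces.linear "(*s)" "(*s)" L by (rule Llin)
  have comb: "chart_solution p X (\<lambda>x. \<Sum>s\<in>UNIV. c $ s * g (e s) x)"
    "jet (\<lambda>x. \<Sum>s\<in>UNIV. c $ s * g (e s) x) r 0 = L c $ r" for c r
  proof -
    show "chart_solution p X (\<lambda>x. \<Sum>s\<in>UNIV. c $ s * g (e s) x)"
      by (rule chart_solution_sum[OF X sub g[OF ed]])
    have "jet (\<lambda>x. \<Sum>s\<in>UNIV. c $ s * g (e s) x) r 0 = (\<Sum>s\<in>UNIV. c $ s * jet (g (e s)) r 0)"
      by (rule jet_sum[OF X0 gh[OF ed] X])
    then show "jet (\<lambda>x. \<Sum>s\<in>UNIV. c $ s * g (e s) x) r 0 = L c $ r" by (simp add: L_def)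
  qed
  have "c = 0" if Lc: "L c = 0" for c
  proof -
    obtain \<rho> where \<rho>: "\<rho> > 0" "ball 0 \<rho> \<subseteq> X" "\<And>x. x \<in> ball 0 \<rho> \<Longrightarrow> (\<Sum>s\<in>UNIV. c $ s * g (e s) x) = 0"
      using chart_solution_zero[OF comb(1)[of c] X0 pt] comb(2)[of c] Lc by auto
    define c' where "c' i = c $ (inv_into UNIV e i)" for i
    have ie: "inv_into UNIV e (e s) = s" for s using e by (simp add: bij_betw_def)
    have "germ_eq R p (\<lambda>h. \<Sum>i<?d. c' i * F i h) (\<lambda>h. 0)"
    proof (rule germ_eq_chartI[OF open_ball _ _ p])
      fix x assume x: "x \<in> ball (0 :: complex ^ 'n) \<rho>"
      have "(\<Sum>i<?d. c' i * F i (translate R x p)) = (\<Sum>s\<in>UNIV. c' (e s) * F (e s) (translate R x p))"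
        using sum.reindex_bij_betw[OF e, of "\<lambda>i. c' i * F i (translate R x p)"] by simp
      then show "(\<Sum>i<?d. c' i * F i (translate R x p)) = 0"
        using \<rho>(3)[OF x] by (simp add: c'_def ie g_def)
    qed (use \<rho> in auto)
    then have "c' (e s) = 0" for s using indep ed by blast
    then show "c = 0" by (simp add: c'_def ie vec_eq_iff)
  qed
  then have "inj L" using L.inj_iff_eq_0 by blast
  then have "surj L" by (rule vec.linear_inj_imp_surj[OF Llin])
  \<comment> \<open>The chosen jet has value 0, which removes the term with \<open>a\<close> and
    \<open>christoffel\<close>, and a single nonzero derivative, which isolates component
    \<open>i\<close>.\<close>
  then obtain c where c: "L c = axis (Some i) 1" by (metis surjD)
  define G where "G x = (\<Sum>s\<in>UNIV. c $ s * g (e s) x)" for x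
  have Gs: "chart_solution p X G" and Gj: "jet G r 0 = axis (Some i) 1 $ r" for r
    using comb[of c] c by (simp_all add: G_def[abs_def])
  have d: "ddir (axis m 1) G 0 = (if m = i then 1 else 0)" for m
    using Gj[of "Some m"] by (simp add: axis_def)
  have pick: "(\<Sum>m\<in>UNIV. ddir (axis m 1) G 0 * y m) = y i" for y
    by (simp add: d if_distrib[of "\<lambda>z. z * _"] cong: if_cong)
  have "G 0 = 0" using Gj[of None] by (simp add: axis_def)
  then show "flatness p u v (axis j 1) i = a u (axis j 1) * v $ i - a v (axis j 1) * u $ i"
    using chart_solution_compatible[OF Gs X0 pt, of u "axis j 1" v] unfolding pick by simp
qed

lemma curvature_eq_imp_integrable:
  assumes S: curvature_eq
  shows "integrable_system R Rp k a b"
  unfolding integrable_system_def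
proof
  fix p assume p: "p \<in> torus_reg R"
  have pt: "p \<in> torus R" using p by (simp add: torus_reg_def)
  let ?d = "CARD('n) + 1"
  let ?\<chi> = "\<lambda>u. translate R u p"
  obtain \<rho> where \<rho>: "\<rho> > 0"
    and ex: "\<And>c. \<exists>g. chart_solution p (ball 0 \<rho>) g \<and> (\<forall>r. jet g r 0 = c r)"
    using chart_solutions_exist[OF S p] by blast
  \<comment> \<open>The solutions with unit jets will be the basis.\<close>
  have "\<forall>s. \<exists>g. chart_solution p (ball 0 \<rho>) g \<and> (\<forall>r. jet g r 0 = (if r = s then 1 else 0))"
    by (intro allI ex)
  then obtain G where G: "\<And>s. chart_solution p (ball 0 \<rho>) (G s)"
    and Gj: "\<And>s r. jet (G s) r 0 = (if r = s then 1 else 0)" by metis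
  obtain V where V: "open V" "0 \<in> V" "V \<subseteq> ball 0 \<rho>" "inj_on ?\<chi> V"
    "openin (top_of_set (torus R)) (?\<chi> ` V)"
    using chart_exists[OF R pt \<rho>] by blast
  have sub: "V \<subseteq> ?\<chi> -` torus_reg R" using G V(3) unfolding chart_solution_def by blast
  note U = open_reg_chart_image[OF V(5) sub V(2)]
  have GV: "chart_solution p V (G s)" for s by (rule chart_solution_subset[OF G V(1,3)])
  have Gh: "holo_on V (G s)" for s using GV by (simp add: chart_solution_def)
  have "card {..<?d} = card (UNIV :: 'n option set)" by simp
  then obtain e where e: "bij_betw e {..<?d} (UNIV :: 'n option set)"
    using finite_same_card_bij[OF finite_lessThan finite] by blast
  define F where "F i h = G (e i) (the_inv_into V ?\<chi> h)" for i h
  have Fx: "F i (?\<chi> x) = G (e i) x" if "x \<in> V" for i x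
    unfolding F_def by (simp only: the_inv_into_f_f[OF V(4) that])
  \<comment> \<open>Coefficients are recovered as jet components, which yields both the independence
    and the coefficients of a given solution.\<close>
  have jF: "jet (\<lambda>x. \<Sum>i<?d. c i * G (e i) x) (e l) 0 = c l" if l: "l < ?d" for c l
  proof -
    have "jet (\<lambda>x. \<Sum>i<?d. c i * G (e i) x) (e l) 0 = (\<Sum>i<?d. c i * jet (G (e i)) (e l) 0)"
      by (rule jet_sum[OF V(2) Gh V(1)])
    also have "\<dots> = (\<Sum>i<?d. c i * (if e l = e i then 1 else 0))" by (simp only: Gj)
    also have "\<dots> = (\<Sum>i<?d. if i = l then c i else 0)"
      using e l by (intro sum.cong) (auto simp: bij_betw_def inj_on_def)
    finally show ?thesis using l by simp
  qed
  show "has_germ_dim R p (local_solutions R Rp k a b p) ?d"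
    unfolding has_germ_dim_def
  proof (intro exI[of _ F] conjI allI impI ballI)
    fix i assume "i < ?d"
    have "solution R Rp k a b (?\<chi> ` V) (F i)"
      using chart_solution_solution[OF V(1,4) GV[of "e i"]] by (simp add: F_def[abs_def])
    then show "F i \<in> local_solutions R Rp k a b p" using U unfolding local_solutions_def by blast
  next
    fix c i assume "germ_eq R p (\<lambda>h. \<Sum>i<?d. c i * F i h) (\<lambda>h. 0)" and i: "i < ?d"
    from germ_eq_chartD[OF this(1) pt] obtain T where T: "open T" "0 \<in> T"
      "\<And>x. x \<in> T \<Longrightarrow> (\<Sum>i<?d. c i * F i (?\<chi> x)) = 0" by auto
    have "jet (\<lambda>x. \<Sum>i<?d. c i * G (e i) x) (e i) 0 = jet (\<lambda>x. 0) (e i) 0"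
    proof (rule jet_cong)
      show "open (T \<inter> V)" "0 \<in> T \<inter> V" using T V by auto
      fix y assume "y \<in> T \<inter> V"
      then show "(\<Sum>i<?d. c i * G (e i) y) = 0" using T(3)[of y] Fx[of y] by simp
    qed
    then show "c i = 0" using jF[OF i] by simp
  next
    fix f assume "f \<in> local_solutions R Rp k a b p"
    then obtain W where W: "open_reg R W" "p \<in> W" "solution R Rp k a b W f"
      unfolding local_solutions_def by blast
    define g where "g x = f (?\<chi> x)" for x
    have gs: "chart_solution p (?\<chi> -` W) g"
      using solution_chart[OF W(1) pt W(3)] by (simp add: g_def[abs_def])
    then have oW: "open (?\<chi> -` W)" using holo_on_open unfolding chart_solution_def by blast
    define T where "T = V \<inter> ?\<chi> -` W"
    have T: "open T" "0 \<in> T" using V W oW by (simp_all add: T_def open_Int)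
    define c where "c i = jet g (e i) 0" for i
    \<comment> \<open>The difference of \<open>f\<close> in the chart and its candidate expansion is
      written as a sum over the two truth values, so that \<open>chart_solution_sum\<close> and
      \<open>jet_sum\<close> apply to it.\<close>
    define D where "D t = (if t then g else (\<lambda>x. \<Sum>i<?d. c i * G (e i) x))" for t
    have D: "chart_solution p T (D t)" for t
    proof (cases t)
      case True
      then show ?thesis using chart_solution_subset[OF gs T(1)] by (simp add: D_def T_def)
    next
      case False
      have "chart_solution p V (\<lambda>x. \<Sum>i<?d. c i * G (e i) x)"
        by (rule chart_solution_sum[OF V(1) sub GV])
      then show ?thesis using False chart_solution_subset[OF _ T(1)] by (simp add: D_def T_def)
    qed
    have subT: "T \<subseteq> ?\<chi> -` torus_reg R" using sub by (auto simp: T_def)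
    let ?w = "\<lambda>t. if t then 1 else (-1 :: complex)"
    have s: "chart_solution p T (\<lambda>x. \<Sum>t\<in>UNIV. ?w t * D t x)"
      by (rule chart_solution_sum[OF T(1) subT D])
    have Dh: "holo_on T (D t)" for t using D by (simp add: chart_solution_def)
    have "jet (\<lambda>x. \<Sum>t\<in>UNIV. ?w t * D t x) r 0 = 0" for r
    proof -
      obtain l where l: "l < ?d" "r = e l" using e unfolding bij_betw_def by (metis UNIV_I imageE lessThan_iff)
      have "jet (\<lambda>x. \<Sum>t\<in>UNIV. ?w t * D t x) r 0 = (\<Sum>t\<in>UNIV. ?w t * jet (D t) r 0)"
        by (rule jet_sum[OF T(2) Dh T(1)])
      also have "\<dots> = jet g r 0 - jet (\<lambda>x. \<Sum>i<?d. c i * G (e i) x) r 0"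
        by (simp add: UNIV_bool D_def)
      finally have "jet (\<lambda>x. \<Sum>t\<in>UNIV. ?w t * D t x) r 0 = jet g r 0 - jet (\<lambda>x. \<Sum>i<?d. c i * G (e i) x) r 0" .
      then show ?thesis using jF[OF l(1), of c] by (simp add: l(2) c_def)
    qed
    from chart_solution_zero[OF s T(2) pt this] obtain \<sigma> where \<sigma>: "\<sigma> > 0" "ball 0 \<sigma> \<subseteq> T"
      "\<And>x. x \<in> ball 0 \<sigma> \<Longrightarrow> (\<Sum>t\<in>UNIV. ?w t * D t x) = 0" by blast
    have "germ_eq R p f (\<lambda>h. \<Sum>i<?d. c i * F i h)"
    proof (rule germ_eq_chartI[OF open_ball _ _ p])
      fix x assume x: "x \<in> ball (0 :: complex ^ 'n) \<sigma>"
      then have xV: "x \<in> V" using \<sigma>(2) by (auto simp: T_def)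
      have "(\<Sum>t\<in>UNIV. ?w t * D t x) = g x - (\<Sum>i<?d. c i * G (e i) x)"
        by (simp add: UNIV_bool D_def)
      then have "g x - (\<Sum>i<?d. c i * G (e i) x) = 0" using \<sigma>(3)[OF x] by (simp only:)
      then show "f (?\<chi> x) = (\<Sum>i<?d. c i * F i (?\<chi> x))"
        by (simp only: g_def Fx[OF xV] right_minus_eq)
    qed (use \<sigma> in auto)
    then show "\<exists>c. germ_eq R p f (\<lambda>h. \<Sum>i<?d. c i * F i h)" by blast
  qed
qed

end

theorem theorem2p9:
  fixes R Rp :: "(real ^ 'n) set"
    and k :: "real ^ 'n \<Rightarrow> complex"
    and a :: "complex ^ 'n \<Rightarrow> complex ^ 'n \<Rightarrow> complex"
    and b :: "complex ^ 'n \<Rightarrow> complex ^ 'n \<Rightarrow> complex ^ 'n"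
  assumes "root_system R" and "reduced_roots R" and "irreducible_roots R"
    and "positive_system R Rp"
    and "\<And>w \<alpha>. w \<in> weyl_group R \<Longrightarrow> \<alpha> \<in> R \<Longrightarrow> k (w \<alpha>) = k \<alpha>"
    and "sym_bilinear (*) a"
    and "\<And>w u v. w \<in> weyl_group R \<Longrightarrow> a (complexify w u) (complexify w v) = a u v"
    and "sym_bilinear (*s) b"
    and "\<And>w u v. w \<in> weyl_group R \<Longrightarrow>
           b (complexify w u) (complexify w v) = complexify w (b u v)"
  shows "integrable_system R Rp k a b \<longleftrightarrow>
         (\<forall>U \<zeta>. open_reg R U \<and> one_form R U \<zeta> \<longrightarrow>
            (\<forall>h\<in>U. \<forall>u v w.
               curvature R (nabla R Rp k b) \<zeta> h u v w = - wedge \<zeta> (A_field a) h u v w))"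
proof -
  have refl: "reflection \<alpha> \<in> weyl_group R" if "\<alpha> \<in> R" for \<alpha>
    using weyl_reflection[OF weyl_id that] by simp
  interpret toric_data R Rp k a b
  proof
    show "root_system R" by fact
    show "Rp \<subseteq> R" using \<open>positive_system R Rp\<close> by (auto simp: positive_system_def)
    show "sym_bilinear (*) a" "sym_bilinear (*s) b" by fact+
  qed (use assms(7,9) refl in blast)+
  show ?thesis
    unfolding curvature_eq_iff
    using integrable_imp_curvature_eq curvature_eq_imp_integrable by blast
qed

end
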